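(* Let $\Omega$ be a homogeneous structure (for a fixed relational signature) such that for each $n$ the class $\mathfrak A=\mathrm{age}(\Omega)$ contains only finitely many $n$-element structures up to isomorphism. Let $G=\mathrm{Aut}(\Omega)$ (which acts oligomorphically on $\Omega$), and let $\mathscr E$ be the stabilizer class in $G$ generated by $\Omega$. Then there is a natural ring isomorphism $\Theta(\mathfrak A)\cong\Theta(G;\mathscr E)$.
   Context: Structures. A signature is a collection $\{(R_i,n_i)\}_{i\in I}$ of relation symbols with arities $n_i\ge 1$; a structure is a set with an $n_i$-ary relation $R_i$ for each $i$. Subsets inherit induced (sub)structures; an embedding $Y\to X$ is an injection inducing an isomorphism of $Y$ with the induced substructure on its image. A structure $\Omega$ is homogeneous if every isomorphism between finite substructures of $\Omega$ extends to an automorphism of $\Omega$. The age of $\Omega$ is the class of all finite structures that embed into $\Omega$. An amalgamation of embeddings $i\colon Y\to X$, $j\colon Y\to Y'$ is a triple $(X',i',j')$ with $X'$ a structure and $i'\colon Y'\to X'$, $j'\colon X\to X'$ embeddings such that $i'\circ j=j'\circ i$ and $X'=\mathrm{im}(i')\cup\mathrm{im}(j')$; amalgamations are considered up to the evident notion of isomorphism. $\Theta(\mathfrak A)$ is the commutative ring generated by classes $[i]$ for embeddings $i\colon Y\to X$ of structures in $\mathfrak A$, with relations: (a) $[i]=1$ if $i$ is an isomorphism; (b) $[i\circ j]=[i][j]$ for composable embeddings; (c) for embeddings $i\colon Y\to X$, $j\colon Y\to Y'$ in $\mathfrak A$, if $(X'_\alpha,i'_\alpha,j'_\alpha)$, $1\le\alpha\le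 r$, are the amalgamations of $(i,j)$ in $\mathfrak A$ up to isomorphism (one from each class), then $[i]=\sum_{\alpha=1}^r[i'_\alpha]$. Groups. An action of a group on $\Omega$ is oligomorphic if it is faithful and has finitely many orbits on $\Omega^n$ for all $n\ge 0$. $G$ has the topology in which the subgroups $G(A)$ (pointwise stabilizers of finite $A\subset\Omega$) form a neighborhood basis of the identity. A set with an action of $G$ or an open subgroup is smooth if every stabilizer is open; all actions are assumed smooth. It is finitary if it has finitely many orbits. A $\hat G$-set is a set $X$ with a smooth action of some open subgroup $U$ of $G$ (a group of definition), where shrinking $U$ does not change the $\hat G$-set; it is finitary if $U$ has finitely many orbits. Maps of $\hat G$-sets are functions equivariant for some common open group of definition. For $g\in G$, $X^g$ is the same set with action $h\bullet x=(g^{-1}hg)\cdot x$. $\mathscr E$, the stabilizer class generated by $\Omega$, is the collection of all stabilizers in $G$ of points of $\Omega^n$, $n\ge 0$ (i.e. all $G(A)$, $A$ finite). For an open subgroup $U$, a $U$-set is $\mathscr E$-smooth if every stabilizer has the form $U\cap V$ with $V\in\mathscr E$; a $\hat G$-set is $\mathscr E$-smooth if it is so for some group of definition. $\Theta(G;\mathscr E)$ is the commutative ring generated by symbols $[X]$ for $\mathscr E$-smooth finitary $\hat G$-sets $X$, with relations: $[X]=[Y]$ if $X\cong Y$; $[X]=1$ for $X$ a singleton; $[X\amalg Y]=[X]+[Y]$; $[X^g]=[X]$ for $g\in G$; and $[X]=[F][Y]$ whenever $X\to Y$ is a map of transitive ($\mathscr E$-smooth) $U$-sets, $U$ an open subgroup,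 with fiber $F$ over some point. *)

theory Defs
  imports
    "HOL-Algebra.QuotRing"
    "HOL-Algebra.Group_Action"
    "HOL-Library.Poly_Mapping"
begin

section \<open>Commutative rings given by generators and relations\<close>

text \<open>
  A monomial in the indeterminates \<^typ>\<open>'g\<close> is an element of \<^typ>\<open>'g \<Rightarrow>\<^sub>0 nat\<close>, a polynomial with
  integer coefficients is an element of \<^typ>\<open>('g \<Rightarrow>\<^sub>0 nat) \<Rightarrow>\<^sub>0 int\<close> with its convolution product.
  Only indeterminates from the set \<open>S\<close> are allowed, so the ring below is \<open>\<int>[S]\<close>.
\<close>

type_synonym 'g int_mpoly = "('g \<Rightarrow>\<^sub>0 nat) \<Rightarrow>\<^sub>0 int"

definition free_comm_ring :: "'g set \<Rightarrow> 'g int_mpoly ring" where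
  "free_comm_ring S =
     \<lparr>carrier = {p. \<forall>m \<in> Poly_Mapping.keys p. Poly_Mapping.keys m \<subseteq> S},
      mult = (*), one = 1, zero = 0, add = (+)\<rparr>"

definition var :: "'g \<Rightarrow> 'g int_mpoly" where
  "var g = Poly_Mapping.single (Poly_Mapping.single g 1) 1"

text \<open>An element \<open>p - q\<close> of \<open>R\<close> imposes the relation \<open>p = q\<close>.\<close>

definition presented_ring :: "'g set \<Rightarrow> 'g int_mpoly set \<Rightarrow> 'g int_mpoly set ring" where
  "presented_ring S R = free_comm_ring S Quot (Idl\<^bsub>free_comm_ring S\<^esub> R)"

definition gen_class :: "'g set \<Rightarrow> 'g int_mpoly set \<Rightarrow> 'g \<Rightarrow> 'g int_mpoly set" where
  "gen_class S R g = (Idl\<^bsub>free_comm_ring S\<^esub> R) +>\<^bsub>free_comm_ring S\<^esub> var g"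


section \<open>Relational structures\<close>

record 'i signature =
  syms :: "'i set"
  arity :: "'i \<Rightarrow> nat"

record ('i, 'a) struc =
  dom :: "'a set"
  rel :: "'i \<Rightarrow> 'a list set"

definition is_signature :: "'i signature \<Rightarrow> bool" where
  "is_signature \<sigma> \<longleftrightarrow> (\<forall>r \<in> syms \<sigma>. 1 \<le> arity \<sigma> r)"

text \<open>The second conjunct normalises the junk values of \<^const>\<open>rel\<close> outside the signature.\<close>

definition is_structure :: "'i signature \<Rightarrow> ('i, 'a) struc \<Rightarrow> bool" where
  "is_structure \<sigma> X \<longleftrightarrow>
     (\<forall>r \<in> syms \<sigma>. rel X r \<subseteq> {xs \<in> lists (dom X). length xs = arity \<sigma> r}) \<and>
     (\<forall>r. r \<notin> syms \<sigma> \<longrightarrow> rel X r = {})"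

definition induced :: "('i, 'a) struc \<Rightarrow> 'a set \<Rightarrow> ('i, 'a) struc" where
  "induced X A = \<lparr>dom = A, rel = (\<lambda>r. rel X r \<inter> lists A)\<rparr>"

text \<open>Maps of structures are extensional functions, so that they are determined by their values
  on the domain.\<close>

definition struct_iso ::
  "'i signature \<Rightarrow> ('i, 'a) struc \<Rightarrow> ('i, 'b) struc \<Rightarrow> ('a \<Rightarrow> 'b) \<Rightarrow> bool" where
  "struct_iso \<sigma> X Y f \<longleftrightarrow>
     f \<in> extensional (dom X) \<and> bij_betw f (dom X) (dom Y) \<and>
     (\<forall>r \<in> syms \<sigma>. \<forall>xs \<in> lists (dom X). length xs = arity \<sigma> r \<longrightarrow>
        (xs \<in> rel X r \<longleftrightarrow> map f xs \<in> rel Y r))"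

definition embedding ::
  "'i signature \<Rightarrow> ('i, 'a) struc \<Rightarrow> ('i, 'b) struc \<Rightarrow> ('a \<Rightarrow> 'b) \<Rightarrow> bool" where
  "embedding \<sigma> Y X f \<longleftrightarrow>
     f \<in> dom Y \<rightarrow>\<^sub>E dom X \<and> inj_on f (dom Y) \<and> struct_iso \<sigma> Y (induced X (f ` dom Y)) f"

definition Aut :: "'i signature \<Rightarrow> ('i, 'w) struc \<Rightarrow> ('w \<Rightarrow> 'w) monoid" where
  "Aut \<sigma> \<Omega> = (BijGroup (dom \<Omega>)) \<lparr>carrier := {g. struct_iso \<sigma> \<Omega> \<Omega> g}\<rparr>"

definition homogeneous :: "'i signature \<Rightarrow> ('i, 'w) struc \<Rightarrow> bool" where
  "homogeneous \<sigma> \<Omega> \<longleftrightarrow>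
     (\<forall>A B f. finite A \<and> finite B \<and> A \<subseteq> dom \<Omega> \<and> B \<subseteq> dom \<Omega> \<and>
        struct_iso \<sigma> (induced \<Omega> A) (induced \<Omega> B) f \<longrightarrow>
        (\<exists>g \<in> carrier (Aut \<sigma> \<Omega>). \<forall>a \<in> A. g a = f a))"

text \<open>
  The members of the age are taken with domain in a type \<^typ>\<open>'b\<close>.  When \<^typ>\<open>'b\<close> is infinite,
  every finite structure has an isomorphic copy there.
\<close>

definition age :: "'i signature \<Rightarrow> ('i, 'w) struc \<Rightarrow> ('i, 'b) struc set" where
  "age \<sigma> \<Omega> = {X. is_structure \<sigma> X \<and> finite (dom X) \<and> (\<exists>f. embedding \<sigma> X \<Omega> f)}"

definition iso_rel :: "'i signature \<Rightarrow> (('i, 'b) struc \<times> ('i, 'b) struc) set" where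
  "iso_rel \<sigma> = {(X, Y). \<exists>f. struct_iso \<sigma> X Y f}"


section \<open>The ring of a class of finite structures\<close>

text \<open>A triple \<open>(Y, X, i)\<close> stands for the embedding \<open>i : Y \<rightarrow> X\<close>.\<close>

type_synonym ('i, 'b) emb = "('i, 'b) struc \<times> ('i, 'b) struc \<times> ('b \<Rightarrow> 'b)"

definition embeddings :: "'i signature \<Rightarrow> ('i, 'b) struc set \<Rightarrow> ('i, 'b) emb set" where
  "embeddings \<sigma> \<AA> = {(Y, X, i). Y \<in> \<AA> \<and> X \<in> \<AA> \<and> embedding \<sigma> Y X i}"

text \<open>Amalgamations \<open>(X', i', j')\<close> of \<open>i : Y \<rightarrow> X\<close> and \<open>j : Y \<rightarrow> Y'\<close>, with \<open>i' : Y' \<rightarrow> X'\<close> and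
  \<open>j' : X \<rightarrow> X'\<close>.\<close>

definition amalgamations ::
  "'i signature \<Rightarrow> ('i, 'b) struc set \<Rightarrow> ('i, 'b) emb \<Rightarrow> ('i, 'b) emb \<Rightarrow>
     (('i, 'b) struc \<times> ('b \<Rightarrow> 'b) \<times> ('b \<Rightarrow> 'b)) set" where
  "amalgamations \<sigma> \<AA> = (\<lambda>(Y, X, i) (_, Y', j).
     {(X', i', j'). X' \<in> \<AA> \<and> embedding \<sigma> Y' X' i' \<and> embedding \<sigma> X X' j' \<and>
        compose (dom Y) i' j = compose (dom Y) j' i \<and>
        dom X' = i' ` dom Y' \<union> j' ` dom X})"

definition amalg_iso ::
  "'i signature \<Rightarrow> ('i, 'b) emb \<Rightarrow> ('i, 'b) emb \<Rightarrow>
     ('i, 'b) struc \<times> ('b \<Rightarrow> 'b) \<times> ('b \<Rightarrow> 'b) \<Rightarrow>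
     ('i, 'b) struc \<times> ('b \<Rightarrow> 'b) \<times> ('b \<Rightarrow> 'b) \<Rightarrow> bool" where
  "amalg_iso \<sigma> = (\<lambda>(_, X, _) (_, Y', _) (X1, i1, j1) (X2, i2, j2).
     \<exists>h. struct_iso \<sigma> X1 X2 h \<and> compose (dom Y') h i1 = i2 \<and> compose (dom X) h j1 = j2)"

definition amalg_representatives ::
  "'i signature \<Rightarrow> ('i, 'b) struc set \<Rightarrow> ('i, 'b) emb \<Rightarrow> ('i, 'b) emb \<Rightarrow>
     (('i, 'b) struc \<times> ('b \<Rightarrow> 'b) \<times> ('b \<Rightarrow> 'b)) set \<Rightarrow> bool" where
  "amalg_representatives \<sigma> \<AA> i j T \<longleftrightarrow>
     finite T \<and> T \<subseteq> amalgamations \<sigma> \<AA> i j \<and>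
     (\<forall>a \<in> amalgamations \<sigma> \<AA> i j. \<exists>!t. t \<in> T \<and> amalg_iso \<sigma> i j a t)"

definition Theta_struct_rels ::
  "'i signature \<Rightarrow> ('i, 'b) struc set \<Rightarrow> ('i, 'b) emb int_mpoly set" where
  "Theta_struct_rels \<sigma> \<AA> =
     {var (Y, X, i) - 1 | Y X i. (Y, X, i) \<in> embeddings \<sigma> \<AA> \<and> struct_iso \<sigma> Y X i} \<union>
     {var (Z, X, compose (dom Z) i j) - var (Y, X, i) * var (Z, Y, j) | X Y Z i j.
        (Y, X, i) \<in> embeddings \<sigma> \<AA> \<and> (Z, Y, j) \<in> embeddings \<sigma> \<AA>} \<union>
     {var (Y, X, i) - (\<Sum>(X', i', j') \<in> T. var (Y', X', i')) | X Y Y' i j T.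
        (Y, X, i) \<in> embeddings \<sigma> \<AA> \<and> (Y, Y', j) \<in> embeddings \<sigma> \<AA> \<and>
        amalg_representatives \<sigma> \<AA> (Y, X, i) (Y, Y', j) T}"

definition Theta_struct ::
  "'i signature \<Rightarrow> ('i, 'b) struc set \<Rightarrow> ('i, 'b) emb int_mpoly set ring" where
  "Theta_struct \<sigma> \<AA> = presented_ring (embeddings \<sigma> \<AA>) (Theta_struct_rels \<sigma> \<AA>)"

definition emb_class ::
  "'i signature \<Rightarrow> ('i, 'b) struc set \<Rightarrow> ('i, 'b) emb \<Rightarrow> ('i, 'b) emb int_mpoly set" where
  "emb_class \<sigma> \<AA> i = gen_class (embeddings \<sigma> \<AA>) (Theta_struct_rels \<sigma> \<AA>) i"


section \<open>Permutation groups and their topology\<close>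

text \<open>Throughout, \<open>G\<close> is a group of permutations of the set \<open>S\<close> (a subgroup of \<^term>\<open>BijGroup S\<close>).\<close>

definition oligomorphic :: "('g, 'm) monoid_scheme \<Rightarrow> 'w set \<Rightarrow> ('g \<Rightarrow> 'w \<Rightarrow> 'w) \<Rightarrow> bool" where
  "oligomorphic G S \<phi> \<longleftrightarrow>
     faithful_action G S \<phi> \<and>
     (\<forall>n. finite (orbits G {xs \<in> lists S. length xs = n} (\<lambda>g. map (\<phi> g))))"

definition pointwise_stab :: "('w \<Rightarrow> 'w) monoid \<Rightarrow> 'w set \<Rightarrow> ('w \<Rightarrow> 'w) set" where
  "pointwise_stab G A = {g \<in> carrier G. \<forall>a \<in> A. g a = a}"

definition open_in_group :: "('w \<Rightarrow> 'w) monoid \<Rightarrow> 'w set \<Rightarrow> ('w \<Rightarrow> 'w) set \<Rightarrow> bool" where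
  "open_in_group G S U \<longleftrightarrow>
     U \<subseteq> carrier G \<and>
     (\<forall>g \<in> U. \<exists>A. finite A \<and> A \<subseteq> S \<and> g <#\<^bsub>G\<^esub> pointwise_stab G A \<subseteq> U)"

definition open_subgroup :: "('w \<Rightarrow> 'w) monoid \<Rightarrow> 'w set \<Rightarrow> ('w \<Rightarrow> 'w) set \<Rightarrow> bool" where
  "open_subgroup G S U \<longleftrightarrow> subgroup U G \<and> open_in_group G S U"

definition stabilizer_class :: "('w \<Rightarrow> 'w) monoid \<Rightarrow> 'w set \<Rightarrow> ('w \<Rightarrow> 'w) set set" where
  "stabilizer_class G S = {stabilizer G (\<lambda>g. map g) xs | xs. xs \<in> lists S}"


section \<open>Sets with an action of an open subgroup\<close>

text \<open>
  A triple \<open>(U, X, \<rho>)\<close> is a set \<open>X\<close> with an action \<open>\<rho>\<close> of \<open>U\<close>.  A \<open>\<hat>G\<close>-set is represented by such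
  a triple with \<open>U\<close> open.  A triple and its restriction to a smaller open subgroup are different
  representatives of one \<open>\<hat>G\<close>-set; they are isomorphic in the sense of \<open>hat_iso\<close> below.
\<close>

type_synonym ('w, 'x) gset = "('w \<Rightarrow> 'w) set \<times> 'x set \<times> (('w \<Rightarrow> 'w) \<Rightarrow> 'x \<Rightarrow> 'x)"

fun smooth_set :: "('w \<Rightarrow> 'w) monoid \<Rightarrow> 'w set \<Rightarrow> ('w, 'x) gset \<Rightarrow> bool" where
  "smooth_set G S (U, X, \<rho>) \<longleftrightarrow>
     open_subgroup G S U \<and> group_action (G\<lparr>carrier := U\<rparr>) X \<rho> \<and>
     (\<forall>x \<in> X. open_in_group G S (stabilizer (G\<lparr>carrier := U\<rparr>) \<rho> x))"

fun finitary :: "('w \<Rightarrow> 'w) monoid \<Rightarrow> ('w, 'x) gset \<Rightarrow> bool" where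
  "finitary G (U, X, \<rho>) \<longleftrightarrow> finite (orbits (G\<lparr>carrier := U\<rparr>) X \<rho>)"

fun E_smooth_uset :: "('w \<Rightarrow> 'w) monoid \<Rightarrow> ('w \<Rightarrow> 'w) set set \<Rightarrow> ('w, 'x) gset \<Rightarrow> bool" where
  "E_smooth_uset G \<E> (U, X, \<rho>) \<longleftrightarrow>
     (\<forall>x \<in> X. \<exists>V \<in> \<E>. stabilizer (G\<lparr>carrier := U\<rparr>) \<rho> x = U \<inter> V)"

text \<open>
  If a \<open>\<hat>G\<close>-set is \<open>\<E>\<close>-smooth for one group of definition, it is so for every smaller one.  Hence it
  suffices to look for a suitable group of definition inside the representing subgroup \<open>U\<close>.
\<close>

fun E_smooth :: "('w \<Rightarrow> 'w) monoid \<Rightarrow> 'w set \<Rightarrow> ('w \<Rightarrow> 'w) set set \<Rightarrow> ('w, 'x) gset \<Rightarrow> bool" where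
  "E_smooth G S \<E> (U, X, \<rho>) \<longleftrightarrow>
     (\<exists>W. open_subgroup G S W \<and> W \<subseteq> U \<and> E_smooth_uset G \<E> (W, X, \<rho>))"

definition hat_sets ::
  "('w \<Rightarrow> 'w) monoid \<Rightarrow> 'w set \<Rightarrow> ('w \<Rightarrow> 'w) set set \<Rightarrow> ('w, 'x) gset set" where
  "hat_sets G S \<E> = {P. smooth_set G S P \<and> finitary G P \<and> E_smooth G S \<E> P}"

fun hat_map ::
  "('w \<Rightarrow> 'w) monoid \<Rightarrow> 'w set \<Rightarrow> ('w, 'x) gset \<Rightarrow> ('w, 'y) gset \<Rightarrow> ('x \<Rightarrow> 'y) \<Rightarrow> bool" where
  "hat_map G S (U, X, \<rho>) (U', Y, \<rho>') f \<longleftrightarrow>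
     f \<in> X \<rightarrow> Y \<and>
     (\<exists>W. open_subgroup G S W \<and> W \<subseteq> U \<inter> U' \<and> (\<forall>g \<in> W. \<forall>x \<in> X. f (\<rho> g x) = \<rho>' g (f x)))"

abbreviation points :: "('w, 'x) gset \<Rightarrow> 'x set" where
  "points P \<equiv> fst (snd P)"

definition hat_iso ::
  "('w \<Rightarrow> 'w) monoid \<Rightarrow> 'w set \<Rightarrow> ('w, 'x) gset \<Rightarrow> ('w, 'y) gset \<Rightarrow> bool" where
  "hat_iso G S P Q \<longleftrightarrow> (\<exists>f. hat_map G S P Q f \<and> bij_betw f (points P) (points Q))"

text \<open>\<open>R\<close> is a disjoint union of \<open>P\<close> and \<open>Q\<close>, with coproduct injections \<open>a\<close> and \<open>b\<close>.\<close>

definition hat_coproduct ::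
  "('w \<Rightarrow> 'w) monoid \<Rightarrow> 'w set \<Rightarrow> ('w, 'x) gset \<Rightarrow> ('w, 'x) gset \<Rightarrow> ('w, 'x) gset \<Rightarrow> bool" where
  "hat_coproduct G S R P Q \<longleftrightarrow>
     (\<exists>a b. hat_map G S P R a \<and> hat_map G S Q R b \<and>
        inj_on a (points P) \<and> inj_on b (points Q) \<and>
        a ` points P \<inter> b ` points Q = {} \<and> a ` points P \<union> b ` points Q = points R)"

text \<open>\<open>X\<^sup>g\<close>: the conjugate subgroup \<open>g U g\<^sup>-\<^sup>1\<close> acts by \<open>h \<bullet> x = (g\<^sup>-\<^sup>1 h g) \<cdot> x\<close>.\<close>

fun hat_conj :: "('w \<Rightarrow> 'w) monoid \<Rightarrow> ('w \<Rightarrow> 'w) \<Rightarrow> ('w, 'x) gset \<Rightarrow> ('w, 'x) gset" where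
  "hat_conj G g (U, X, \<rho>) =
     ((\<lambda>u. g \<otimes>\<^bsub>G\<^esub> u \<otimes>\<^bsub>G\<^esub> inv\<^bsub>G\<^esub> g) ` U, X, \<lambda>h. \<rho> (inv\<^bsub>G\<^esub> g \<otimes>\<^bsub>G\<^esub> h \<otimes>\<^bsub>G\<^esub> g))"

text \<open>The empty set is not transitive, although \<^const>\<open>transitive_action\<close> allows it.\<close>

fun transitive_E_smooth_uset ::
  "('w \<Rightarrow> 'w) monoid \<Rightarrow> 'w set \<Rightarrow> ('w \<Rightarrow> 'w) set set \<Rightarrow> ('w, 'x) gset \<Rightarrow> bool" where
  "transitive_E_smooth_uset G S \<E> (U, X, \<rho>) \<longleftrightarrow>
     smooth_set G S (U, X, \<rho>) \<and> X \<noteq> {} \<and> transitive_action (G\<lparr>carrier := U\<rparr>) X \<rho> \<and>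
     E_smooth_uset G \<E> (U, X, \<rho>)"

text \<open>The fiber of \<open>p : X \<rightarrow> Y\<close> over \<open>y\<close> is a set with an action of the stabilizer of \<open>y\<close> in \<open>U\<close>; the
  restriction makes the action extensional, as \<^const>\<open>group_action\<close> demands.\<close>

definition fiber ::
  "('w \<Rightarrow> 'w) monoid \<Rightarrow> ('w \<Rightarrow> 'w) set \<Rightarrow> 'x set \<Rightarrow> (('w \<Rightarrow> 'w) \<Rightarrow> 'x \<Rightarrow> 'x) \<Rightarrow>
     (('w \<Rightarrow> 'w) \<Rightarrow> 'y \<Rightarrow> 'y) \<Rightarrow> ('x \<Rightarrow> 'y) \<Rightarrow> 'y \<Rightarrow> ('w, 'x) gset" where
  "fiber G U X \<rho> \<rho>' p y =
     (stabilizer (G\<lparr>carrier := U\<rparr>) \<rho>' y, {x \<in> X. p x = y}, \<lambda>g. restrict (\<rho> g) {x \<in> X. p x = y})"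


section \<open>The ring of a permutation group relative to a stabilizer class\<close>

definition Theta_group_rels ::
  "('w \<Rightarrow> 'w) monoid \<Rightarrow> 'w set \<Rightarrow> ('w \<Rightarrow> 'w) set set \<Rightarrow> ('w, 'x) gset int_mpoly set" where
  "Theta_group_rels G S \<E> =
     {var P - var Q | P Q. P \<in> hat_sets G S \<E> \<and> Q \<in> hat_sets G S \<E> \<and> hat_iso G S P Q} \<union>
     {var P - 1 | P. P \<in> hat_sets G S \<E> \<and> is_singleton (points P)} \<union>
     {var R - (var P + var Q) | R P Q.
        R \<in> hat_sets G S \<E> \<and> P \<in> hat_sets G S \<E> \<and> Q \<in> hat_sets G S \<E> \<and> hat_coproduct G S R P Q} \<union>
     {var (hat_conj G g P) - var P | g P. g \<in> carrier G \<and> P \<in> hat_sets G S \<E>} \<union>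
     {var (U, X, \<rho>) - var (fiber G U X \<rho> \<rho>' p y) * var (U, Y, \<rho>') | U X \<rho> Y \<rho>' p y.
        transitive_E_smooth_uset G S \<E> (U, X, \<rho>) \<and> transitive_E_smooth_uset G S \<E> (U, Y, \<rho>') \<and>
        p \<in> X \<rightarrow> Y \<and> (\<forall>g \<in> U. \<forall>x \<in> X. p (\<rho> g x) = \<rho>' g (p x)) \<and> y \<in> Y}"

text \<open>
  The \<open>\<hat>G\<close>-sets have their points in a type \<^typ>\<open>'x\<close>.  An orbit of a subgroup \<open>U\<close> with stabilizer
  \<open>U \<inter> V\<close>, where \<open>V\<close> is the stabilizer of a tuple \<open>xs\<close>, is isomorphic to the \<open>U\<close>-orbit of \<open>xs\<close>.  Hence, for \<open>\<E>\<close>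
  the stabilizer class of \<open>S\<close>, every finitary \<open>\<E>\<close>-smooth \<open>\<hat>G\<close>-set is isomorphic to one with points
  in \<^typ>\<open>'x\<close> as soon as \<^typ>\<open>nat \<times> 'w list\<close> injects into \<^typ>\<open>'x\<close>.
\<close>

definition Theta_group ::
  "('w \<Rightarrow> 'w) monoid \<Rightarrow> 'w set \<Rightarrow> ('w \<Rightarrow> 'w) set set \<Rightarrow> ('w, 'x) gset int_mpoly set ring" where
  "Theta_group G S \<E> = presented_ring (hat_sets G S \<E>) (Theta_group_rels G S \<E>)"

definition set_class ::
  "('w \<Rightarrow> 'w) monoid \<Rightarrow> 'w set \<Rightarrow> ('w \<Rightarrow> 'w) set set \<Rightarrow> ('w, 'x) gset \<Rightarrow>
     ('w, 'x) gset int_mpoly set" where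
  "set_class G S \<E> P = gen_class (hat_sets G S \<E>) (Theta_group_rels G S \<E>) P"


section \<open>The comparison map\<close>

text \<open>
  For \<open>i : Y \<rightarrow> X\<close> and \<open>e : Y \<rightarrow> \<Omega>\<close>, the set of embeddings \<open>f : X \<rightarrow> \<Omega>\<close> with \<open>f \<circ> i = e\<close>, acted upon by
  the pointwise stabilizer of \<open>e(Y)\<close> through composition.  This is the fiber over \<open>e\<close> of the map
  from embeddings of \<open>X\<close> to embeddings of \<open>Y\<close> given by precomposition with \<open>i\<close>.
\<close>

fun extension_set ::
  "'i signature \<Rightarrow> ('i, 'w) struc \<Rightarrow> ('i, 'b) emb \<Rightarrow> ('b \<Rightarrow> 'w) \<Rightarrow> ('w, 'b \<Rightarrow> 'w) gset" where
  "extension_set \<sigma> \<Omega> (Y, X, i) e =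
     (let F = {f. embedding \<sigma> X \<Omega> f \<and> compose (dom Y) f i = e}
      in (pointwise_stab (Aut \<sigma> \<Omega>) (e ` dom Y), F, \<lambda>g. \<lambda>f \<in> F. compose (dom X) g f))"

end

theory Submission
  imports Defs
begin

text \<open>
  Write \<open>S\<close> for the domain of the homogeneous structure \<open>\<Omega>\<close> and \<open>G(A)\<close> for the pointwise stabilizer
  of a finite \<open>A \<subseteq> S\<close>.  A \<^emph>\<open>measure\<close> with values in a commutative ring assigns to finite sets
  \<open>A \<subseteq> B \<subseteq> S\<close> a ring element \<open>mu A B\<close>, to be thought of as the size of \<open>G(A)/G(B)\<close>, such that
  \<open>mu A A = 1\<close>, \<open>mu A C = mu A B * mu B C\<close>, \<open>mu (gA) (gB) = mu A B\<close>, and \<open>mu A B\<close> is the sum of the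
  elements \<open>mu A' (A' \<union> tB)\<close> whenever \<open>A \<subseteq> A'\<close> and \<open>t\<close> runs over representatives of the
  \<open>G(A')\<close>-orbits on \<open>G(A)/G(B)\<close>.  The theorem holds because both rings are the universal target of a
  measure.

  For the ring of the age: every embedding \<open>i : Y \<rightarrow> X\<close> becomes an inclusion \<open>A \<subseteq> B\<close> once \<open>X\<close> is
  embedded into \<open>\<Omega>\<close>, and by homogeneity two ways of doing so differ by an element of \<open>G\<close>.  So an
  invariant function of inclusions is the same as a function of embeddings that is compatible with
  isomorphisms.  Again by homogeneity, the amalgamations of \<open>A \<subseteq> B\<close> with \<open>A \<subseteq> A'\<close> are the different
  positions of a translate \<open>tB\<close>, \<open>t \<in> G(A)\<close>, relative to \<open>A'\<close>, that is, the \<open>G(A')\<close>-orbits on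
  \<open>G(A)/G(B)\<close> (\<open>placed_iso_iff\<close>).  Hence the classes of inclusions form a measure, and every measure
  respects the defining relations (\<open>phi_struct_rels\<close>).

  For the ring of the group: after shrinking the group of definition to a small \<open>G(A)\<close>, an
  \<open>\<E>\<close>-smooth finitary set is a finite disjoint union of orbits isomorphic to \<open>G(A)/G(B)\<close> with
  \<open>A \<subseteq> B\<close>, and a measure gives it the size \<open>psi\<close>, the sum of the corresponding \<open>mu A B\<close>.  The orbit
  knows only the group \<open>G(B)\<close>, but this suffices (\<open>mu_same_stab\<close>): if \<open>G(B) = G(C)\<close> and
  \<open>B \<subseteq> C\<close>, then \<open>G(C)\<close> has one orbit on the one-point set \<open>G(B)/G(C)\<close>, and the sum formula reads
  \<open>mu B C = mu C C = 1\<close>.  The sum formula also shows that the size is independent of \<open>A\<close>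
  (\<open>psi_refine\<close>), and multiplicativity of \<open>mu\<close> gives the relation for fibrations
  (\<open>psi_set_fiber\<close>).  Conversely the classes \<open>nu A B\<close> of \<open>G(A)/G(B)\<close> form a measure, and every
  smooth set is the sum of the classes of its orbits (\<open>psi_set_nu\<close>).

  Applying each construction to the universal measure on the other side gives two ring homomorphisms,
  which exchange the class of the inclusion \<open>A \<subseteq> B\<close> with the class of \<open>G(A)/G(B)\<close>.  They are inverse to
  each other because these classes generate.  Finally \<open>G(A)/G(B)\<close> is the set of extensions
  of the embedding of \<open>A\<close> to an embedding of \<open>B\<close> (\<open>extension_set_iso\<close>), which is the naturality claim.
\<close>



section \<open>Congruences and presented rings\<close>

text \<open>
  Calculations in a presented ring are carried out on representing polynomials, up to this relation.
  It is only a partial equivalence relation, since polynomials that use indeterminates outside the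
  allowed set represent nothing.
\<close>

locale ring_congruence =
  fixes eqv :: "'r::comm_ring_1 \<Rightarrow> 'r \<Rightarrow> bool" (infix "\<approx>" 50)
  assumes eqv_sym: "a \<approx> b \<Longrightarrow> b \<approx> a"
    and eqv_trans [trans]: "a \<approx> b \<Longrightarrow> b \<approx> c \<Longrightarrow> a \<approx> c"
    and eqv_add: "a \<approx> b \<Longrightarrow> c \<approx> d \<Longrightarrow> a + c \<approx> b + d"
    and eqv_mult: "a \<approx> b \<Longrightarrow> c \<approx> d \<Longrightarrow> a * c \<approx> b * d"
    and eqv_minus: "a \<approx> b \<Longrightarrow> - a \<approx> - b"
    and eqv_one: "1 \<approx> 1"
begin

lemma eqv_reflI: "a \<approx> b \<Longrightarrow> a \<approx> a" "a \<approx> b \<Longrightarrow> b \<approx> b"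
  by (blast intro: eqv_sym eqv_trans)+

lemma eqv_zero: "0 \<approx> 0"
  using eqv_add[OF eqv_one eqv_minus[OF eqv_one]] by simp

lemma eqv_diff: "a \<approx> b \<Longrightarrow> c \<approx> d \<Longrightarrow> a - c \<approx> b - d"
  using eqv_add[of a b "- c" "- d"] eqv_minus by simp

lemma eqv_sum: "(\<And>i. i \<in> I \<Longrightarrow> f i \<approx> g i) \<Longrightarrow> sum f I \<approx> sum g I"
  by (induction I rule: infinite_finite_induct) (auto intro: eqv_zero eqv_add)

lemma eqv_prod: "(\<And>i. i \<in> I \<Longrightarrow> f i \<approx> g i) \<Longrightarrow> prod f I \<approx> prod g I"
  by (induction I rule: infinite_finite_induct) (auto intro: eqv_one eqv_mult)

lemma eqv_power: "a \<approx> b \<Longrightarrow> a ^ n \<approx> b ^ n"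
  by (induction n) (auto intro: eqv_one eqv_mult)

end

lemma free_comm_ring_simps [simp]:
  "mult (free_comm_ring S) = (*)" "one (free_comm_ring S) = 1"
  "zero (free_comm_ring S) = 0" "add (free_comm_ring S) = (+)"
  by (auto simp: free_comm_ring_def)

lemma carrier_free_comm_ring:
  "p \<in> carrier (free_comm_ring S) \<longleftrightarrow> Poly_Mapping.keys p \<subseteq> {m. Poly_Mapping.keys m \<subseteq> S}"
  by (auto simp: free_comm_ring_def)

lemma free_add: "p \<in> carrier (free_comm_ring S) \<Longrightarrow> q \<in> carrier (free_comm_ring S) \<Longrightarrow>
    p + q \<in> carrier (free_comm_ring S)"
  unfolding carrier_free_comm_ring using Poly_Mapping.keys_add[of p q] by blast

lemma free_minus: "p \<in> carrier (free_comm_ring S) \<Longrightarrow> - p \<in> carrier (free_comm_ring S)"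
  unfolding carrier_free_comm_ring by simp

lemma free_diff: "p \<in> carrier (free_comm_ring S) \<Longrightarrow> q \<in> carrier (free_comm_ring S) \<Longrightarrow>
    p - q \<in> carrier (free_comm_ring S)"
  using free_add[of p S "- q"] free_minus[of q S] by simp

lemma free_mult:
  assumes "p \<in> carrier (free_comm_ring S)" "q \<in> carrier (free_comm_ring S)"
  shows "p * q \<in> carrier (free_comm_ring S)"
  unfolding carrier_free_comm_ring
proof
  fix m assume "m \<in> Poly_Mapping.keys (p * q)"
  then obtain a b where "a \<in> Poly_Mapping.keys p" "b \<in> Poly_Mapping.keys q" "m = a + b"
    using keys_mult[of p q] by blast
  then show "m \<in> {m. Poly_Mapping.keys m \<subseteq> S}"
    using assms Poly_Mapping.keys_add[of a b] unfolding carrier_free_comm_ring by blast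
qed

lemma free_zero: "0 \<in> carrier (free_comm_ring S)" and free_one: "1 \<in> carrier (free_comm_ring S)"
  by (auto simp: carrier_free_comm_ring)

lemma free_var: "g \<in> S \<Longrightarrow> var g \<in> carrier (free_comm_ring S)"
  by (auto simp: carrier_free_comm_ring var_def)

lemma free_sum: "(\<And>i. i \<in> I \<Longrightarrow> f i \<in> carrier (free_comm_ring S)) \<Longrightarrow>
    sum f I \<in> carrier (free_comm_ring S)"
  by (induction I rule: infinite_finite_induct) (auto intro: free_zero free_add)

lemma free_prod: "(\<And>i. i \<in> I \<Longrightarrow> f i \<in> carrier (free_comm_ring S)) \<Longrightarrow>
    prod f I \<in> carrier (free_comm_ring S)"
  by (induction I rule: infinite_finite_induct) (auto intro: free_one free_mult)

lemma free_power: "p \<in> carrier (free_comm_ring S) \<Longrightarrow> p ^ n \<in> carrier (free_comm_ring S)"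
  by (induction n) (auto intro: free_one free_mult)

lemmas free_closed = free_add free_minus free_diff free_mult free_zero free_one free_var

lemma cring_free_comm_ring: "cring (free_comm_ring S)"
proof (intro cringI abelian_groupI comm_monoidI)
  fix x assume "x \<in> carrier (free_comm_ring S)"
  then show "\<exists>y\<in>carrier (free_comm_ring S). y \<oplus>\<^bsub>free_comm_ring S\<^esub> x = \<zero>\<^bsub>free_comm_ring S\<^esub>"
    by (intro bexI[of _ "- x"]) (auto intro: free_minus)
qed (auto intro: free_closed simp: algebra_simps)

lemma free_comm_ring_minus:
  assumes "p \<in> carrier (free_comm_ring S)" "q \<in> carrier (free_comm_ring S)"
  shows "p \<ominus>\<^bsub>free_comm_ring S\<^esub> q = p - q"
proof -
  interpret cring "free_comm_ring S" by (rule cring_free_comm_ring)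
  have "\<ominus>\<^bsub>free_comm_ring S\<^esub> q = - q"
    using minus_equality[of "- q" q] assms(2) free_minus[of q S] by simp
  then show ?thesis by (simp add: a_minus_def)
qed

text \<open>
  Equality in the presented ring, as a relation on polynomials.
\<close>

definition pres_eq :: "'g set \<Rightarrow> 'g int_mpoly set \<Rightarrow> 'g int_mpoly \<Rightarrow> 'g int_mpoly \<Rightarrow> bool" where
  "pres_eq S R p q \<longleftrightarrow> p \<in> carrier (free_comm_ring S) \<and> q \<in> carrier (free_comm_ring S) \<and>
     p - q \<in> Idl\<^bsub>free_comm_ring S\<^esub> R"

lemma pres_eqI: "p - q \<in> R \<Longrightarrow> R \<subseteq> carrier (free_comm_ring S) \<Longrightarrow>
    p \<in> carrier (free_comm_ring S) \<Longrightarrow> q \<in> carrier (free_comm_ring S) \<Longrightarrow> pres_eq S R p q"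
  unfolding pres_eq_def
  using ring.genideal_self[OF cring.axioms(1)[OF cring_free_comm_ring], of R S] by blast

lemma pres_eq_iff_coset:
  assumes "R \<subseteq> carrier (free_comm_ring S)" "p \<in> carrier (free_comm_ring S)"
    "q \<in> carrier (free_comm_ring S)"
  shows "pres_eq S R p q \<longleftrightarrow>
    (Idl\<^bsub>free_comm_ring S\<^esub> R) +>\<^bsub>free_comm_ring S\<^esub> p = (Idl\<^bsub>free_comm_ring S\<^esub> R) +>\<^bsub>free_comm_ring S\<^esub> q"
proof -
  interpret cring "free_comm_ring S" by (rule cring_free_comm_ring)
  show ?thesis
    using quotient_eq_iff_same_a_r_cos[OF genideal_ideal[OF assms(1)] assms(2,3)] assms
    by (simp add: pres_eq_def free_comm_ring_minus)
qed

lemma pres_eq_congruence: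
  assumes "R \<subseteq> carrier (free_comm_ring S)"
  shows "ring_congruence (pres_eq S R)"
proof -
  interpret cring "free_comm_ring S" by (rule cring_free_comm_ring)
  interpret I: ideal "Idl\<^bsub>free_comm_ring S\<^esub> R" "free_comm_ring S" by (rule genideal_ideal[OF assms])
  let ?I = "Idl\<^bsub>free_comm_ring S\<^esub> R"
  have add: "a + b \<in> ?I" if "a \<in> ?I" "b \<in> ?I" for a b
    using I.a_closed[OF that] by simp
  have mul: "c * a \<in> ?I" if "a \<in> ?I" "c \<in> carrier (free_comm_ring S)" for a c
    using I.I_l_closed[OF that] by simp
  have neg: "- a \<in> ?I" if "a \<in> ?I" for a
    using mul[OF that free_minus[OF free_one]] by simp
  show ?thesis
  proof
    show "pres_eq S R b a" if "pres_eq S R a b" for a b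
      using that neg[of "a - b"] by (simp add: pres_eq_def)
    show "pres_eq S R a c" if "pres_eq S R a b" "pres_eq S R b c" for a b c
      using that add[of "a - b" "b - c"] by (simp add: pres_eq_def)
    show "pres_eq S R (a + c) (b + d)" if "pres_eq S R a b" "pres_eq S R c d" for a b c d
      using that add[of "a - b" "c - d"] by (auto simp: pres_eq_def algebra_simps intro: free_add)
    show "pres_eq S R (a * c) (b * d)" if "pres_eq S R a b" "pres_eq S R c d" for a b c d
    proof -
      have "a * c - b * d = c * (a - b) + b * (c - d)" by (simp add: algebra_simps)
      then show ?thesis
        using that by (auto simp: pres_eq_def intro!: add mul free_mult)
    qed
    show "pres_eq S R (- a) (- b)" if "pres_eq S R a b" for a b
      using that neg[of "a - b"] by (auto simp: pres_eq_def intro: free_minus)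
    show "pres_eq S R 1 1"
      by (simp add: pres_eq_def free_one) (use I.zero_closed in simp)
  qed
qed

text \<open>
  The ring homomorphism that sends the indeterminate \<open>g\<close> to the polynomial \<open>\<phi> g\<close>.  A polynomial is a
  free abelian group element on monomials, so the additive extension of the map on monomials does it.
\<close>

definition subst_poly :: "('g \<Rightarrow> 'h int_mpoly) \<Rightarrow> 'g int_mpoly \<Rightarrow> 'h int_mpoly" where
  "subst_poly \<phi> = frag_extend (\<lambda>m. \<Prod>g\<in>Poly_Mapping.keys m. \<phi> g ^ Poly_Mapping.lookup m g)"

lemma subst_add: "subst_poly \<phi> (p + q) = subst_poly \<phi> p + subst_poly \<phi> q"
  and subst_diff: "subst_poly \<phi> (p - q) = subst_poly \<phi> p - subst_poly \<phi> q"
  and subst_zero: "subst_poly \<phi> 0 = 0"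
  by (simp_all add: subst_poly_def frag_extend_add frag_extend_diff)

lemma subst_sum: "subst_poly \<phi> (sum f I) = (\<Sum>i\<in>I. subst_poly \<phi> (f i))"
  by (induction I rule: infinite_finite_induct) (auto simp: subst_zero subst_add)

lemma subst_monom:
  "subst_poly \<phi> (frag_of m) = (\<Prod>g\<in>Poly_Mapping.keys m. \<phi> g ^ Poly_Mapping.lookup m g)"
  by (simp add: subst_poly_def)

lemma subst_var: "subst_poly \<phi> (var g) = \<phi> g"
  by (simp add: var_def subst_monom)

lemma subst_one: "subst_poly \<phi> 1 = 1"
  using subst_monom[of \<phi> 0] by simp

lemma subst_monom_mult:
  "subst_poly \<phi> (frag_of (m + n)) = subst_poly \<phi> (frag_of m) * subst_poly \<phi> (frag_of n)"
proof -
  let ?K = "Poly_Mapping.keys m \<union> Poly_Mapping.keys n"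
  have ext: "subst_poly \<phi> (frag_of k) = (\<Prod>g\<in>?K. \<phi> g ^ Poly_Mapping.lookup k g)"
    if "Poly_Mapping.keys k \<subseteq> ?K" for k
    unfolding subst_monom using that
    by (intro prod.mono_neutral_left) (auto simp: in_keys_iff)
  show ?thesis
    using Poly_Mapping.keys_add[of m n]
    by (simp add: ext lookup_add power_add prod.distrib)
qed

lemma subst_mult: "subst_poly \<phi> (p * q) = subst_poly \<phi> p * subst_poly \<phi> q"
proof (induction p rule: frag_induction[OF subset_UNIV])
  case (2 m)
  show "subst_poly \<phi> (frag_of m * q) = subst_poly \<phi> (frag_of m) * subst_poly \<phi> q"
  proof (induction q rule: frag_induction[OF subset_UNIV])
    case (2 n)
    then show ?case using subst_monom_mult[of \<phi> m n] by (simp add: mult_single)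
  qed (auto simp: subst_zero subst_diff algebra_simps)
qed (auto simp: subst_zero subst_diff algebra_simps)

lemma subst_prod: "subst_poly \<phi> (prod f I) = (\<Prod>i\<in>I. subst_poly \<phi> (f i))"
  by (induction I rule: infinite_finite_induct) (auto simp: subst_one subst_mult)

lemma subst_power: "subst_poly \<phi> (p ^ n) = subst_poly \<phi> p ^ n"
  by (induction n) (auto simp: subst_one subst_mult)

lemma subst_subst: "subst_poly \<psi> (subst_poly \<phi> p) = subst_poly (\<lambda>g. subst_poly \<psi> (\<phi> g)) p"
proof (induction p rule: frag_induction[OF subset_UNIV])
  case (2 m)
  show ?case by (simp add: subst_monom subst_prod subst_power)
qed (auto simp: subst_zero subst_diff)

lemma subst_poly_var: "subst_poly var p = p"
proof (induction p rule: frag_induction[OF subset_UNIV])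
  case (2 m)
  have pow: "var g ^ n = frag_of (Poly_Mapping.single g n)" for g :: 'a and n
    by (induction n) (auto simp: var_def mult_single simp flip: single_add)
  have prd: "(\<Prod>g\<in>A. frag_of (f g)) = frag_of (\<Sum>g\<in>A. f g)" if "finite A"
    for A :: "'a set" and f :: "'a \<Rightarrow> 'a \<Rightarrow>\<^sub>0 nat"
    using that by (induction A) (auto simp: mult_single)
  have "(\<Sum>g\<in>Poly_Mapping.keys m. Poly_Mapping.single g (Poly_Mapping.lookup m g)) = m"
    by (rule poly_mapping_eqI) (auto simp: lookup_sum lookup_single when_def in_keys_iff)
  then show ?case by (simp add: subst_monom pow prd)
qed (auto simp: subst_zero subst_diff)

lemma subst_closed:
  assumes "\<And>g. g \<in> S \<Longrightarrow> \<phi> g \<in> carrier (free_comm_ring T)" "p \<in> carrier (free_comm_ring S)"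
  shows "subst_poly \<phi> p \<in> carrier (free_comm_ring T)"
  using assms(2) unfolding carrier_free_comm_ring[of p]
proof (induction p rule: frag_induction)
  case (one m)
  then show ?case unfolding subst_monom by (intro free_prod free_power assms(1)) auto
qed (auto simp: subst_zero subst_diff free_zero free_diff)

lemma subst_cong:
  fixes eqv :: "'h int_mpoly \<Rightarrow> 'h int_mpoly \<Rightarrow> bool"
  assumes "ring_congruence eqv"
    and "\<And>g. g \<in> S \<Longrightarrow> eqv (\<phi> g) (\<psi> g)" "p \<in> carrier (free_comm_ring S)"
  shows "eqv (subst_poly \<phi> p) (subst_poly \<psi> p)"
proof -
  interpret ring_congruence eqv by fact
  show ?thesis using assms(3) unfolding carrier_free_comm_ring[of p]
  proof (induction p rule: frag_induction)
    case (one m)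
    then show ?case unfolding subst_monom by (intro eqv_prod eqv_power assms(2)) auto
  qed (auto simp: subst_zero subst_diff eqv_zero eqv_diff)
qed

lemma pres_eq_refl: "R \<subseteq> carrier (free_comm_ring S) \<Longrightarrow> p \<in> carrier (free_comm_ring S) \<Longrightarrow> pres_eq S R p p"
  by (simp add: pres_eq_iff_coset)

lemma subst_pres_eq:
  assumes R: "R \<subseteq> carrier (free_comm_ring S)" and R': "R' \<subseteq> carrier (free_comm_ring S')"
    and \<phi>: "\<And>g. g \<in> S \<Longrightarrow> \<phi> g \<in> carrier (free_comm_ring S')"
    and rel: "\<And>r. r \<in> R \<Longrightarrow> pres_eq S' R' (subst_poly \<phi> r) 0"
    and eq: "pres_eq S R p q"
  shows "pres_eq S' R' (subst_poly \<phi> p) (subst_poly \<phi> q)"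
proof -
  let ?F = "free_comm_ring S" and ?F' = "free_comm_ring S'"
  interpret F: cring ?F by (rule cring_free_comm_ring)
  interpret F': cring ?F' by (rule cring_free_comm_ring)
  have "subst_poly \<phi> \<in> ring_hom ?F ?F'"
    by (rule ring_hom_memI) (auto simp: subst_add subst_mult subst_one intro!: subst_closed[OF \<phi>])
  then interpret h: ring_hom_ring ?F ?F' "subst_poly \<phi>"
    by (intro ring_hom_ringI2 F.ring_axioms F'.ring_axioms)
  have "Idl\<^bsub>?F\<^esub> R \<subseteq> {r \<in> carrier ?F. subst_poly \<phi> r \<in> Idl\<^bsub>?F'\<^esub> R'}"
    by (rule F.genideal_minimal[OF h.ideal_vimage[OF F'.genideal_ideal[OF R']]])
      (use R rel in \<open>auto simp: pres_eq_def\<close>)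
  then show ?thesis
    using eq subst_closed[OF \<phi>] by (auto simp: pres_eq_def subst_diff)
qed

lemma presented_ring_simps:
  fixes S R
  defines "F \<equiv> free_comm_ring S" and "I \<equiv> Idl\<^bsub>free_comm_ring S\<^esub> R"
  assumes R: "R \<subseteq> carrier (free_comm_ring S)"
  shows carrier_presented_ring: "carrier (presented_ring S R) = (\<lambda>p. I +>\<^bsub>F\<^esub> p) ` carrier F"
    and hom_presented_ring: "(\<lambda>p. I +>\<^bsub>F\<^esub> p) \<in> ring_hom F (presented_ring S R)"
proof -
  interpret F: cring F unfolding F_def by (rule cring_free_comm_ring)
  interpret I: ideal I F unfolding F_def I_def
    by (rule ring.genideal_ideal[OF cring.axioms(1)[OF cring_free_comm_ring] R])
  show "carrier (presented_ring S R) = (\<lambda>p. I +>\<^bsub>F\<^esub> p) ` carrier F"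
    by (auto simp: presented_ring_def F_def I_def FactRing_def A_RCOSETS_defs a_r_coset_def)
  show "(\<lambda>p. I +>\<^bsub>F\<^esub> p) \<in> ring_hom F (presented_ring S R)"
    using I.rcos_ring_hom by (simp add: presented_ring_def F_def I_def)
qed

text \<open>
  Two presented rings are isomorphic as soon as there are substitutions in both directions that
  respect the relations and are mutually inverse on generators: a homomorphism out of a presented ring is
  determined by the generators, so both composites are the identity.
\<close>

theorem presented_ring_iso:
  fixes \<phi> :: "'g \<Rightarrow> 'h int_mpoly" and \<psi> :: "'h \<Rightarrow> 'g int_mpoly"
  assumes R: "R \<subseteq> carrier (free_comm_ring S)" and R': "R' \<subseteq> carrier (free_comm_ring S')"
    and \<phi>: "\<And>g. g \<in> S \<Longrightarrow> \<phi> g \<in> carrier (free_comm_ring S')"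
    and \<psi>: "\<And>h. h \<in> S' \<Longrightarrow> \<psi> h \<in> carrier (free_comm_ring S)"
    and rel: "\<And>r. r \<in> R \<Longrightarrow> pres_eq S' R' (subst_poly \<phi> r) 0"
    and rel': "\<And>r. r \<in> R' \<Longrightarrow> pres_eq S R (subst_poly \<psi> r) 0"
    and inv: "\<And>g. g \<in> S \<Longrightarrow> pres_eq S R (subst_poly \<psi> (\<phi> g)) (var g)"
    and inv': "\<And>h. h \<in> S' \<Longrightarrow> pres_eq S' R' (subst_poly \<phi> (\<psi> h)) (var h)"
  obtains \<Phi> where "\<Phi> \<in> ring_iso (presented_ring S R) (presented_ring S' R')"
    and "\<And>g. g \<in> S \<Longrightarrow>
      \<Phi> (gen_class S R g) = (Idl\<^bsub>free_comm_ring S'\<^esub> R') +>\<^bsub>free_comm_ring S'\<^esub> \<phi> g"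
proof -
  let ?F = "free_comm_ring S" and ?F' = "free_comm_ring S'"
  let ?c = "\<lambda>p. (Idl\<^bsub>?F\<^esub> R) +>\<^bsub>?F\<^esub> p" and ?c' = "\<lambda>p. (Idl\<^bsub>?F'\<^esub> R') +>\<^bsub>?F'\<^esub> p"
  interpret E: ring_congruence "pres_eq S R" by (rule pres_eq_congruence[OF R])
  interpret E': ring_congruence "pres_eq S' R'" by (rule pres_eq_congruence[OF R'])
  have sub: "subst_poly \<phi> p \<in> carrier ?F'" if "p \<in> carrier ?F" for p
    by (rule subst_closed[OF \<phi> that])
  have sub': "subst_poly \<psi> p \<in> carrier ?F" if "p \<in> carrier ?F'" for p
    by (rule subst_closed[OF \<psi> that])
  have inv_sub: "pres_eq S R (subst_poly \<psi> (subst_poly \<phi> p)) p" if "p \<in> carrier ?F" for p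
    using subst_cong[OF E.ring_congruence_axioms, of S "\<lambda>g. subst_poly \<psi> (\<phi> g)" var p] inv that
    by (simp add: subst_subst subst_poly_var)
  have inv_sub': "pres_eq S' R' (subst_poly \<phi> (subst_poly \<psi> p)) p" if "p \<in> carrier ?F'" for p
    using subst_cong[OF E'.ring_congruence_axioms, of S' "\<lambda>g. subst_poly \<phi> (\<psi> g)" var p] inv' that
    by (simp add: subst_subst subst_poly_var)
  define \<Phi> where "\<Phi> C = ?c' (subst_poly \<phi> (SOME p. p \<in> carrier ?F \<and> ?c p = C))" for C
  have \<Phi>: "\<Phi> (?c p) = ?c' (subst_poly \<phi> p)" if p: "p \<in> carrier ?F" for p
  proof -
    define q where "q = (SOME q. q \<in> carrier ?F \<and> ?c q = ?c p)"
    have q: "q \<in> carrier ?F \<and> ?c q = ?c p"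
      unfolding q_def by (rule someI[of _ p]) (simp add: p)
    then have "pres_eq S R q p" using pres_eq_iff_coset[OF R] p by blast
    from subst_pres_eq[OF R R' \<phi> rel this]
    have "pres_eq S' R' (subst_poly \<phi> q) (subst_poly \<phi> p)" .
    then show ?thesis
      using pres_eq_iff_coset[OF R'] sub p q unfolding \<Phi>_def q_def[symmetric] by blast
  qed
  note hom = ring_hom_mult[OF hom_presented_ring[OF R], symmetric, simplified]
    ring_hom_add[OF hom_presented_ring[OF R], symmetric, simplified]
    ring_hom_one[OF hom_presented_ring[OF R], symmetric, simplified]
  note hom' = ring_hom_mult[OF hom_presented_ring[OF R'], symmetric, simplified]
    ring_hom_add[OF hom_presented_ring[OF R'], symmetric, simplified]
    ring_hom_one[OF hom_presented_ring[OF R'], symmetric, simplified]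
  have "\<Phi> \<in> ring_hom (presented_ring S R) (presented_ring S' R')"
    by (rule ring_hom_memI)
      (auto simp: carrier_presented_ring[OF R] carrier_presented_ring[OF R'] \<Phi> sub hom hom'
        free_closed subst_mult subst_add subst_one)
  moreover have "inj_on \<Phi> (carrier (presented_ring S R))"
  proof (rule inj_onI)
    fix C D assume "C \<in> carrier (presented_ring S R)" "D \<in> carrier (presented_ring S R)"
      and eq: "\<Phi> C = \<Phi> D"
    then obtain p q where p: "p \<in> carrier ?F" "C = ?c p" and q: "q \<in> carrier ?F" "D = ?c q"
      unfolding carrier_presented_ring[OF R] by blast
    from eq have "pres_eq S' R' (subst_poly \<phi> p) (subst_poly \<phi> q)"
      using pres_eq_iff_coset[OF R'] p q sub by (simp add: \<Phi>)
    from subst_pres_eq[OF R' R \<psi> rel' this]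
    have "pres_eq S R (subst_poly \<psi> (subst_poly \<phi> p)) (subst_poly \<psi> (subst_poly \<phi> q))" .
    then have "pres_eq S R p q"
      using inv_sub[OF p(1)] inv_sub[OF q(1)] E.eqv_trans E.eqv_sym by meson
    then show "C = D" using pres_eq_iff_coset[OF R] p q by blast
  qed
  moreover have "\<Phi> ` carrier (presented_ring S R) = carrier (presented_ring S' R')"
  proof
    show "\<Phi> ` carrier (presented_ring S R) \<subseteq> carrier (presented_ring S' R')"
      by (auto simp: carrier_presented_ring[OF R] carrier_presented_ring[OF R'] \<Phi> sub)
    show "carrier (presented_ring S' R') \<subseteq> \<Phi> ` carrier (presented_ring S R)"
    proof
      fix D assume "D \<in> carrier (presented_ring S' R')"
      then obtain q where q: "q \<in> carrier ?F'" "D = ?c' q"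
        unfolding carrier_presented_ring[OF R'] by blast
      then have "\<Phi> (?c (subst_poly \<psi> q)) = D"
        using inv_sub'[OF q(1)] pres_eq_iff_coset[OF R'] sub sub' by (simp add: \<Phi>)
      then show "D \<in> \<Phi> ` carrier (presented_ring S R)"
        using sub'[OF q(1)] unfolding carrier_presented_ring[OF R] by blast
    qed
  qed
  ultimately have "\<Phi> \<in> ring_iso (presented_ring S R) (presented_ring S' R')"
    by (simp add: ring_iso_def bij_betw_def)
  then show ?thesis
    by (rule that) (simp add: gen_class_def \<Phi> free_var subst_var)
qed


section \<open>Permutation groups and their smooth sets\<close>

lemma finite_image_factor:
  assumes "finite (h ` U)" "\<And>u v. u \<in> U \<Longrightarrow> v \<in> U \<Longrightarrow> h u = h v \<Longrightarrow> f u = f v"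
  shows "finite (f ` U)"
proof -
  have "f u = f (SOME v. v \<in> U \<and> h v = h u)" if "u \<in> U" for u
    using someI[of "\<lambda>v. v \<in> U \<and> h v = h u" u] that by (intro assms(2)) auto
  then have "f ` U \<subseteq> (\<lambda>t. f (SOME v. v \<in> U \<and> h v = t)) ` h ` U" by auto
  then show ?thesis by (rule finite_subset) (intro finite_imageI assms(1))
qed

locale perm_group =
  fixes G :: "('w \<Rightarrow> 'w) monoid" (structure) and S :: "'w set"
  assumes G_eq: "G = (BijGroup S)\<lparr>carrier := carrier G\<rparr>"
    and G_sub: "subgroup (carrier G) (BijGroup S)"
begin

sublocale group G
  using subgroup.subgroup_is_group[OF G_sub group_BijGroup] G_eq by simp

lemma cancel [simp]:
  assumes "g \<in> carrier G" "h \<in> carrier G"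
  shows "g \<otimes> (inv g \<otimes> h) = h" "inv g \<otimes> (g \<otimes> h) = h"
  using assms by (simp_all add: m_assoc[symmetric])

lemma G_Bij: "g \<in> carrier G \<Longrightarrow> g \<in> Bij S"
  using subgroup.subset[OF G_sub] by (auto simp: BijGroup_def)

lemma G_closed: "g \<in> carrier G \<Longrightarrow> a \<in> S \<Longrightarrow> g a \<in> S"
  using G_Bij Bij_imp_funcset by blast

lemma mult_eq: "g \<in> carrier G \<Longrightarrow> h \<in> carrier G \<Longrightarrow> g \<otimes> h = compose S g h"
  using G_Bij by (subst G_eq) (simp add: BijGroup_def)

lemma mult_apply: "g \<in> carrier G \<Longrightarrow> h \<in> carrier G \<Longrightarrow> a \<in> S \<Longrightarrow> (g \<otimes> h) a = g (h a)"
  by (simp add: mult_eq compose_eq)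

lemma one_apply: "a \<in> S \<Longrightarrow> \<one> a = a"
  by (subst G_eq) (simp add: BijGroup_def)

lemma inv_apply:
  assumes "g \<in> carrier G" "a \<in> S"
  shows "(inv g) (g a) = a" "g ((inv g) a) = a"
  using assms mult_apply[of "inv g" g a] mult_apply[of g "inv g" a] by (simp_all add: one_apply)

abbreviation "stab \<equiv> pointwise_stab G"

lemma stab_iff: "g \<in> stab A \<longleftrightarrow> g \<in> carrier G \<and> (\<forall>a\<in>A. g a = a)"
  by (auto simp: pointwise_stab_def)

lemma stab_carrier: "g \<in> stab A \<Longrightarrow> g \<in> carrier G"
  by (simp add: stab_iff)

lemma stab_subgroup:
  assumes "A \<subseteq> S"
  shows "subgroup (stab A) G"
proof (rule subgroupI)
  have "\<one> \<in> stab A" using assms one_apply by (auto simp: stab_iff)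
  then show "stab A \<noteq> {}" by blast
  show "inv g \<in> stab A" if g: "g \<in> stab A" for g
    unfolding stab_iff
  proof (intro conjI ballI)
    fix a assume "a \<in> A"
    then show "(inv g) a = a" using inv_apply(1)[of g a] g assms by (auto simp: stab_iff)
  qed (use g in \<open>simp add: stab_iff\<close>)
qed (use assms in \<open>auto simp: stab_iff mult_apply subset_iff\<close>)

lemma stab_Un: "stab (A \<union> B) = stab A \<inter> stab B"
  by (auto simp: stab_iff)

lemma stab_antimono: "A \<subseteq> B \<Longrightarrow> stab B \<subseteq> stab A"
  unfolding pointwise_stab_def by blast

lemma stab_image_iff:
  assumes "g \<in> carrier G" "h \<in> carrier G" "A \<subseteq> S"
  shows "h \<in> stab (g ` A) \<longleftrightarrow> inv g \<otimes> h \<otimes> g \<in> stab A"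
proof -
  have "h (g a) = g a \<longleftrightarrow> (inv g \<otimes> h \<otimes> g) a = a" if "a \<in> A" for a
  proof -
    have a: "a \<in> S" using that assms by blast
    then have "(inv g \<otimes> h \<otimes> g) a = (inv g) (h (g a))"
      using assms by (simp add: mult_apply G_closed)
    then show ?thesis using assms a inv_apply G_closed by metis
  qed
  then show ?thesis using assms by (auto simp: stab_iff)
qed

lemma stab_image:
  assumes "g \<in> carrier G" "A \<subseteq> S"
  shows "stab (g ` A) = (\<lambda>h. g \<otimes> h \<otimes> inv g) ` stab A"
proof (intro equalityI subsetI)
  fix h assume h: "h \<in> stab (g ` A)"
  then have "inv g \<otimes> h \<otimes> g \<in> stab A" using stab_image_iff assms stab_carrier by blast
  moreover have "h = g \<otimes> (inv g \<otimes> h \<otimes> g) \<otimes> inv g"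
    using stab_carrier[OF h] assms by (simp add: m_assoc)
  ultimately show "h \<in> (\<lambda>h. g \<otimes> h \<otimes> inv g) ` stab A" by blast
next
  fix k assume "k \<in> (\<lambda>h. g \<otimes> h \<otimes> inv g) ` stab A"
  then obtain h where h: "h \<in> stab A" "k = g \<otimes> h \<otimes> inv g" by blast
  have "inv g \<otimes> k \<otimes> g = h" using stab_carrier[OF h(1)] assms h(2) by (simp add: m_assoc)
  then show "k \<in> stab (g ` A)" using stab_image_iff[of g k A] assms h stab_carrier[OF h(1)] by simp
qed

lemma stab_image_self: "g \<in> stab A \<Longrightarrow> g ` A = A"
  by (force simp: stab_iff)

lemma open_in_group_subgroup:
  assumes "subgroup U G"
  shows "open_in_group G S U \<longleftrightarrow> (\<exists>A. finite A \<and> A \<subseteq> S \<and> stab A \<subseteq> U)"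
proof
  assume "open_in_group G S U"
  then obtain A where A: "finite A" "A \<subseteq> S" "\<one> <# stab A \<subseteq> U"
    using subgroup.one_closed[OF assms] unfolding open_in_group_def by blast
  moreover have "\<one> <# stab A = stab A" using stab_subgroup[OF A(2)]
    by (simp add: lcos_mult_one subgroup.subset)
  ultimately show "\<exists>A. finite A \<and> A \<subseteq> S \<and> stab A \<subseteq> U" by auto
next
  assume "\<exists>A. finite A \<and> A \<subseteq> S \<and> stab A \<subseteq> U"
  then show "open_in_group G S U"
    unfolding open_in_group_def
  proof (intro conjI subgroup.subset[OF assms] ballI)
    assume "\<exists>A. finite A \<and> A \<subseteq> S \<and> stab A \<subseteq> U"
    then obtain A where A: "finite A" "A \<subseteq> S" "stab A \<subseteq> U" by blast
    fix g assume "g \<in> U"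
    then have "g <# stab A \<subseteq> U"
      using A(3) subgroup.m_closed[OF assms] by (auto simp: l_coset_def)
    then show "\<exists>A. finite A \<and> A \<subseteq> S \<and> g <# stab A \<subseteq> U" using A by blast
  qed
qed

lemma open_subgroup_iff:
  "open_subgroup G S U \<longleftrightarrow> subgroup U G \<and> (\<exists>A. finite A \<and> A \<subseteq> S \<and> stab A \<subseteq> U)"
  using open_in_group_subgroup by (auto simp: open_subgroup_def)

lemma open_stab: "finite A \<Longrightarrow> A \<subseteq> S \<Longrightarrow> open_subgroup G S (stab A)"
  unfolding open_subgroup_iff using stab_subgroup by blast

lemma open_subgroup_Int:
  assumes "open_subgroup G S U" "open_subgroup G S V"
  shows "open_subgroup G S (U \<inter> V)"
proof -
  obtain A B where "finite A" "A \<subseteq> S" "stab A \<subseteq> U" "finite B" "B \<subseteq> S" "stab B \<subseteq> V"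
    using assms unfolding open_subgroup_iff by blast
  then have "finite (A \<union> B) \<and> A \<union> B \<subseteq> S \<and> stab (A \<union> B) \<subseteq> U \<inter> V" by (auto simp: stab_Un)
  then show ?thesis using assms subgroups_Inter_pair unfolding open_subgroup_iff by blast
qed

lemma stabilizer_class_iff:
  "V \<in> stabilizer_class G S \<longleftrightarrow> (\<exists>A. finite A \<and> A \<subseteq> S \<and> V = stab A)"
proof -
  have *: "stabilizer G (\<lambda>g. map g) xs = stab (set xs)" for xs
  proof -
    have "map g xs = xs \<longleftrightarrow> (\<forall>a\<in>set xs. g a = a)" for g
      using map_eq_conv[of g xs id] by (simp del: map_eq_conv)
    then show ?thesis by (auto simp: stabilizer_def stab_iff)
  qed
  show ?thesis
    unfolding stabilizer_class_def * lists_eq_set mem_Collect_eq by (metis finite_list finite_set)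
qed

subsection \<open>Actions of subgroups\<close>

text \<open>
  Unlike \<^const>\<open>group_action\<close>, this does not ask the maps to be extensional on \<open>X\<close>, so that one function
  \<open>\<rho>\<close> acts on \<open>X\<close> and on all its invariant subsets, and for all smaller groups.
\<close>

definition is_act :: "('w \<Rightarrow> 'w) set \<Rightarrow> 'x set \<Rightarrow> (('w \<Rightarrow> 'w) \<Rightarrow> 'x \<Rightarrow> 'x) \<Rightarrow> bool" where
  "is_act U X \<rho> \<longleftrightarrow> (\<forall>g\<in>U. \<forall>x\<in>X. \<rho> g x \<in> X) \<and>
     (\<forall>g\<in>U. \<forall>h\<in>U. \<forall>x\<in>X. \<rho> (g \<otimes> h) x = \<rho> g (\<rho> h x)) \<and> (\<forall>x\<in>X. \<rho> \<one> x = x)"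

definition isotropy :: "('w \<Rightarrow> 'w) set \<Rightarrow> (('w \<Rightarrow> 'w) \<Rightarrow> 'x \<Rightarrow> 'x) \<Rightarrow> 'x \<Rightarrow> ('w \<Rightarrow> 'w) set" where
  "isotropy U \<rho> x = {g \<in> U. \<rho> g x = x}"

definition orb :: "('w \<Rightarrow> 'w) set \<Rightarrow> (('w \<Rightarrow> 'w) \<Rightarrow> 'x \<Rightarrow> 'x) \<Rightarrow> 'x \<Rightarrow> 'x set" where
  "orb U \<rho> x = (\<lambda>g. \<rho> g x) ` U"

definition orbs :: "('w \<Rightarrow> 'w) set \<Rightarrow> 'x set \<Rightarrow> (('w \<Rightarrow> 'w) \<Rightarrow> 'x \<Rightarrow> 'x) \<Rightarrow> 'x set set" where
  "orbs U X \<rho> = orb U \<rho> ` X"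

lemma stabilizer_isotropy: "stabilizer (G\<lparr>carrier := U\<rparr>) \<rho> x = isotropy U \<rho> x"
  by (simp add: stabilizer_def isotropy_def)

lemma orbits_orbs: "orbits (G\<lparr>carrier := U\<rparr>) X \<rho> = orbs U X \<rho>"
  by (auto simp: orbits_def orbit_def orbs_def orb_def)

lemma is_act_closed: "is_act U X \<rho> \<Longrightarrow> g \<in> U \<Longrightarrow> x \<in> X \<Longrightarrow> \<rho> g x \<in> X"
  and is_act_mult: "is_act U X \<rho> \<Longrightarrow> g \<in> U \<Longrightarrow> h \<in> U \<Longrightarrow> x \<in> X \<Longrightarrow> \<rho> (g \<otimes> h) x = \<rho> g (\<rho> h x)"
  and is_act_one: "is_act U X \<rho> \<Longrightarrow> x \<in> X \<Longrightarrow> \<rho> \<one> x = x"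
  by (auto simp: is_act_def)

lemma is_act_subgroup: "is_act U X \<rho> \<Longrightarrow> V \<subseteq> U \<Longrightarrow> is_act V X \<rho>"
  unfolding is_act_def by blast

lemma is_act_subset:
  "is_act U X \<rho> \<Longrightarrow> Y \<subseteq> X \<Longrightarrow> (\<And>g y. g \<in> U \<Longrightarrow> y \<in> Y \<Longrightarrow> \<rho> g y \<in> Y) \<Longrightarrow> is_act U Y \<rho>"
  unfolding is_act_def by blast

lemma is_act_inv:
  assumes "is_act U X \<rho>" "subgroup U G" "g \<in> U" "x \<in> X"
  shows "\<rho> (inv g) (\<rho> g x) = x" "\<rho> g (\<rho> (inv g) x) = x"
proof -
  have g: "g \<in> carrier G" "inv g \<in> U"
    using assms subgroup.subset subgroup.m_inv_closed by fastforce+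
  then show "\<rho> (inv g) (\<rho> g x) = x" "\<rho> g (\<rho> (inv g) x) = x"
    using is_act_mult[OF assms(1), of "inv g" g x] is_act_mult[OF assms(1), of g "inv g" x]
      is_act_one[OF assms(1)] assms by simp_all
qed

lemma group_action_iff:
  assumes U: "subgroup U G"
  shows "group_action (G\<lparr>carrier := U\<rparr>) X \<rho> \<longleftrightarrow> is_act U X \<rho> \<and> (\<forall>g\<in>U. \<rho> g \<in> extensional X)"
proof
  assume "group_action (G\<lparr>carrier := U\<rparr>) X \<rho>"
  then interpret A: group_action "G\<lparr>carrier := U\<rparr>" X \<rho> .
  have "\<rho> \<one> x = x" if "x \<in> X" for x
    using fun_cong[OF A.id_eq_one, of x] that by simp
  then show "is_act U X \<rho> \<and> (\<forall>g\<in>U. \<rho> g \<in> extensional X)"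
    using A.element_image A.composition_rule A.bij_prop0 Bij_imp_extensional
    unfolding is_act_def by fastforce
next
  assume *: "is_act U X \<rho> \<and> (\<forall>g\<in>U. \<rho> g \<in> extensional X)"
  then have act: "is_act U X \<rho>" and ext: "\<And>g. g \<in> U \<Longrightarrow> \<rho> g \<in> extensional X" by auto
  have bij: "\<rho> g \<in> Bij X" if g: "g \<in> U" for g
  proof -
    have "inv g \<in> U" using U g by (simp add: subgroup.m_inv_closed)
    then have "bij_betw (\<rho> g) X X"
      using is_act_inv[OF act U g] is_act_closed[OF act]
      by (intro bij_betwI[of _ _ _ "\<rho> (inv g)"]) (use g in auto)
    then show ?thesis using ext[OF g] by (simp add: Bij_def)
  qed
  have "\<rho> (g \<otimes> h) = \<rho> g \<otimes>\<^bsub>BijGroup X\<^esub> \<rho> h" if "g \<in> U" "h \<in> U" for g h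
  proof -
    have "\<rho> (g \<otimes> h) = compose X (\<rho> g) (\<rho> h)"
      using that ext[of "g \<otimes> h"] U act
      by (intro extensionalityI[of _ X]) (auto simp: subgroup.m_closed compose_def is_act_mult)
    then show ?thesis using that bij by (simp add: BijGroup_def)
  qed
  then have "group_hom (G\<lparr>carrier := U\<rparr>) (BijGroup X) \<rho>"
    using bij by (intro group_hom.intro group_hom_axioms.intro subgroup_imp_group[OF U] group_BijGroup homI)
      (auto simp: BijGroup_def)
  then show "group_action (G\<lparr>carrier := U\<rparr>) X \<rho>" by (rule group_action.intro)
qed

lemma isotropy_subgroup:
  assumes "is_act U X \<rho>" "subgroup U G" "x \<in> X"
  shows "subgroup (isotropy U \<rho> x) G"
proof (rule subgroupI)
  show "isotropy U \<rho> x \<subseteq> carrier G"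
    using subgroup.subset[OF assms(2)] by (auto simp: isotropy_def)
  show "isotropy U \<rho> x \<noteq> {}"
    using is_act_one[OF assms(1,3)] subgroup.one_closed[OF assms(2)] by (auto simp: isotropy_def)
  show "inv a \<in> isotropy U \<rho> x" if "a \<in> isotropy U \<rho> x" for a
    using that is_act_inv(1)[OF assms(1,2) _ assms(3), of a] subgroup.m_inv_closed[OF assms(2)]
    by (auto simp: isotropy_def)
  show "a \<otimes> b \<in> isotropy U \<rho> x" if "a \<in> isotropy U \<rho> x" "b \<in> isotropy U \<rho> x" for a b
    using that is_act_mult[OF assms(1), of a b x] assms(3) subgroup.m_closed[OF assms(2)]
    by (auto simp: isotropy_def)
qed

lemma orb_self: "is_act U X \<rho> \<Longrightarrow> subgroup U G \<Longrightarrow> x \<in> X \<Longrightarrow> x \<in> orb U \<rho> x"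
  unfolding orb_def by (metis image_eqI is_act_one subgroup.one_closed)

lemma orb_subset: "is_act U X \<rho> \<Longrightarrow> x \<in> X \<Longrightarrow> orb U \<rho> x \<subseteq> X"
  by (auto simp: orb_def is_act_closed)

lemma orb_eq:
  assumes "is_act U X \<rho>" "subgroup U G" "x \<in> X" "y \<in> orb U \<rho> x"
  shows "orb U \<rho> y = orb U \<rho> x"
proof -
  have sub: "orb U \<rho> (\<rho> g z) \<subseteq> orb U \<rho> z" if "g \<in> U" "z \<in> X" for g z
  proof
    fix w assume "w \<in> orb U \<rho> (\<rho> g z)"
    then obtain h where "h \<in> U" "w = \<rho> h (\<rho> g z)" by (auto simp: orb_def)
    then have "w = \<rho> (h \<otimes> g) z" "h \<otimes> g \<in> U"
      using that is_act_mult[OF assms(1)] subgroup.m_closed[OF assms(2)] by auto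
    then show "w \<in> orb U \<rho> z" by (auto simp: orb_def)
  qed
  obtain g where g: "g \<in> U" "y = \<rho> g x" using assms(4) by (auto simp: orb_def)
  have "inv g \<in> U" "y \<in> X"
    using g assms(1-3) by (simp_all add: subgroup.m_inv_closed is_act_closed)
  then have "orb U \<rho> (\<rho> (inv g) y) \<subseteq> orb U \<rho> y" by (rule sub)
  then show ?thesis using sub[OF g(1) assms(3)] g is_act_inv(1)[OF assms(1,2) g(1) assms(3)] by auto
qed

lemma orb_invariant:
  assumes "is_act U X \<rho>" "subgroup U G" "x \<in> X" "y \<in> orb U \<rho> x" "g \<in> U"
  shows "\<rho> g y \<in> orb U \<rho> x"
  using orb_eq[OF assms(1-4)] assms(5) by (auto simp: orb_def)

lemma orbs_memD: "is_act U X \<rho> \<Longrightarrow> subgroup U G \<Longrightarrow> Q \<in> orbs U X \<rho> \<Longrightarrow> x \<in> Q \<Longrightarrow> x \<in> X \<and> Q = orb U \<rho> x"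
  using orb_eq[of U X \<rho> _ x] orb_subset[of U X \<rho>] by (fastforce simp: orbs_def)

lemma orbs_nonempty: "is_act U X \<rho> \<Longrightarrow> subgroup U G \<Longrightarrow> Q \<in> orbs U X \<rho> \<Longrightarrow> \<exists>x. x \<in> Q"
  using orb_self[of U X \<rho>] by (fastforce simp: orbs_def)

lemma isotropy_translate:
  assumes act: "is_act U X \<rho>" and U: "subgroup U G" and x: "x \<in> X" and g: "g \<in> U"
  shows "isotropy U \<rho> (\<rho> g x) = (\<lambda>h. g \<otimes> h \<otimes> inv g) ` isotropy U \<rho> x"
proof -
  note [simp] = subgroup.m_closed[OF U] subgroup.m_inv_closed[OF U] subgroup.mem_carrier[OF U]
  show ?thesis
  proof (intro equalityI subsetI)
    fix h assume h: "h \<in> isotropy U \<rho> (\<rho> g x)"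
    then have hU: "h \<in> U" and e: "\<rho> h (\<rho> g x) = \<rho> g x" by (auto simp: isotropy_def)
    have "\<rho> (inv g \<otimes> h \<otimes> g) x = x"
      using hU g x e act is_act_closed[OF act] is_act_inv(1)[OF act U g x] by (simp add: is_act_mult[OF act])
    then have "inv g \<otimes> h \<otimes> g \<in> isotropy U \<rho> x" using hU g by (simp add: isotropy_def)
    moreover have "h = g \<otimes> (inv g \<otimes> h \<otimes> g) \<otimes> inv g"
      using hU g by (simp add: m_assoc)
    ultimately show "h \<in> (\<lambda>h. g \<otimes> h \<otimes> inv g) ` isotropy U \<rho> x" by blast
  next
    fix k assume "k \<in> (\<lambda>h. g \<otimes> h \<otimes> inv g) ` isotropy U \<rho> x"
    then obtain h where h: "h \<in> U" "\<rho> h x = x" "k = g \<otimes> h \<otimes> inv g" by (auto simp: isotropy_def)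
    then show "k \<in> isotropy U \<rho> (\<rho> g x)"
      using g x is_act_closed[OF act] is_act_inv(1)[OF act U g x]
      by (simp add: isotropy_def is_act_mult[OF act])
  qed
qed

text \<open>
  A set is tame for \<open>A\<close> when its restriction to \<open>G(A)\<close> is a finite union of orbits of the form
  \<open>G(A)/G(B)\<close> with \<open>A \<subseteq> B\<close>.  Every finitary \<open>\<E>\<close>-smooth set is tame for some \<open>A\<close>, and then for all larger ones;
  all computations with smooth sets take place at this level.
\<close>

definition tame :: "'w set \<Rightarrow> 'x set \<Rightarrow> (('w \<Rightarrow> 'w) \<Rightarrow> 'x \<Rightarrow> 'x) \<Rightarrow> bool" where
  "tame A X \<rho> \<longleftrightarrow> finite A \<and> A \<subseteq> S \<and> is_act (stab A) X \<rho> \<and> finite (orbs (stab A) X \<rho>) \<and>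
     (\<forall>x\<in>X. \<exists>B. finite B \<and> A \<subseteq> B \<and> B \<subseteq> S \<and> isotropy (stab A) \<rho> x = stab B)"

lemma tame_stab: "tame A X \<rho> \<Longrightarrow> subgroup (stab A) G"
  using stab_subgroup by (simp add: tame_def)

lemma tame_act: "tame A X \<rho> \<Longrightarrow> is_act (stab A) X \<rho>"
  by (simp add: tame_def)

lemma tame_point:
  assumes "tame A X \<rho>" "x \<in> X"
  obtains B where "finite B" "A \<subseteq> B" "B \<subseteq> S" "isotropy (stab A) \<rho> x = stab B"
  using assms unfolding tame_def by (elim conjE) (drule bspec, assumption, elim exE conjE)

lemma tame_subset:
  assumes "tame A X \<rho>" "Y \<subseteq> X" "\<And>g y. g \<in> stab A \<Longrightarrow> y \<in> Y \<Longrightarrow> \<rho> g y \<in> Y"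
  shows "tame A Y \<rho>"
proof -
  have "orbs (stab A) Y \<rho> \<subseteq> orbs (stab A) X \<rho>" using assms(2) by (auto simp: orbs_def)
  then show ?thesis using assms is_act_subset[of "stab A" X \<rho> Y] finite_subset
    unfolding tame_def by (metis subsetD)
qed

lemma hat_setsI:
  assumes U: "subgroup U G" and A: "finite A" "A \<subseteq> S" "stab A \<subseteq> U"
    and act: "is_act U X \<rho>" and ext: "\<And>g. g \<in> U \<Longrightarrow> \<rho> g \<in> extensional X"
    and fin: "finite (orbs U X \<rho>)"
    and iso: "\<And>x. x \<in> X \<Longrightarrow> \<exists>B. finite B \<and> B \<subseteq> S \<and> isotropy (stab A) \<rho> x = stab B"
  shows "(U, X, \<rho>) \<in> hat_sets G S (stabilizer_class G S)"
proof -
  have oU: "open_subgroup G S U" using U A open_subgroup_iff by blast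
  have "open_in_group G S (isotropy U \<rho> x)" if x: "x \<in> X" for x
  proof -
    obtain B where "finite B" "B \<subseteq> S" "isotropy (stab A) \<rho> x = stab B" using iso x by blast
    moreover have "isotropy (stab A) \<rho> x \<subseteq> isotropy U \<rho> x" using A by (auto simp: isotropy_def)
    ultimately show ?thesis using open_in_group_subgroup[OF isotropy_subgroup[OF act U x]] by auto
  qed
  then have "smooth_set G S (U, X, \<rho>)"
    using oU group_action_iff[OF U, of X \<rho>] act ext by (simp add: stabilizer_isotropy)
  moreover have "E_smooth_uset G (stabilizer_class G S) (stab A, X, \<rho>)"
    unfolding E_smooth_uset.simps stabilizer_isotropy
  proof
    fix x assume "x \<in> X"
    then obtain B where B: "finite B" "B \<subseteq> S" "isotropy (stab A) \<rho> x = stab B" using iso by blast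
    then have "isotropy (stab A) \<rho> x = stab A \<inter> stab B" by (auto simp: isotropy_def)
    then show "\<exists>V\<in>stabilizer_class G S. isotropy (stab A) \<rho> x = stab A \<inter> V"
      using B stabilizer_class_iff[of "stab B"] by blast
  qed
  then have "E_smooth G S (stabilizer_class G S) (U, X, \<rho>)"
    using A open_stab unfolding E_smooth.simps by blast
  ultimately show ?thesis
    using fin by (simp add: hat_sets_def orbits_orbs del: smooth_set.simps E_smooth.simps)
qed

lemma hat_setsD:
  assumes "(U, X, \<rho>) \<in> hat_sets G S E"
  shows "open_subgroup G S U" "subgroup U G" "is_act U X \<rho>" "\<And>g. g \<in> U \<Longrightarrow> \<rho> g \<in> extensional X"
    "finite (orbs U X \<rho>)"
  using assms group_action_iff[of U X \<rho>]
  by (auto simp: hat_sets_def orbits_orbs open_subgroup_def)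

end

locale oligo_group = perm_group G S for G :: "('w \<Rightarrow> 'w) monoid" (structure) and S :: "'w set" +
  assumes finite_tuple_orbits: "finite (orbits G {xs \<in> lists S. length xs = n} (\<lambda>g. map g))"
begin

text \<open>
  Passing to a smaller open subgroup \<open>G(A)\<close> keeps the number of orbits finite.  Inside one orbit of \<open>U\<close>,
  the point \<open>u x\<close> is determined by the image under \<open>u\<close> of a finite tuple \<open>cs\<close> whose stabilizer
  fixes \<open>x\<close>.  If the tuples \<open>as @ u cs\<close> and \<open>as @ v cs\<close>, with \<open>as\<close> enumerating \<open>A\<close>, are in one orbit of \<open>G\<close>, then
  the group element carrying one to the other lies in \<open>G(A)\<close> and carries \<open>u x\<close> to \<open>v x\<close>; and there are only finitely
  many orbits of tuples.
\<close>

lemma finite_orbs_stab: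
  assumes act: "is_act U X \<rho>" and U: "subgroup U G" and fin: "finite (orbs U X \<rho>)"
    and A: "finite A" "A \<subseteq> S" "stab A \<subseteq> U"
    and smooth: "\<And>x. x \<in> X \<Longrightarrow> \<exists>C. finite C \<and> C \<subseteq> S \<and> stab C \<subseteq> isotropy U \<rho> x"
  shows "finite (orbs (stab A) X \<rho>)"
proof -
  note UG = subgroup.mem_carrier[OF U]
  have one: "finite ((\<lambda>u. orb (stab A) \<rho> (\<rho> u x)) ` U)" if x: "x \<in> X" for x
  proof -
    obtain C where C: "finite C" "C \<subseteq> S" "stab C \<subseteq> isotropy U \<rho> x" using smooth[OF x] by blast
    obtain as cs where as: "set as = A" and cs: "set cs = C" using A C finite_list by metis
    let ?h = "\<lambda>u. orbit G (\<lambda>g. map g) (as @ map u cs)"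
    have "as @ map u cs \<in> {xs \<in> lists S. length xs = length as + length cs}" if "u \<in> U" for u
      using as cs A(2) C(2) G_closed[OF UG[OF that]] by (auto simp: subset_iff)
    then have "?h ` U \<subseteq> orbits G {xs \<in> lists S. length xs = length as + length cs} (\<lambda>g. map g)"
      unfolding orbits_def by blast
    then have "finite (?h ` U)" using finite_tuple_orbits finite_subset by blast
    then show ?thesis
    proof (rule finite_image_factor)
      fix u v assume u: "u \<in> U" and v: "v \<in> U" and eq: "?h u = ?h v"
      have id: "map \<one> (as @ map v cs) = as @ map v cs"
        using as cs A C UG[OF v] G_closed one_apply by (auto simp: map_idI subset_iff)
      have "as @ map v cs \<in> ?h v"
        unfolding orbit_def by (rule CollectI, rule exI[of _ \<one>]) (metis id one_closed)
      then obtain h where h: "h \<in> carrier G" "as @ map v cs = map h (as @ map u cs)"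
        unfolding eq[symmetric] by (auto simp: orbit_def)
      then have "map h as = map id as" "map h (map u cs) = map v cs" by simp_all
      then have h1: "h \<in> stab A" and h2: "\<And>c. c \<in> C \<Longrightarrow> h (u c) = v c"
        using h(1) as cs unfolding map_map map_eq_conv by (auto simp: stab_iff)
      have hU: "h \<in> U" using h1 A by blast
      have "inv v \<otimes> (h \<otimes> u) \<in> stab C"
        using h(1) UG[OF u] UG[OF v] h2 C inv_apply(1)[of v]
        by (auto simp: stab_iff mult_apply G_closed subset_iff)
      then have "\<rho> (inv v \<otimes> (h \<otimes> u)) x = x" using C by (auto simp: isotropy_def)
      then have "\<rho> v (\<rho> (inv v \<otimes> (h \<otimes> u)) x) = \<rho> v x" by simp
      moreover have "\<rho> (v \<otimes> (inv v \<otimes> (h \<otimes> u))) x = \<rho> v (\<rho> (inv v \<otimes> (h \<otimes> u)) x)"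
        using act u v hU x U by (intro is_act_mult) (auto simp: subgroup.m_closed subgroup.m_inv_closed)
      moreover have "v \<otimes> (inv v \<otimes> (h \<otimes> u)) = h \<otimes> u"
        using UG[OF u] UG[OF v] h(1) by (simp add: inv_solve_left m_assoc[symmetric])
      ultimately have "\<rho> h (\<rho> u x) = \<rho> v x" using act hU u x is_act_mult by metis
      then have "\<rho> v x \<in> orb (stab A) \<rho> (\<rho> u x)" using h1 unfolding orb_def by (metis image_eqI)
      then show "orb (stab A) \<rho> (\<rho> u x) = orb (stab A) \<rho> (\<rho> v x)"
        using orb_eq[OF is_act_subgroup[OF act A(3)] stab_subgroup[OF A(2)]] is_act_closed[OF act u x] by metis
    qed
  qed
  have "orbs (stab A) X \<rho> = (\<Union>Q\<in>orbs U X \<rho>. orb (stab A) \<rho> ` Q)"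
    using orb_self[OF act U] orb_subset[OF act] by (auto simp: orbs_def)
  moreover have "finite (orb (stab A) \<rho> ` Q)" if "Q \<in> orbs U X \<rho>" for Q
    using that one by (auto simp: orbs_def orb_def[of U] image_image)
  ultimately show ?thesis using fin by simp
qed

lemma tame_mono:
  assumes "tame A X \<rho>" "A \<subseteq> B" "finite B" "B \<subseteq> S"
  shows "tame B X \<rho>"
proof -
  have sub: "stab B \<subseteq> stab A" by (rule stab_antimono) fact
  have iso: "\<exists>C. finite C \<and> B \<subseteq> C \<and> C \<subseteq> S \<and> isotropy (stab B) \<rho> x = stab C" if x: "x \<in> X" for x
  proof -
    obtain C where C: "finite C" "C \<subseteq> S" "isotropy (stab A) \<rho> x = stab C"
      using tame_point[OF assms(1) x] by metis
    have "isotropy (stab B) \<rho> x = stab (B \<union> C)"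
      unfolding stab_Un C(3)[symmetric] using sub by (auto simp: isotropy_def)
    then show ?thesis using C assms by (intro exI[of _ "B \<union> C"]) auto
  qed
  have "finite (orbs (stab B) X \<rho>)"
  proof (rule finite_orbs_stab[OF tame_act[OF assms(1)] tame_stab[OF assms(1)] _ assms(3,4) sub])
    show "finite (orbs (stab A) X \<rho>)" using assms(1) by (simp add: tame_def)
    show "\<exists>C. finite C \<and> C \<subseteq> S \<and> stab C \<subseteq> isotropy (stab A) \<rho> x" if "x \<in> X" for x
      using tame_point[OF assms(1) that] by (metis order_refl)
  qed
  then show ?thesis using assms iso is_act_subgroup[OF tame_act[OF assms(1)] sub]
    by (auto simp: tame_def)
qed

text \<open>
  If the stabilizers in \<open>W\<close> are \<open>W \<inter> G(C)\<close> and \<open>G(A) \<subseteq> W\<close>, then the stabilizers in \<open>G(A)\<close> are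
  \<open>G(A \<union> C)\<close>.
\<close>

lemma hat_sets_tame:
  assumes "(U, X, \<rho>) \<in> hat_sets G S (stabilizer_class G S)"
  obtains A where "stab A \<subseteq> U" "tame A X \<rho>"
proof -
  note P = hat_setsD[OF assms]
  obtain W where W: "open_subgroup G S W" "W \<subseteq> U" "E_smooth_uset G (stabilizer_class G S) (W, X, \<rho>)"
    using assms by (auto simp: hat_sets_def)
  obtain A where A: "finite A" "A \<subseteq> S" "stab A \<subseteq> W" using W(1) open_subgroup_iff by blast
  have iso: "\<exists>C. finite C \<and> A \<subseteq> C \<and> C \<subseteq> S \<and> isotropy (stab A) \<rho> x = stab C" if x: "x \<in> X" for x
  proof -
    obtain C where C: "finite C" "C \<subseteq> S" "isotropy W \<rho> x = W \<inter> stab C"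
      using W(3) x unfolding E_smooth_uset.simps stabilizer_isotropy
      by (metis stabilizer_class_iff)
    have "isotropy (stab A) \<rho> x = stab (A \<union> C)"
      unfolding stab_Un using C(3) A(3) by (auto simp: isotropy_def)
    then show ?thesis using C A by (intro exI[of _ "A \<union> C"]) auto
  qed
  have AU: "stab A \<subseteq> U" using A W by blast
  have "finite (orbs (stab A) X \<rho>)"
  proof (rule finite_orbs_stab[OF P(3,2,5) A(1,2) AU])
    fix x assume "x \<in> X"
    then obtain C where C: "finite C" "C \<subseteq> S" "isotropy (stab A) \<rho> x = stab C" using iso[of x] by metis
    moreover have "isotropy (stab A) \<rho> x \<subseteq> isotropy U \<rho> x" using AU by (auto simp: isotropy_def)
    ultimately show "\<exists>C. finite C \<and> C \<subseteq> S \<and> stab C \<subseteq> isotropy U \<rho> x" by blast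
  qed
  then have "tame A X \<rho>" using A iso is_act_subgroup[OF P(3) AU] by (auto simp: tame_def)
  then show thesis using that AU by blast
qed

end


section \<open>Measures and the classes of smooth sets\<close>

context oligo_group
begin

text \<open>
  The orbit of \<open>x\<close> under \<open>G(A)\<close> is isomorphic to \<open>G(A)/G(B)\<close>.  The set \<open>B\<close> is in general not unique.
\<close>

definition base :: "'w set \<Rightarrow> (('w \<Rightarrow> 'w) \<Rightarrow> 'x \<Rightarrow> 'x) \<Rightarrow> 'x \<Rightarrow> 'w set \<Rightarrow> bool" where
  "base A \<rho> x B \<longleftrightarrow> finite B \<and> A \<subseteq> B \<and> B \<subseteq> S \<and> isotropy (stab A) \<rho> x = stab B"

text \<open>
  A choice of \<open>B\<close> for a whole orbit \<open>Q\<close>; bases of different points of \<open>Q\<close> are translates of each other.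
\<close>

definition Bsel :: "'w set \<Rightarrow> (('w \<Rightarrow> 'w) \<Rightarrow> 'x \<Rightarrow> 'x) \<Rightarrow> 'x set \<Rightarrow> 'w set" where
  "Bsel A \<rho> Q = (SOME B. \<exists>x\<in>Q. base A \<rho> x B)"

lemma tame_base: "tame A X \<rho> \<Longrightarrow> x \<in> X \<Longrightarrow> \<exists>B. base A \<rho> x B"
  using tame_point[of A X \<rho> x] unfolding base_def by metis

lemma base_translate:
  assumes "tame A X \<rho>" "x \<in> X" "base A \<rho> x B" "g \<in> stab A"
  shows "base A \<rho> (\<rho> g x) (g ` B)"
proof -
  have "isotropy (stab A) \<rho> (\<rho> g x) = stab (g ` B)"
    using isotropy_translate[OF tame_act tame_stab, OF assms(1,1,2,4)] assms stab_image[of g B] stab_carrier[of g]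
    by (simp add: base_def)
  moreover have "A \<subseteq> g ` B" using assms stab_image_self[of g A] unfolding base_def by blast
  ultimately show ?thesis using assms G_closed[OF stab_carrier[OF assms(4)]] unfolding base_def by auto
qed

text \<open>
  The maps \<open>f\<close> below are equivariant up to conjugation by \<open>g\<close>.  The case \<open>g = \<one>\<close> covers isomorphisms, the
  case where \<open>f\<close> is the identity covers the conjugates \<open>X\<^sup>g\<close>, and translation by a group element
  between two fibers of an equivariant map is a third case.
\<close>

lemma orb_semilinear:
  assumes g: "g \<in> carrier G" and A: "A \<subseteq> S"
    and f: "\<And>h x. h \<in> stab A \<Longrightarrow> x \<in> X \<Longrightarrow> f (\<rho> h x) = \<rho>' (g \<otimes> h \<otimes> inv g) (f x)"
    and x: "x \<in> X"
  shows "orb (stab (g ` A)) \<rho>' (f x) = f ` orb (stab A) \<rho> x"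
  unfolding orb_def stab_image[OF g A] using f x by (auto simp: image_image)

lemma base_semilinear:
  assumes g: "g \<in> carrier G" and A: "A \<subseteq> S"
    and f: "\<And>h x. h \<in> stab A \<Longrightarrow> x \<in> X \<Longrightarrow> f (\<rho> h x) = \<rho>' (g \<otimes> h \<otimes> inv g) (f x)"
    and bij: "inj_on f X" and X: "\<And>h x. h \<in> stab A \<Longrightarrow> x \<in> X \<Longrightarrow> \<rho> h x \<in> X"
    and x: "x \<in> X" and B: "base A \<rho> x B"
  shows "base (g ` A) \<rho>' (f x) (g ` B)"
proof -
  have "isotropy (stab (g ` A)) \<rho>' (f x) = (\<lambda>h. g \<otimes> h \<otimes> inv g) ` isotropy (stab A) \<rho> x"
    unfolding isotropy_def stab_image[OF g A]
    using f[OF _ x, symmetric] inj_on_eq_iff[OF bij X[OF _ x] x] by auto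
  also have "\<dots> = stab (g ` B)" using B stab_image[OF g, of B] by (simp add: base_def)
  finally show ?thesis using B G_closed[OF g] by (auto simp: base_def)
qed

lemma tame_semilinear:
  assumes t: "tame A X \<rho>" and g: "g \<in> carrier G" and bij: "bij_betw f X Y"
    and f: "\<And>h x. h \<in> stab A \<Longrightarrow> x \<in> X \<Longrightarrow> f (\<rho> h x) = \<rho>' (g \<otimes> h \<otimes> inv g) (f x)"
  shows "tame (g ` A) Y \<rho>'"
proof -
  have A: "finite A" "A \<subseteq> S" using t by (auto simp: tame_def)
  note act = tame_act[OF t] and sub = tame_stab[OF t]
  have Y: "Y = f ` X" and inj: "inj_on f X" using bij by (auto simp: bij_betw_def)
  have "is_act (stab (g ` A)) Y \<rho>'"
    unfolding is_act_def Y stab_image[OF g A(2)]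
  proof (intro conjI ballI; elim imageE; simp only:)
    fix h x assume "h \<in> stab A" "x \<in> X"
    then show "\<rho>' (g \<otimes> h \<otimes> inv g) (f x) \<in> f ` X" using is_act_closed[OF act] by (simp flip: f)
  next
    fix h k x assume h: "h \<in> stab A" "k \<in> stab A" "x \<in> X"
    have "(g \<otimes> h \<otimes> inv g) \<otimes> (g \<otimes> k \<otimes> inv g) = g \<otimes> (h \<otimes> k) \<otimes> inv g"
      using h g by (simp add: m_assoc stab_carrier)
    then show "\<rho>' (g \<otimes> h \<otimes> inv g \<otimes> (g \<otimes> k \<otimes> inv g)) (f x) = \<rho>' (g \<otimes> h \<otimes> inv g) (\<rho>' (g \<otimes> k \<otimes> inv g) (f x))"
      using h is_act_closed[OF act] is_act_mult[OF act] subgroup.m_closed[OF sub]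
      by (simp flip: f)
  next
    fix x assume x: "x \<in> X"
    have "\<one> = g \<otimes> \<one> \<otimes> inv g" using g by simp
    then have "\<rho>' \<one> (f x) = f (\<rho> \<one> x)" using f[OF subgroup.one_closed[OF sub] x] by metis
    then show "\<rho>' \<one> (f x) = f x" using is_act_one[OF act x] by simp
  qed
  moreover have orb: "orb (stab (g ` A)) \<rho>' (f x) = f ` orb (stab A) \<rho> x" if "x \<in> X" for x
    by (rule orb_semilinear[of g A X f \<rho> \<rho>' x, OF g A(2) f that])
  have "orbs (stab (g ` A)) Y \<rho>' = (`) f ` orbs (stab A) X \<rho>"
    unfolding orbs_def Y using orb by (auto simp: image_image)
  then have "finite (orbs (stab (g ` A)) Y \<rho>')" using t by (simp add: tame_def)
  moreover have "\<exists>B. base (g ` A) \<rho>' y B" if "y \<in> Y" for y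
  proof -
    obtain x where x: "x \<in> X" "y = f x" using \<open>y \<in> Y\<close> Y by blast
    obtain B where B: "base A \<rho> x B" using tame_base[OF t x(1)] by metis
    have "base (g ` A) \<rho>' (f x) (g ` B)"
      by (rule base_semilinear[of g A X f \<rho> \<rho>' x B, OF g A(2) f inj is_act_closed[OF act] x(1) B])
    then show ?thesis using x(2) by metis
  qed
  ultimately show ?thesis using A G_closed[OF g] by (auto simp: tame_def base_def)
qed

lemma base_eq_iff:
  assumes t: "tame A X \<rho>" and x: "x \<in> X" and B: "base A \<rho> x B"
    and u: "u \<in> stab A" and v: "v \<in> stab A"
  shows "\<rho> u x = \<rho> v x \<longleftrightarrow> (\<forall>b\<in>B. u b = v b)"
proof -
  note act = tame_act[OF t] and sub = tame_stab[OF t]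
  note G = stab_carrier[OF u] stab_carrier[OF v]
  have vu: "inv v \<otimes> u \<in> stab A" using u v by (simp add: subgroup.m_closed[OF sub] subgroup.m_inv_closed[OF sub])
  have "\<rho> u x = \<rho> v x \<longleftrightarrow> \<rho> (inv v \<otimes> u) x = x"
  proof -
    have "\<rho> (inv v \<otimes> u) x = \<rho> (inv v) (\<rho> u x)"
      using u v x by (intro is_act_mult[OF act]) (simp_all add: subgroup.m_inv_closed[OF sub])
    then show ?thesis
      using is_act_inv[OF act sub v] is_act_closed[OF act u x] x by metis
  qed
  also have "\<dots> \<longleftrightarrow> inv v \<otimes> u \<in> stab B" using B vu unfolding base_def isotropy_def by blast
  also have "\<dots> \<longleftrightarrow> (\<forall>b\<in>B. (inv v) (u b) = b)"
    using G B by (auto simp: stab_iff mult_apply base_def subset_iff)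
  also have "\<dots> \<longleftrightarrow> (\<forall>b\<in>B. u b = v b)"
    using inv_apply[OF G(2)] G_closed[OF G(1)] B unfolding base_def by (metis subsetD)
  finally show ?thesis .
qed

lemma base_refine:
  assumes t: "tame A X \<rho>" and x: "x \<in> X" and B: "base A \<rho> x B"
    and A': "finite A'" "A' \<subseteq> S" "A \<subseteq> A'"
  shows "base A' \<rho> x (A' \<union> B)"
proof -
  have "isotropy (stab A') \<rho> x = stab A' \<inter> isotropy (stab A) \<rho> x"
    using stab_antimono[OF A'(3)] by (auto simp: isotropy_def)
  then show ?thesis using B A' by (auto simp: base_def stab_Un)
qed

lemma orbs_partition:
  assumes "is_act U X \<rho>" "subgroup U G"
  shows "X = \<Union> (orbs U X \<rho>)"
    and "Q \<in> orbs U X \<rho> \<Longrightarrow> R \<in> orbs U X \<rho> \<Longrightarrow> Q \<noteq> R \<Longrightarrow> Q \<inter> R = {}"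
    and "Q \<in> orbs U X \<rho> \<Longrightarrow> g \<in> U \<Longrightarrow> y \<in> Q \<Longrightarrow> \<rho> g y \<in> Q"
proof -
  show "X = \<Union> (orbs U X \<rho>)"
    using orb_self[OF assms] orb_subset[OF assms(1)] by (fastforce simp: orbs_def)
  show "Q \<in> orbs U X \<rho> \<Longrightarrow> R \<in> orbs U X \<rho> \<Longrightarrow> Q \<noteq> R \<Longrightarrow> Q \<inter> R = {}"
    using orbs_memD[OF assms] by (metis disjoint_iff)
  show "Q \<in> orbs U X \<rho> \<Longrightarrow> g \<in> U \<Longrightarrow> y \<in> Q \<Longrightarrow> \<rho> g y \<in> Q"
    using orb_invariant[OF assms] by (auto simp: orbs_def)
qed

end

text \<open>
  In \<open>mu_amalg\<close> the set \<open>T\<close> represents the \<open>G(A')\<close>-orbits on \<open>G(A)/G(B)\<close>: the coset of \<open>g\<close> is recorded by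
  the restriction of \<open>g\<close> to \<open>B\<close>.
\<close>

locale measure = oligo_group G S + ring_congruence eqv
  for G :: "('w \<Rightarrow> 'w) monoid" (structure) and S :: "'w set"
    and eqv :: "'r::comm_ring_1 \<Rightarrow> 'r \<Rightarrow> bool" (infix "\<approx>" 50) +
  fixes mu :: "'w set \<Rightarrow> 'w set \<Rightarrow> 'r"
  assumes mu_self: "finite A \<Longrightarrow> A \<subseteq> S \<Longrightarrow> mu A A \<approx> 1"
    and mu_trans: "finite C \<Longrightarrow> C \<subseteq> S \<Longrightarrow> A \<subseteq> B \<Longrightarrow> B \<subseteq> C \<Longrightarrow> mu A C \<approx> mu A B * mu B C"
    and mu_conj: "g \<in> carrier G \<Longrightarrow> finite B \<Longrightarrow> B \<subseteq> S \<Longrightarrow> A \<subseteq> B \<Longrightarrow> mu (g ` A) (g ` B) \<approx> mu A B"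
    and mu_amalg: "finite A' \<Longrightarrow> A' \<subseteq> S \<Longrightarrow> finite B \<Longrightarrow> B \<subseteq> S \<Longrightarrow> A \<subseteq> A' \<Longrightarrow> A \<subseteq> B \<Longrightarrow>
      finite T \<Longrightarrow> T \<subseteq> stab A \<Longrightarrow>
      (\<And>g. g \<in> stab A \<Longrightarrow> \<exists>!t. t \<in> T \<and> (\<exists>h\<in>stab A'. \<forall>b\<in>B. h (g b) = t b)) \<Longrightarrow>
      mu A B \<approx> (\<Sum>t\<in>T. mu A' (A' \<union> t ` B))"
begin

lemma mu_refl: "finite B \<Longrightarrow> B \<subseteq> S \<Longrightarrow> A \<subseteq> B \<Longrightarrow> mu A B \<approx> mu A B"
  using mu_conj[OF one_closed, of B A] eqv_reflI(2) by blast

text \<open>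
  A measure sees \<open>B\<close> only through its stabilizer.  Both sets are compared with their union \<open>D\<close>, which
  has the same stabilizer: if \<open>C\<close> is one of the two sets, then \<open>G(D) = G(C)\<close>, so the identity alone represents the \<open>G(D)\<close>-orbits on
  \<open>G(C)/G(D)\<close>, and the sum formula becomes \<open>mu C D = mu D D = 1\<close>.
\<close>

lemma mu_same_stab:
  assumes B: "finite B" "B \<subseteq> S" "A \<subseteq> B" and B': "finite B'" "B' \<subseteq> S" "A \<subseteq> B'"
    and eq: "stab B = stab B'"
  shows "mu A B \<approx> mu A B'"
proof -
  have *: "mu A (B \<union> B') \<approx> mu A C"
    if C: "finite C" "C \<subseteq> S" "A \<subseteq> C" "C \<subseteq> B \<union> B'" "stab C = stab (B \<union> B')" for C
  proof -
    let ?D = "B \<union> B'"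
    have D: "finite ?D" "?D \<subseteq> S" using B B' by auto
    have "\<And>d. d \<in> ?D \<Longrightarrow> \<one> d = d" using D one_apply by blast
    then have one: "\<one> ` ?D = ?D" "\<one> \<in> stab C"
      using C one_closed unfolding stab_iff by (simp_all add: subset_iff)
    have "mu C ?D \<approx> (\<Sum>t\<in>{\<one>}. mu ?D (?D \<union> t ` ?D))"
    proof (rule mu_amalg[OF D D])
      fix g assume "g \<in> stab C"
      then have "g \<in> stab ?D" using C by simp
      then have "\<forall>b\<in>?D. \<one> (g b) = \<one> b" by (simp only: stab_iff) simp
      moreover have "\<one> \<in> stab ?D" using one C by simp
      ultimately have "\<exists>h\<in>stab ?D. \<forall>b\<in>?D. h (g b) = \<one> b" by (intro bexI[of _ "\<one>"])
      then show "\<exists>!t. t \<in> {\<one>} \<and> (\<exists>h\<in>stab ?D. \<forall>b\<in>?D. h (g b) = t b)"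
        by (intro ex1I[of _ "\<one>"]) (auto simp del: Un_iff)
    qed (use C one in auto)
    then have "mu C ?D \<approx> mu ?D ?D" by (simp add: one(1))
    then have "mu C ?D \<approx> 1" by (rule eqv_trans[OF _ mu_self[OF D]])
    then have "mu A C * mu C ?D \<approx> mu A C * 1" by (rule eqv_mult[OF mu_refl[OF C(1,2,3)]])
    then have "mu A C * mu C ?D \<approx> mu A C" by simp
    then show ?thesis by (rule eqv_trans[OF mu_trans[OF D C(3,4)]])
  qed
  have "stab (B \<union> B') = stab B" using eq by (simp add: stab_Un)
  then show ?thesis using *[of B] *[of B'] B B' eq eqv_sym eqv_trans by (metis Un_upper1 Un_upper2)
qed

lemma mu_base:
  assumes "base A \<rho> x B" "base A \<rho> x B'"
  shows "mu A B \<approx> mu A B'"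
  using assms unfolding base_def by (intro mu_same_stab) auto

lemma mu_Bsel:
  assumes "tame A X \<rho>" "x \<in> X" "base A \<rho> x B"
  shows "mu A (Bsel A \<rho> (orb (stab A) \<rho> x)) \<approx> mu A B"
proof -
  let ?B = "Bsel A \<rho> (orb (stab A) \<rho> x)"
  have "\<exists>y\<in>orb (stab A) \<rho> x. base A \<rho> y ?B"
    unfolding Bsel_def using orb_self[OF tame_act tame_stab, OF assms(1,1,2)] assms(3)
    by (intro someI[of "\<lambda>B. \<exists>y\<in>orb (stab A) \<rho> x. base A \<rho> y B"]) blast
  then obtain g where g: "g \<in> stab A" "base A \<rho> (\<rho> g x) ?B" by (auto simp: orb_def)
  have "mu A ?B \<approx> mu A (g ` B)"
    using mu_base[OF g(2) base_translate[OF assms g(1)]] .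
  also have "mu A (g ` B) \<approx> mu A B"
    using mu_conj[OF stab_carrier[OF g(1)], of B A] stab_image_self[OF g(1)] assms(3) by (simp add: base_def)
  finally show ?thesis .
qed

text \<open>
  The size of a smooth set with respect to the measure.  Up to the congruence it depends neither on the chosen
  bases (\<open>mu_Bsel\<close>) nor on \<open>A\<close> (\<open>psi_refine\<close>).
\<close>

definition psi :: "'w set \<Rightarrow> 'x set \<Rightarrow> (('w \<Rightarrow> 'w) \<Rightarrow> 'x \<Rightarrow> 'x) \<Rightarrow> 'r" where
  "psi A X \<rho> = (\<Sum>Q\<in>orbs (stab A) X \<rho>. mu A (Bsel A \<rho> Q))"

lemma psi_semilinear:
  assumes t: "tame A X \<rho>" and g: "g \<in> carrier G" and bij: "bij_betw f X Y"
    and f: "\<And>h x. h \<in> stab A \<Longrightarrow> x \<in> X \<Longrightarrow> f (\<rho> h x) = \<rho>' (g \<otimes> h \<otimes> inv g) (f x)"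
  shows "psi (g ` A) Y \<rho>' \<approx> psi A X \<rho>"
proof -
  have t': "tame (g ` A) Y \<rho>'" by (rule tame_semilinear[of A X \<rho> g f Y \<rho>', OF t g bij f])
  have A: "finite A" "A \<subseteq> S" using t by (auto simp: tame_def)
  note act = tame_act[OF t]
  have Y: "Y = f ` X" and inj: "inj_on f X" using bij by (auto simp: bij_betw_def)
  have orb: "orb (stab (g ` A)) \<rho>' (f x) = f ` orb (stab A) \<rho> x" if "x \<in> X" for x
    by (rule orb_semilinear[of g A X f \<rho> \<rho>' x, OF g A(2) f that])
  have im: "orbs (stab (g ` A)) Y \<rho>' = (`) f ` orbs (stab A) X \<rho>"
    unfolding orbs_def Y using orb by (auto simp: image_image)
  have sub: "Q \<subseteq> X" if "Q \<in> orbs (stab A) X \<rho>" for Q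
    using that orb_subset[OF act] unfolding orbs_def by (elim imageE) simp
  have "inj_on ((`) f) (orbs (stab A) X \<rho>)"
    by (rule inj_onI) (simp add: inj_on_image_eq_iff[OF inj sub sub])
  then have "psi (g ` A) Y \<rho>' = (\<Sum>Q\<in>orbs (stab A) X \<rho>. mu (g ` A) (Bsel (g ` A) \<rho>' (f ` Q)))"
    unfolding psi_def im by (simp add: sum.reindex)
  also have "\<dots> \<approx> psi A X \<rho>"
    unfolding psi_def
  proof (rule eqv_sum)
    fix Q assume "Q \<in> orbs (stab A) X \<rho>"
    then obtain x where x: "x \<in> X" and Q: "Q = orb (stab A) \<rho> x" by (auto simp: orbs_def)
    obtain B where B: "base A \<rho> x B" using tame_base[OF t x] by metis
    have fx: "f x \<in> Y" using x Y by simp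
    have "base (g ` A) \<rho>' (f x) (g ` B)"
      by (rule base_semilinear[of g A X f \<rho> \<rho>' x B, OF g A(2) f inj is_act_closed[OF act] x B])
    then have "mu (g ` A) (Bsel (g ` A) \<rho>' (f ` Q)) \<approx> mu (g ` A) (g ` B)"
      unfolding Q orb[OF x, symmetric] by (rule mu_Bsel[OF t' fx])
    also have "mu (g ` A) (g ` B) \<approx> mu A B" using B by (intro mu_conj g) (auto simp: base_def)
    also have "mu A B \<approx> mu A (Bsel A \<rho> Q)" unfolding Q using mu_Bsel[OF t x B] eqv_sym by blast
    finally show "mu (g ` A) (Bsel (g ` A) \<rho>' (f ` Q)) \<approx> mu A (Bsel A \<rho> Q)" .
  qed
  finally show ?thesis .
qed

lemma psi_iso:
  assumes t: "tame A X \<rho>" and bij: "bij_betw f X Y"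
    and f: "\<And>h x. h \<in> stab A \<Longrightarrow> x \<in> X \<Longrightarrow> f (\<rho> h x) = \<rho>' h (f x)"
  shows "psi A Y \<rho>' \<approx> psi A X \<rho>"
proof -
  have A: "A \<subseteq> S" using t by (simp add: tame_def)
  have "\<one> ` A = A" using A one_apply by (force simp: subset_iff)
  then show ?thesis
    using psi_semilinear[OF t one_closed bij, of \<rho>'] f stab_carrier by simp
qed

lemma psi_Union:
  assumes t: "tame A X \<rho>" and I: "finite I" and X: "X = (\<Union>i\<in>I. Y i)"
    and disj: "\<And>i j. i \<in> I \<Longrightarrow> j \<in> I \<Longrightarrow> i \<noteq> j \<Longrightarrow> Y i \<inter> Y j = {}"
    and inv: "\<And>i g y. i \<in> I \<Longrightarrow> g \<in> stab A \<Longrightarrow> y \<in> Y i \<Longrightarrow> \<rho> g y \<in> Y i"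
  shows "psi A X \<rho> = (\<Sum>i\<in>I. psi A (Y i) \<rho>)"
proof -
  have orbs: "orbs (stab A) X \<rho> = (\<Union>i\<in>I. orbs (stab A) (Y i) \<rho>)" unfolding orbs_def X by blast
  have sub: "Q \<subseteq> Y i \<and> Q \<noteq> {}" if i: "i \<in> I" and Q: "Q \<in> orbs (stab A) (Y i) \<rho>" for i Q
  proof -
    obtain y where "y \<in> Y i" "Q = orb (stab A) \<rho> y" using Q by (auto simp: orbs_def)
    moreover have "y \<in> X" using \<open>y \<in> Y i\<close> i X by blast
    ultimately show ?thesis using inv[OF i] orb_self[OF tame_act[OF t] tame_stab[OF t], of y]
      by (auto simp: orb_def)
  qed
  show ?thesis unfolding psi_def orbs
  proof (rule sum.UNION_disjoint[OF I])
    show "\<forall>i\<in>I. finite (orbs (stab A) (Y i) \<rho>)"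
      using t orbs finite_subset[of _ "orbs (stab A) X \<rho>"] by (auto simp: tame_def)
    show "\<forall>i\<in>I. \<forall>j\<in>I. i \<noteq> j \<longrightarrow> orbs (stab A) (Y i) \<rho> \<inter> orbs (stab A) (Y j) \<rho> = {}"
    proof (intro ballI impI equals0I)
      fix i j Q assume "i \<in> I" "j \<in> I" "i \<noteq> j" "Q \<in> orbs (stab A) (Y i) \<rho> \<inter> orbs (stab A) (Y j) \<rho>"
      then show False using sub[of i Q] sub[of j Q] disj[of i j] by auto
    qed
  qed
qed

text \<open>
  The sum formula, reinterpreted: for a transitive \<open>G(A)\<close>-set the size does not change when \<open>A\<close> grows.
\<close>

lemma mu_refine:
  assumes t: "tame A X \<rho>" and x: "x \<in> X" and B: "base A \<rho> x B"
    and A': "finite A'" "A' \<subseteq> S" "A \<subseteq> A'"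
  shows "mu A B \<approx> psi A' (orb (stab A) \<rho> x) \<rho>"
proof -
  let ?O = "orb (stab A) \<rho> x"
  note act = tame_act[OF t] and sub = tame_stab[OF t]
  have O: "?O \<subseteq> X" by (rule orb_subset[OF act x])
  have sub': "stab A' \<subseteq> stab A" "subgroup (stab A') G"
    using stab_antimono[OF A'(3)] stab_subgroup[OF A'(2)] by auto
  have tX': "tame A' X \<rho>" by (rule tame_mono[OF t A'(3,1,2)])
  have t': "tame A' ?O \<rho>"
    using sub' by (intro tame_subset[OF tX' O]) (auto intro: orb_invariant[OF act sub x])
  note act' = tame_act[OF t']
  define gs where "gs Q = (SOME g. g \<in> stab A \<and> \<rho> g x \<in> Q)" for Q
  have gs: "gs Q \<in> stab A \<and> \<rho> (gs Q) x \<in> Q" if "Q \<in> orbs (stab A') ?O \<rho>" for Q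
  proof -
    obtain y where "y \<in> ?O" "y \<in> Q" using orb_self[OF act' sub'(2)] \<open>Q \<in> _\<close> by (auto simp: orbs_def)
    then have "\<exists>g. g \<in> stab A \<and> \<rho> g x \<in> Q" by (auto simp: orb_def)
    then show ?thesis unfolding gs_def by (rule someI_ex)
  qed
  have Qeq: "Q = orb (stab A') \<rho> (\<rho> (gs Q) x)" if "Q \<in> orbs (stab A') ?O \<rho>" for Q
    using orbs_memD[OF act' sub'(2) that] gs[OF that] by blast
  have inj: "inj_on gs (orbs (stab A') ?O \<rho>)"
    by (rule inj_onI) (metis Qeq)
  have key: "(\<exists>h\<in>stab A'. \<forall>b\<in>B. h (g b) = t b) \<longleftrightarrow> orb (stab A') \<rho> (\<rho> g x) = orb (stab A') \<rho> (\<rho> t x)"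
    if g: "g \<in> stab A" and t': "t \<in> stab A" for g t
  proof -
    have "(\<forall>b\<in>B. h (g b) = t b) \<longleftrightarrow> \<rho> h (\<rho> g x) = \<rho> t x" if h: "h \<in> stab A'" for h
    proof -
      have hA: "h \<in> stab A" using h sub' by blast
      have "(\<forall>b\<in>B. h (g b) = t b) \<longleftrightarrow> (\<forall>b\<in>B. (h \<otimes> g) b = t b)"
        using B stab_carrier[OF hA] stab_carrier[OF g] by (auto simp: base_def mult_apply subset_iff)
      also have "\<dots> \<longleftrightarrow> \<rho> (h \<otimes> g) x = \<rho> t x"
        using base_eq_iff[OF t x B subgroup.m_closed[OF sub hA g] t'] by blast
      finally show ?thesis using is_act_mult[OF act hA g x] by simp
    qed
    then have "(\<exists>h\<in>stab A'. \<forall>b\<in>B. h (g b) = t b) \<longleftrightarrow> \<rho> t x \<in> orb (stab A') \<rho> (\<rho> g x)"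
      unfolding orb_def by (auto intro: rev_image_eqI)
    also have "\<dots> \<longleftrightarrow> orb (stab A') \<rho> (\<rho> g x) = orb (stab A') \<rho> (\<rho> t x)"
      using orb_eq[OF tame_act[OF tX'] sub'(2) is_act_closed[OF act g x]]
        orb_self[OF tame_act[OF tX'] sub'(2) is_act_closed[OF act t' x]] by metis
    finally show ?thesis .
  qed
  \<comment> \<open>The elements \<open>gs Q\<close> represent the orbits of \<open>G(A')\<close> on the cosets of \<open>G(B)\<close>, by \<open>key\<close>.\<close>
  have "mu A B \<approx> (\<Sum>t\<in>gs ` orbs (stab A') ?O \<rho>. mu A' (A' \<union> t ` B))"
  proof (rule mu_amalg[OF A'(1,2)])
    show "finite (gs ` orbs (stab A') ?O \<rho>)" using t' by (simp add: tame_def)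
    fix g assume g: "g \<in> stab A"
    let ?Q = "orb (stab A') \<rho> (\<rho> g x)"
    have Q: "?Q \<in> orbs (stab A') ?O \<rho>" using g by (auto simp: orbs_def orb_def[of "stab A"])
    show "\<exists>!t. t \<in> gs ` orbs (stab A') ?O \<rho> \<and> (\<exists>h\<in>stab A'. \<forall>b\<in>B. h (g b) = t b)"
    proof (rule ex1I[of _ "gs ?Q"])
      show "gs ?Q \<in> gs ` orbs (stab A') ?O \<rho> \<and> (\<exists>h\<in>stab A'. \<forall>b\<in>B. h (g b) = gs ?Q b)"
        using Q key[OF g, of "gs ?Q"] gs[OF Q] Qeq[OF Q] by blast
      fix t assume t: "t \<in> gs ` orbs (stab A') ?O \<rho> \<and> (\<exists>h\<in>stab A'. \<forall>b\<in>B. h (g b) = t b)"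
      then obtain Q' where Q': "Q' \<in> orbs (stab A') ?O \<rho>" "t = gs Q'" by blast
      then show "t = gs ?Q" using t key[OF g, of t] gs[OF Q'(1)] Qeq[OF Q'(1)] by simp
    qed
  qed (use B A' gs in \<open>auto simp: base_def\<close>)
  also have "\<dots> = (\<Sum>Q\<in>orbs (stab A') ?O \<rho>. mu A' (A' \<union> gs Q ` B))"
    by (simp add: sum.reindex[OF inj])
  also have "\<dots> \<approx> psi A' ?O \<rho>"
    unfolding psi_def
  proof (rule eqv_sum)
    fix Q assume Q: "Q \<in> orbs (stab A') ?O \<rho>"
    have g: "gs Q \<in> stab A" using gs[OF Q] by blast
    have y: "\<rho> (gs Q) x \<in> X" by (rule is_act_closed[OF act g x])
    have "base A' \<rho> (\<rho> (gs Q) x) (A' \<union> gs Q ` B)"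
      by (rule base_refine[OF t y base_translate[OF t x B g] A'])
    from mu_Bsel[OF tX' y this] show "mu A' (A' \<union> gs Q ` B) \<approx> mu A' (Bsel A' \<rho> Q)"
      using Qeq[OF Q] eqv_sym by metis
  qed
  finally show ?thesis .
qed

lemma psi_refine:
  assumes t: "tame A X \<rho>" and A': "finite A'" "A' \<subseteq> S" "A \<subseteq> A'"
  shows "psi A X \<rho> \<approx> psi A' X \<rho>"
proof -
  note act = tame_act[OF t] and sub = tame_stab[OF t]
  have "psi A' X \<rho> = (\<Sum>Q\<in>orbs (stab A) X \<rho>. psi A' Q \<rho>)"
    using orbs_partition[OF act sub] stab_antimono[OF A'(3)] t
    by (intro psi_Union[OF tame_mono[OF t A'(3,1,2)]]) (auto simp: tame_def)
  moreover have "psi A X \<rho> \<approx> (\<Sum>Q\<in>orbs (stab A) X \<rho>. psi A' Q \<rho>)"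
    unfolding psi_def[of A]
  proof (rule eqv_sum)
    fix Q assume "Q \<in> orbs (stab A) X \<rho>"
    then obtain x where x: "x \<in> X" and Q: "Q = orb (stab A) \<rho> x" by (auto simp: orbs_def)
    obtain B where B: "base A \<rho> x B" using tame_base[OF t x] by metis
    show "mu A (Bsel A \<rho> Q) \<approx> psi A' Q \<rho>"
      unfolding Q by (rule eqv_trans[OF mu_Bsel[OF t x B] mu_refine[OF t x B A']])
  qed
  ultimately show ?thesis by simp
qed

text \<open>
  The choice of \<open>A\<close> is immaterial by \<open>psi_set_eq\<close>: two sets for which \<open>X\<close> is tame are compared through
  their union.
\<close>

definition psi_set :: "'x set \<Rightarrow> (('w \<Rightarrow> 'w) \<Rightarrow> 'x \<Rightarrow> 'x) \<Rightarrow> 'r" where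
  "psi_set X \<rho> = psi (SOME A. tame A X \<rho>) X \<rho>"

lemma psi_set_eq:
  assumes t: "tame A X \<rho>"
  shows "psi_set X \<rho> \<approx> psi A X \<rho>"
proof -
  define A' where "A' = (SOME A. tame A X \<rho>)"
  have t': "tame A' X \<rho>" unfolding A'_def by (rule someI[of "\<lambda>A. tame A X \<rho>", OF t])
  have "finite (A \<union> A')" "A \<union> A' \<subseteq> S" using t t' by (auto simp: tame_def)
  then have "psi A X \<rho> \<approx> psi (A \<union> A') X \<rho>" "psi A' X \<rho> \<approx> psi (A \<union> A') X \<rho>"
    by (auto intro!: psi_refine t t')
  then show ?thesis unfolding psi_set_def A'_def[symmetric] using eqv_sym eqv_trans by metis
qed

lemma psi_set_orbit:
  assumes "tame A X \<rho>" "base A \<rho> x B" "x \<in> X" "X = orb (stab A) \<rho> x"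
  shows "psi_set X \<rho> \<approx> mu A B"
proof -
  have "orbs (stab A) X \<rho> = {X}"
    using orb_eq[OF tame_act tame_stab, OF assms(1,1,3)] assms(3,4) unfolding orbs_def by blast
  then have "psi A X \<rho> \<approx> mu A B" using mu_Bsel[OF assms(1,3,2)] assms(4) by (simp add: psi_def)
  then show ?thesis using psi_set_eq[OF assms(1)] eqv_trans by blast
qed

lemma psi_set_iso:
  assumes t: "tame A X \<rho>" and t': "tame B Y \<rho>'" and W: "open_subgroup G S W" and bij: "bij_betw f X Y"
    and f: "\<And>h x. h \<in> W \<Longrightarrow> x \<in> X \<Longrightarrow> f (\<rho> h x) = \<rho>' h (f x)"
  shows "psi_set X \<rho> \<approx> psi_set Y \<rho>'"
proof -
  obtain C where C: "finite C" "C \<subseteq> S" "stab C \<subseteq> W" using W open_subgroup_iff by blast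
  let ?D = "A \<union> B \<union> C"
  have D: "finite ?D" "?D \<subseteq> S" "stab ?D \<subseteq> W" using C t t' by (auto simp: tame_def stab_Un)
  have tD: "tame ?D X \<rho>" using D by (intro tame_mono[OF t]) auto
  have tD': "tame ?D Y \<rho>'" using D by (intro tame_mono[OF t']) auto
  have "psi ?D Y \<rho>' \<approx> psi ?D X \<rho>"
    by (rule psi_iso[OF tD bij]) (use D(3) in \<open>auto intro!: f\<close>)
  from eqv_trans[OF psi_set_eq[OF tD'] this] eqv_sym[OF psi_set_eq[OF tD]]
  have "psi_set Y \<rho>' \<approx> psi_set X \<rho>" by (rule eqv_trans)
  then show ?thesis by (rule eqv_sym)
qed

lemma psi_set_singleton:
  assumes t: "tame A {x} \<rho>"
  shows "psi_set {x} \<rho> \<approx> 1"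
proof -
  note act = tame_act[OF t]
  have A: "finite A" "A \<subseteq> S" using t by (auto simp: tame_def)
  have fx: "\<rho> g x = x" if "g \<in> stab A" for g using is_act_closed[OF act that, of x] by simp
  then have "base A \<rho> x A" "{x} = orb (stab A) \<rho> x"
    using A subgroup.one_closed[OF tame_stab[OF t]] by (auto simp: base_def isotropy_def orb_def)
  then show ?thesis using psi_set_orbit[OF t _ _, of x A] mu_self[OF A] eqv_trans by blast
qed

lemma psi_set_coproduct:
  assumes t: "tame A Z \<tau>" and tX: "tame B X \<rho>" and tY: "tame C Y \<rho>'"
    and W: "open_subgroup G S W" and inj: "inj_on a X" "inj_on b Y"
    and a: "\<And>h x. h \<in> W \<Longrightarrow> x \<in> X \<Longrightarrow> a (\<rho> h x) = \<tau> h (a x)"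
    and b: "\<And>h x. h \<in> W \<Longrightarrow> x \<in> Y \<Longrightarrow> b (\<rho>' h x) = \<tau> h (b x)"
    and Z: "a ` X \<inter> b ` Y = {}" "a ` X \<union> b ` Y = Z"
  shows "psi_set Z \<tau> \<approx> psi_set X \<rho> + psi_set Y \<rho>'"
proof -
  obtain D where D: "finite D" "D \<subseteq> S" "stab D \<subseteq> W" using W open_subgroup_iff by blast
  let ?D = "A \<union> B \<union> C \<union> D"
  have D: "finite ?D" "?D \<subseteq> S" "stab ?D \<subseteq> W" using D t tX tY by (auto simp: tame_def stab_Un)
  have tD: "tame ?D Z \<tau>" using D by (intro tame_mono[OF t]) auto
  have tXD: "tame ?D X \<rho>" using D by (intro tame_mono[OF tX]) auto
  have tYD: "tame ?D Y \<rho>'" using D by (intro tame_mono[OF tY]) auto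
  have aD: "a (\<rho> h x) = \<tau> h (a x)" if "h \<in> stab ?D" "x \<in> X" for h x
    by (rule a) (use that D in auto)
  have bD: "b (\<rho>' h x) = \<tau> h (b x)" if "h \<in> stab ?D" "x \<in> Y" for h x
    by (rule b) (use that D in auto)
  have "psi ?D Z \<tau> = (\<Sum>i\<in>UNIV. psi ?D (if i then a ` X else b ` Y) \<tau>)"
  proof (rule psi_Union[OF tD])
    show "Z = (\<Union>i. if i then a ` X else b ` Y)" using Z by (auto split: if_splits)
    fix i g y assume g: "g \<in> stab ?D" "y \<in> (if i then a ` X else b ` Y)"
    show "\<tau> g y \<in> (if i then a ` X else b ` Y)"
    proof (cases i)
      case True
      then obtain x where "x \<in> X" "y = a x" using g by auto
      then show ?thesis using True aD[OF g(1), symmetric] is_act_closed[OF tame_act[OF tXD] g(1)] by simp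
    next
      case False
      then obtain x where "x \<in> Y" "y = b x" using g by auto
      then show ?thesis using False bD[OF g(1), symmetric] is_act_closed[OF tame_act[OF tYD] g(1)] by simp
    qed
  qed (use Z in auto)
  then have "psi ?D Z \<tau> = psi ?D (a ` X) \<tau> + psi ?D (b ` Y) \<tau>" by (simp add: UNIV_bool add.commute)
  also have "\<dots> \<approx> psi ?D X \<rho> + psi ?D Y \<rho>'"
    by (rule eqv_add[OF psi_iso[of _ _ \<rho> a, OF tXD inj_on_imp_bij_betw[OF inj(1)] aD]
      psi_iso[of _ _ \<rho>' b, OF tYD inj_on_imp_bij_betw[OF inj(2)] bD]])
  finally have "psi_set Z \<tau> \<approx> psi ?D X \<rho> + psi ?D Y \<rho>'"
    by (rule eqv_trans[OF psi_set_eq[OF tD]])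
  then show ?thesis
    by (rule eqv_trans[OF _ eqv_sym[OF eqv_add[OF psi_set_eq[OF tXD] psi_set_eq[OF tYD]]]])
qed

text \<open>
  Let \<open>F\<close> be the fiber over \<open>y\<close>.  The orbits of \<open>G(A)\<close> above the orbit \<open>G(A)/G(D)\<close> of \<open>y\<close> correspond to the orbits of
  \<open>G(D)\<close> on \<open>F\<close> by intersecting with \<open>F\<close>.  An orbit \<open>G(A)/G(B)\<close> meets \<open>F\<close> in \<open>G(D)/G(B)\<close>, where \<open>B\<close> may be enlarged by \<open>D\<close>
  because \<open>G(B) \<subseteq> G(D)\<close>; so the formula is \<open>mu A B = mu A D * mu D B\<close> summed over orbits.
\<close>

lemma psi_fiber_orbit:
  assumes tX: "tame A X \<rho>" and tY: "tame A Y \<rho>'"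
    and p: "\<And>x. x \<in> X \<Longrightarrow> p x \<in> Y" "\<And>g x. g \<in> stab A \<Longrightarrow> x \<in> X \<Longrightarrow> p (\<rho> g x) = \<rho>' g (p x)"
    and y: "y \<in> Y" and D: "base A \<rho>' y D"
  shows "psi A {x \<in> X. p x \<in> orb (stab A) \<rho>' y} \<rho> \<approx> mu A D * psi D {x \<in> X. p x = y} \<rho>"
    (is "psi A ?Z \<rho> \<approx> mu A D * psi D ?F \<rho>")
proof -
  note act = tame_act[OF tX] and sub = tame_stab[OF tX] and actY = tame_act[OF tY]
  have Dfin: "finite D" "A \<subseteq> D" "D \<subseteq> S" "isotropy (stab A) \<rho>' y = stab D" using D by (auto simp: base_def)
  have tD: "tame D X \<rho>" by (rule tame_mono[OF tX Dfin(2,1,3)])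
  have DA: "stab D \<subseteq> stab A" by (rule stab_antimono[OF Dfin(2)])
  have fixy: "\<rho>' g y = y \<longleftrightarrow> g \<in> stab D" if "g \<in> stab A" for g
    using Dfin(4) that unfolding isotropy_def by blast
  have tF: "tame D ?F \<rho>"
  proof (rule tame_subset[OF tD])
    fix g x assume "g \<in> stab D" "x \<in> ?F"
    then show "\<rho> g x \<in> ?F" using p(2)[of g x] DA fixy[of g] is_act_closed[OF act, of g x] by auto
  qed auto
  have tZ: "tame A ?Z \<rho>"
  proof (rule tame_subset[OF tX])
    fix g x assume "g \<in> stab A" "x \<in> ?Z"
    then show "\<rho> g x \<in> ?Z"
      using p(2)[of g x] is_act_closed[OF act, of g x] orb_invariant[OF actY sub y, of "p x" g] by auto
  qed auto
  have meet: "\<exists>x. x \<in> ?F \<and> Q = orb (stab A) \<rho> x" if Q: "Q \<in> orbs (stab A) ?Z \<rho>" for Q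
  proof -
    obtain z where z: "z \<in> X" "p z \<in> orb (stab A) \<rho>' y" "Q = orb (stab A) \<rho> z"
      using Q by (auto simp: orbs_def)
    then obtain g where g: "g \<in> stab A" "p z = \<rho>' g y" by (auto simp: orb_def)
    have ig: "inv g \<in> stab A" by (rule subgroup.m_inv_closed[OF sub g(1)])
    have "p (\<rho> (inv g) z) = y" using p(2)[OF ig z(1)] g(2) is_act_inv(1)[OF actY sub g(1) y] by simp
    then have "\<rho> (inv g) z \<in> ?F" using is_act_closed[OF act ig z(1)] by simp
    moreover have "orb (stab A) \<rho> (\<rho> (inv g) z) = Q"
      unfolding z(3) by (rule orb_eq[OF act sub z(1)]) (use ig in \<open>auto simp: orb_def\<close>)
    ultimately show ?thesis by blast
  qed
  have cut: "orb (stab A) \<rho> x \<inter> ?F = orb (stab D) \<rho> x" if x: "x \<in> ?F" for x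
  proof -
    have "\<rho> g x \<in> ?F \<longleftrightarrow> g \<in> stab D" if "g \<in> stab A" for g
      using x p(2)[OF that, of x] is_act_closed[OF act that, of x] fixy[OF that] by auto
    then show ?thesis using DA unfolding orb_def by blast
  qed
  have im: "(\<lambda>Q. Q \<inter> ?F) ` orbs (stab A) ?Z \<rho> = orbs (stab D) ?F \<rho>"
  proof
    show "(\<lambda>Q. Q \<inter> ?F) ` orbs (stab A) ?Z \<rho> \<subseteq> orbs (stab D) ?F \<rho>"
    proof
      fix R assume "R \<in> (\<lambda>Q. Q \<inter> ?F) ` orbs (stab A) ?Z \<rho>"
      then obtain Q where Q: "Q \<in> orbs (stab A) ?Z \<rho>" "R = Q \<inter> ?F" by blast
      obtain x where "x \<in> ?F" "Q = orb (stab A) \<rho> x" using meet[OF Q(1)] by metis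
      then show "R \<in> orbs (stab D) ?F \<rho>" using cut Q(2) unfolding orbs_def by blast
    qed
    show "orbs (stab D) ?F \<rho> \<subseteq> (\<lambda>Q. Q \<inter> ?F) ` orbs (stab A) ?Z \<rho>"
    proof
      fix R assume "R \<in> orbs (stab D) ?F \<rho>"
      then obtain x where x: "x \<in> ?F" "R = orb (stab D) \<rho> x" unfolding orbs_def by blast
      then have "x \<in> ?Z" using orb_self[OF actY sub y] by simp
      then show "R \<in> (\<lambda>Q. Q \<inter> ?F) ` orbs (stab A) ?Z \<rho>"
        using cut[OF x(1)] x(2) unfolding orbs_def by blast
    qed
  qed
  have inj: "inj_on (\<lambda>Q. Q \<inter> ?F) (orbs (stab A) ?Z \<rho>)"
  proof (rule inj_onI)
    fix Q R assume Q: "Q \<in> orbs (stab A) ?Z \<rho>" and R: "R \<in> orbs (stab A) ?Z \<rho>" and eq: "Q \<inter> ?F = R \<inter> ?F"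
    obtain x where x: "x \<in> ?F" "Q = orb (stab A) \<rho> x" using meet[OF Q] by metis
    have "x \<in> Q \<inter> ?F" using x orb_self[OF act sub, of x] by simp
    then have "x \<in> R" using eq by blast
    then show "Q = R" using orbs_memD[OF tame_act[OF tZ] sub R] x by blast
  qed
  have "psi A ?Z \<rho> \<approx> (\<Sum>Q\<in>orbs (stab A) ?Z \<rho>. mu A D * mu D (Bsel D \<rho> (Q \<inter> ?F)))"
    unfolding psi_def
  proof (rule eqv_sum)
    fix Q assume Q: "Q \<in> orbs (stab A) ?Z \<rho>"
    obtain x where x: "x \<in> ?F" "Q = orb (stab A) \<rho> x" using meet[OF Q] by metis
    have xX: "x \<in> X" using x by simp
    obtain B where B: "base A \<rho> x B" using tame_base[OF tX xX] by metis
    have BD: "stab B \<subseteq> stab D"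
    proof
      fix g assume g: "g \<in> stab B"
      then have "g \<in> stab A" "\<rho> g x = x" using B by (auto simp: base_def isotropy_def)
      then show "g \<in> stab D" using p(2)[of g x] x(1) fixy[of g] by simp
    qed
    have B': "base A \<rho> x (D \<union> B)" using B Dfin BD by (auto simp: base_def stab_Un)
    have "mu A (Bsel A \<rho> Q) \<approx> mu A (D \<union> B)" unfolding x(2) by (rule mu_Bsel[OF tX xX B'])
    also have "mu A (D \<union> B) \<approx> mu A D * mu D (D \<union> B)"
      using B' Dfin by (intro mu_trans) (auto simp: base_def)
    also have "\<dots> \<approx> mu A D * mu D (Bsel D \<rho> (Q \<inter> ?F))"
    proof (rule eqv_mult)
      show "mu A D \<approx> mu A D" using Dfin by (intro mu_refl) auto
      have "base D \<rho> x (D \<union> B)" by (rule base_refine[OF tX xX B Dfin(1,3,2)])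
      from mu_Bsel[OF tF x(1) this] show "mu D (D \<union> B) \<approx> mu D (Bsel D \<rho> (Q \<inter> ?F))"
        unfolding x(2) cut[OF x(1)] by (rule eqv_sym)
    qed
    finally show "mu A (Bsel A \<rho> Q) \<approx> mu A D * mu D (Bsel D \<rho> (Q \<inter> ?F))" .
  qed
  also have "\<dots> = mu A D * psi D ?F \<rho>"
    unfolding psi_def im[symmetric] sum.reindex[OF inj] by (simp add: sum_distrib_left)
  finally show ?thesis .
qed

text \<open>
  The group \<open>G(A) \<subseteq> U\<close> need not be transitive on \<open>Y\<close>, so the previous lemma is applied to each orbit of \<open>G(A)\<close> on \<open>Y\<close>.
  The fibers over different orbits have the same size because \<open>U\<close> is transitive on \<open>Y\<close>: an element \<open>u\<close> moves
  one fiber to another, up to conjugation by \<open>u\<close>.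
\<close>

lemma psi_set_fiber:
  assumes U: "subgroup U G" and AU: "stab A \<subseteq> U" and actX: "is_act U X \<rho>" and actY: "is_act U Y \<rho>'"
    and tX: "tame A X \<rho>" and tY: "tame A Y \<rho>'" and tF: "tame C {x \<in> X. p x = y} \<rho>"
    and p: "\<And>x. x \<in> X \<Longrightarrow> p x \<in> Y" "\<And>g x. g \<in> U \<Longrightarrow> x \<in> X \<Longrightarrow> p (\<rho> g x) = \<rho>' g (p x)"
    and y: "y \<in> Y" and trans: "\<And>z. z \<in> Y \<Longrightarrow> \<exists>u\<in>U. \<rho>' u y = z"
  shows "psi_set X \<rho> \<approx> psi_set {x \<in> X. p x = y} \<rho> * psi_set Y \<rho>'"
proof -
  let ?F = "\<lambda>z. {x \<in> X. p x = z}" and ?Z = "\<lambda>Q. {x \<in> X. p x \<in> Q}"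
  note sub = tame_stab[OF tX]
  note part = orbs_partition[OF tame_act[OF tY] sub]
  have pA: "p (\<rho> g x) = \<rho>' g (p x)" if "g \<in> stab A" "x \<in> X" for g x
    using that AU by (intro p(2)) auto
  have "psi A X \<rho> = (\<Sum>Q\<in>orbs (stab A) Y \<rho>'. psi A (?Z Q) \<rho>)"
  proof (rule psi_Union[OF tX])
    show "finite (orbs (stab A) Y \<rho>')" using tY by (simp add: tame_def)
    show "X = \<Union> (?Z ` orbs (stab A) Y \<rho>')" using part(1) p(1) by blast
    show "?Z Q \<inter> ?Z R = {}" if "Q \<in> orbs (stab A) Y \<rho>'" "R \<in> orbs (stab A) Y \<rho>'" "Q \<noteq> R" for Q R
      using part(2)[OF that] by blast
    show "\<rho> g x \<in> ?Z Q" if "Q \<in> orbs (stab A) Y \<rho>'" "g \<in> stab A" "x \<in> ?Z Q" for Q g x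
      using part(3)[OF that(1,2), of "p x"] that(2,3) pA is_act_closed[OF tame_act[OF tX] that(2), of x] by simp
  qed
  moreover have "(\<Sum>Q\<in>orbs (stab A) Y \<rho>'. psi A (?Z Q) \<rho>) \<approx>
      (\<Sum>Q\<in>orbs (stab A) Y \<rho>'. mu A (Bsel A \<rho>' Q) * psi_set (?F y) \<rho>)"
  proof (rule eqv_sum)
    fix Q assume "Q \<in> orbs (stab A) Y \<rho>'"
    then obtain z where z: "z \<in> Y" and Q: "Q = orb (stab A) \<rho>' z" by (auto simp: orbs_def)
    obtain D where D: "base A \<rho>' z D" using tame_base[OF tY z] by metis
    then have Dfin: "finite D" "A \<subseteq> D" "D \<subseteq> S" "isotropy (stab A) \<rho>' z = stab D" by (auto simp: base_def)
    obtain u where u: "u \<in> U" "\<rho>' u y = z" using trans[OF z] by blast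
    have iu: "inv u \<in> U" "u \<in> carrier G" using u U subgroup.mem_carrier by (auto simp: subgroup.m_inv_closed)
    have DU: "stab D \<subseteq> U" using stab_antimono[OF Dfin(2)] AU by blast
    have fixz: "\<rho>' g z = z" if "g \<in> stab D" for g
      using Dfin(4) that unfolding isotropy_def by blast
    have tFz: "tame D (?F z) \<rho>"
    proof (rule tame_subset[OF tame_mono[OF tX Dfin(2,1,3)]])
      fix g x assume "g \<in> stab D" "x \<in> ?F z"
      then show "\<rho> g x \<in> ?F z" using p(2)[of g x] DU fixz[of g] is_act_closed[OF actX, of g x] by auto
    qed auto
    have bij: "bij_betw (\<rho> (inv u)) (?F z) (?F y)"
    proof (rule bij_betwI[of _ _ _ "\<rho> u"])
      have "\<rho>' (inv u) z = y" using is_act_inv(1)[OF actY U u(1) y] u(2) by simp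
      then show "\<rho> (inv u) \<in> ?F z \<rightarrow> ?F y"
        using p(2)[OF iu(1)] is_act_closed[OF actX iu(1)] by auto
      show "\<rho> u \<in> ?F y \<rightarrow> ?F z" using p(2)[OF u(1)] u(2) is_act_closed[OF actX u(1)] by auto
    qed (use is_act_inv[OF actX U u(1)] in auto)
    have semi: "\<rho> (inv u) (\<rho> h x) = \<rho> (inv u \<otimes> h \<otimes> inv (inv u)) (\<rho> (inv u) x)"
      if "h \<in> stab D" "x \<in> ?F z" for h x
    proof -
      have h: "h \<in> U" "x \<in> X" using that DU by auto
      have "\<rho> (inv u \<otimes> h \<otimes> u) (\<rho> (inv u) x) = \<rho> (inv u) (\<rho> h (\<rho> u (\<rho> (inv u) x)))"
        using h u iu is_act_closed[OF actX] by (simp add: is_act_mult[OF actX] subgroup.m_closed[OF U])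
      then show ?thesis using is_act_inv(2)[OF actX U u(1) h(2)] iu by simp
    qed
    have g: "inv u \<in> carrier G" using iu by simp
    have "tame ((inv u) ` D) (?F y) \<rho>"
      by (rule tame_semilinear[of D "?F z" \<rho> "inv u" "\<rho> (inv u)" "?F y" \<rho>, OF tFz g bij semi])
    moreover have "psi ((inv u) ` D) (?F y) \<rho> \<approx> psi D (?F z) \<rho>"
      by (rule psi_semilinear[of D "?F z" \<rho> "inv u" "\<rho> (inv u)" "?F y" \<rho>, OF tFz g bij semi])
    ultimately have "psi_set (?F y) \<rho> \<approx> psi D (?F z) \<rho>"
      by (rule eqv_trans[OF psi_set_eq])
    from eqv_mult[OF eqv_sym[OF mu_Bsel[OF tY z D]] eqv_sym[OF this]]
    have "mu A D * psi D (?F z) \<rho> \<approx> mu A (Bsel A \<rho>' Q) * psi_set (?F y) \<rho>"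
      unfolding Q .
    moreover have "psi A (?Z Q) \<rho> \<approx> mu A D * psi D (?F z) \<rho>"
      unfolding Q by (rule psi_fiber_orbit[of A X \<rho> Y \<rho>' p z D, OF tX tY p(1) pA z D])
    ultimately show "psi A (?Z Q) \<rho> \<approx> mu A (Bsel A \<rho>' Q) * psi_set (?F y) \<rho>"
      by (rule eqv_trans[rotated])
  qed
  ultimately have "psi A X \<rho> \<approx> psi_set (?F y) \<rho> * psi A Y \<rho>'"
    by (simp add: psi_def[of A Y] sum_distrib_left mult.commute)
  moreover have "psi_set (?F y) \<rho> * psi_set Y \<rho>' \<approx> psi_set (?F y) \<rho> * psi A Y \<rho>'"
    by (rule eqv_mult[OF eqv_reflI(1)[OF psi_set_eq[OF tF]] psi_set_eq[OF tY]])
  ultimately show ?thesis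
    using eqv_trans[OF psi_set_eq[OF tX]] eqv_trans[OF _ eqv_sym] by blast
qed


end


section \<open>The ring of smooth sets carries the universal measure\<close>

context oligo_group
begin

lemma Bsel_base:
  assumes t: "tame A X \<rho>" and Q: "Q \<in> orbs (stab A) X \<rho>"
  shows "\<exists>x\<in>Q. base A \<rho> x (Bsel A \<rho> Q)"
proof -
  obtain z where z: "z \<in> Q" using orbs_nonempty[OF tame_act[OF t] tame_stab[OF t] Q] by blast
  then have "z \<in> X" using orbs_memD[OF tame_act[OF t] tame_stab[OF t] Q] by blast
  then obtain B where "base A \<rho> z B" using tame_base[OF t] by metis
  then have "\<exists>B. \<exists>x\<in>Q. base A \<rho> x B" using z by blast
  then show ?thesis unfolding Bsel_def by (rule someI_ex)
qed

abbreviation "hats \<equiv> hat_sets G S (stabilizer_class G S)"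

lemma subgroup_conj:
  assumes U: "subgroup U G" and g: "g \<in> carrier G"
  shows "subgroup ((\<lambda>u. g \<otimes> u \<otimes> inv g) ` U) G"
proof (rule subgroupI)
  note mem = subgroup.mem_carrier[OF U]
  show "(\<lambda>u. g \<otimes> u \<otimes> inv g) ` U \<subseteq> carrier G" using g mem by auto
  show "(\<lambda>u. g \<otimes> u \<otimes> inv g) ` U \<noteq> {}" using subgroup.one_closed[OF U] by auto
  fix a assume "a \<in> (\<lambda>u. g \<otimes> u \<otimes> inv g) ` U"
  then obtain u where u: "u \<in> U" "a = g \<otimes> u \<otimes> inv g" by blast
  have "inv a = g \<otimes> inv u \<otimes> inv g"
    using g mem[OF u(1)] by (simp add: u(2) inv_mult_group m_assoc)
  then show "inv a \<in> (\<lambda>u. g \<otimes> u \<otimes> inv g) ` U" using subgroup.m_inv_closed[OF U u(1)] by blast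
  fix b assume "b \<in> (\<lambda>u. g \<otimes> u \<otimes> inv g) ` U"
  then obtain v where v: "v \<in> U" "b = g \<otimes> v \<otimes> inv g" by blast
  have "a \<otimes> b = g \<otimes> (u \<otimes> v) \<otimes> inv g"
    using g mem[OF u(1)] mem[OF v(1)] by (simp add: u(2) v(2) m_assoc)
  then show "a \<otimes> b \<in> (\<lambda>u. g \<otimes> u \<otimes> inv g) ` U" using subgroup.m_closed[OF U u(1) v(1)] by blast
qed

lemma conj_conj: "g \<in> carrier G \<Longrightarrow> u \<in> carrier G \<Longrightarrow> inv g \<otimes> (g \<otimes> u \<otimes> inv g) \<otimes> g = u"
  by (simp add: m_assoc)

text \<open>
  The relations have to be polynomials in admissible generators, since an ideal generated by a set that
  leaves the ring is the whole type.  So conjugates and fibers must again be finitary \<open>\<E>\<close>-smooth sets.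
\<close>

lemma hat_conj_closed:
  assumes g: "g \<in> carrier G" and P: "(U, X, \<rho>) \<in> hats"
  shows "hat_conj G g (U, X, \<rho>) \<in> hats"
    and "tame A X \<rho> \<Longrightarrow> tame (g ` A) X (\<lambda>h. \<rho> (inv g \<otimes> h \<otimes> g))"
proof -
  let ?U = "(\<lambda>u. g \<otimes> u \<otimes> inv g) ` U" and ?\<rho> = "\<lambda>h. \<rho> (inv g \<otimes> h \<otimes> g)"
  note D = hat_setsD[OF P]
  note mem = subgroup.mem_carrier[OF D(2)]
  have \<rho>: "?\<rho> (g \<otimes> u \<otimes> inv g) = \<rho> u" if "u \<in> carrier G" for u
    using conj_conj[OF g that] by simp
  show t: "tame (g ` A) X ?\<rho>" if "tame A X \<rho>" for A
    by (rule tame_semilinear[of A X \<rho> g "\<lambda>x. x" X ?\<rho>, OF that g])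
      (auto simp: \<rho> stab_carrier bij_betw_def)
  obtain A where A: "stab A \<subseteq> U" "tame A X \<rho>" using hat_sets_tame[OF P] by metis
  note t = t[OF A(2)]
  have "A \<subseteq> S" using A(2) by (simp add: tame_def)
  show "hat_conj G g (U, X, \<rho>) \<in> hats"
    unfolding hat_conj.simps
  proof (rule hat_setsI[where A = "g ` A"])
    show "subgroup ?U G" by (rule subgroup_conj[OF D(2) g])
    show "stab (g ` A) \<subseteq> ?U" unfolding stab_image[OF g \<open>A \<subseteq> S\<close>] using A(1) by blast
    show "is_act ?U X ?\<rho>"
      unfolding is_act_def
    proof (intro conjI ballI; (elim imageE)?; (simp only:)?)
      fix u x assume "u \<in> U" "x \<in> X"
      then show "?\<rho> (g \<otimes> u \<otimes> inv g) x \<in> X" using \<rho>[OF mem] is_act_closed[OF D(3)] by simp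
    next
      fix u v x assume u: "u \<in> U" "v \<in> U" "x \<in> X"
      have "g \<otimes> u \<otimes> inv g \<otimes> (g \<otimes> v \<otimes> inv g) = g \<otimes> (u \<otimes> v) \<otimes> inv g"
        using g mem[OF u(1)] mem[OF u(2)] by (simp add: m_assoc)
      then show "?\<rho> (g \<otimes> u \<otimes> inv g \<otimes> (g \<otimes> v \<otimes> inv g)) x = ?\<rho> (g \<otimes> u \<otimes> inv g) (?\<rho> (g \<otimes> v \<otimes> inv g) x)"
        using u \<rho> mem is_act_mult[OF D(3)] by simp
    next
      fix x assume "x \<in> X"
      then show "?\<rho> \<one> x = x" using g is_act_one[OF D(3)] by simp
    qed
    show "?\<rho> k \<in> extensional X" if "k \<in> ?U" for k using that \<rho>[OF mem] D(4) by auto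
    have "orbs ?U X ?\<rho> = orbs U X \<rho>"
      unfolding orbs_def orb_def image_image using \<rho>[OF mem] by simp
    then show "finite (orbs ?U X ?\<rho>)" using D(5) by simp
    show "\<exists>B. finite B \<and> B \<subseteq> S \<and> isotropy (stab (g ` A)) ?\<rho> x = stab B" if "x \<in> X" for x
      using tame_point[OF t that] by metis
  qed (use t in \<open>simp_all add: tame_def\<close>)
qed

lemma transitive_E_smoothD:
  assumes "transitive_E_smooth_uset G S (stabilizer_class G S) (U, X, \<rho>)"
  shows "(U, X, \<rho>) \<in> hats" and "subgroup U G" and "is_act U X \<rho>"
    and "\<And>x y. x \<in> X \<Longrightarrow> y \<in> X \<Longrightarrow> \<exists>u\<in>U. \<rho> u x = y"
    and "\<And>x. x \<in> X \<Longrightarrow> \<exists>B. finite B \<and> B \<subseteq> S \<and> isotropy U \<rho> x = U \<inter> stab B"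
proof -
  have sm: "smooth_set G S (U, X, \<rho>)" and ne: "X \<noteq> {}"
    and tr: "transitive_action (G\<lparr>carrier := U\<rparr>) X \<rho>"
    and E: "E_smooth_uset G (stabilizer_class G S) (U, X, \<rho>)"
    using assms by auto
  have oU: "open_subgroup G S U" using sm by simp
  then show U: "subgroup U G" by (simp add: open_subgroup_def)
  then show act: "is_act U X \<rho>" using sm group_action_iff[OF U, of X \<rho>] by simp
  show trans: "\<exists>u\<in>U. \<rho> u x = y" if "x \<in> X" "y \<in> X" for x y
    using transitive_action.unique_orbit[OF tr that] by simp
  show "\<exists>B. finite B \<and> B \<subseteq> S \<and> isotropy U \<rho> x = U \<inter> stab B" if "x \<in> X" for x
    using E that unfolding E_smooth_uset.simps stabilizer_isotropy by (metis stabilizer_class_iff)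
  have "orbs U X \<rho> \<subseteq> {X}"
    using trans is_act_closed[OF act] unfolding orbs_def orb_def by fastforce
  then have "finite (orbs U X \<rho>)" using finite_subset by blast
  moreover have "E_smooth G S (stabilizer_class G S) (U, X, \<rho>)"
    using oU E unfolding E_smooth.simps by blast
  ultimately show "(U, X, \<rho>) \<in> hats"
    using sm by (simp add: hat_sets_def orbits_orbs del: smooth_set.simps E_smooth.simps)
qed

lemma transitive_E_smoothI:
  assumes U: "open_subgroup G S U" and act: "is_act U X \<rho>" and ext: "\<And>g. g \<in> U \<Longrightarrow> \<rho> g \<in> extensional X"
    and x: "x \<in> X" "X = orb U \<rho> x"
    and iso: "\<And>z. z \<in> X \<Longrightarrow> \<exists>B. finite B \<and> B \<subseteq> S \<and> isotropy U \<rho> z = U \<inter> stab B"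
  shows "transitive_E_smooth_uset G S (stabilizer_class G S) (U, X, \<rho>)"
proof -
  have sU: "subgroup U G" using U by (simp add: open_subgroup_def)
  have ga: "group_action (G\<lparr>carrier := U\<rparr>) X \<rho>"
    using group_action_iff[OF sU, of X \<rho>] act ext by blast
  have E: "E_smooth_uset G (stabilizer_class G S) (U, X, \<rho>)"
    unfolding E_smooth_uset.simps stabilizer_isotropy using iso by (metis stabilizer_class_iff)
  have op: "open_in_group G S (isotropy U \<rho> z)" if z: "z \<in> X" for z
  proof -
    obtain B where B: "finite B" "B \<subseteq> S" "isotropy U \<rho> z = U \<inter> stab B" using iso[OF z] by metis
    then show ?thesis
      using open_subgroup_Int[OF U open_stab[OF B(1,2)]] by (simp add: open_subgroup_def)
  qed
  have "transitive_action (G\<lparr>carrier := U\<rparr>) X \<rho>"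
  proof (intro transitive_action.intro ga transitive_action_axioms.intro)
    fix y z assume y: "y \<in> X" and z: "z \<in> X"
    then have "z \<in> orb U \<rho> y" using orb_eq[OF act sU x(1), of y] x(2) by simp
    then show "\<exists>g\<in>carrier (G\<lparr>carrier := U\<rparr>). \<rho> g y = z" by (auto simp: orb_def)
  qed
  then show ?thesis using U ga op x(1) E by (auto simp: stabilizer_isotropy simp del: E_smooth_uset.simps)
qed

lemma is_act_restrict:
  assumes "is_act U Y \<rho>" "subgroup U G"
  shows "is_act U Y (\<lambda>g. restrict (\<rho> g) Y)"
  using assms unfolding is_act_def by simp

lemma orbs_restrict: "orbs U Y (\<lambda>g. restrict (\<rho> g) Y) = orbs U Y \<rho>"
  unfolding orbs_def orb_def by (intro image_cong) auto

lemma isotropy_restrict: "x \<in> Y \<Longrightarrow> isotropy U (\<lambda>g. restrict (\<rho> g) Y) x = isotropy U \<rho> x"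
  unfolding isotropy_def by simp

lemma fiber_closed:
  assumes X: "transitive_E_smooth_uset G S (stabilizer_class G S) (U, X, \<rho>)"
    and Y: "transitive_E_smooth_uset G S (stabilizer_class G S) (U, Y, \<rho>')"
    and p: "p \<in> X \<rightarrow> Y" "\<forall>g\<in>U. \<forall>x\<in>X. p (\<rho> g x) = \<rho>' g (p x)" and y: "y \<in> Y"
  shows "fiber G U X \<rho> \<rho>' p y \<in> hats"
    and "\<exists>D. stab D \<subseteq> U \<and> tame D X \<rho> \<and> tame D Y \<rho>' \<and> tame D {x \<in> X. p x = y} \<rho>"
proof -
  let ?F = "{x \<in> X. p x = y}" and ?V = "isotropy U \<rho>' y"
  note DX = transitive_E_smoothD[OF X] and DY = transitive_E_smoothD[OF Y]
  obtain A where A: "stab A \<subseteq> U" "tame A X \<rho>" using hat_sets_tame[OF DX(1)] by metis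
  obtain A' where A': "stab A' \<subseteq> U" "tame A' Y \<rho>'" using hat_sets_tame[OF DY(1)] by metis
  obtain C where C: "finite C" "C \<subseteq> S" "?V = U \<inter> stab C" using DY(5)[OF y] by metis
  define D where "D = A \<union> A' \<union> C"
  have D: "finite D" "D \<subseteq> S" "stab D \<subseteq> ?V" "stab D \<subseteq> U"
    using A A' C by (auto simp: D_def tame_def stab_Un)
  have tX: "tame D X \<rho>" by (rule tame_mono[OF A(2) _ D(1,2)]) (auto simp: D_def)
  have tY: "tame D Y \<rho>'" by (rule tame_mono[OF A'(2) _ D(1,2)]) (auto simp: D_def)
  have inv: "\<rho> g x \<in> ?F" if "g \<in> ?V" "x \<in> ?F" for g x
  proof -
    have "g \<in> U" "\<rho>' g y = y" using that by (auto simp: isotropy_def)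
    then show ?thesis using that p(2) is_act_closed[OF DX(3)] by simp
  qed
  have tF: "tame D ?F \<rho>"
    by (rule tame_subset[OF tX]) (use inv D(3) in blast)+
  show "\<exists>D. stab D \<subseteq> U \<and> tame D X \<rho> \<and> tame D Y \<rho>' \<and> tame D ?F \<rho>"
    using D(4) tX tY tF by (intro exI[of _ D]) simp
  have V: "subgroup ?V G" by (rule isotropy_subgroup[OF DY(3,2) y])
  have act: "is_act ?V ?F \<rho>"
    by (rule is_act_subset[OF is_act_subgroup[OF DX(3)]]) (use inv in \<open>auto simp: isotropy_def\<close>)
  have "orb ?V \<rho> x = ?F" if x: "x \<in> ?F" for x
  proof
    show "orb ?V \<rho> x \<subseteq> ?F" by (rule orb_subset[OF act x])
    show "?F \<subseteq> orb ?V \<rho> x"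
    proof
      fix z assume z: "z \<in> ?F"
      obtain u where u: "u \<in> U" "\<rho> u x = z" using DX(4)[of x z] x z by auto
      then have "\<rho>' u y = y" using p(2) x z by auto
      then show "z \<in> orb ?V \<rho> x" using u unfolding orb_def isotropy_def by blast
    qed
  qed
  then have "orbs ?V ?F \<rho> \<subseteq> {?F}" unfolding orbs_def by blast
  then have fin: "finite (orbs ?V ?F \<rho>)" by (rule finite_subset) simp
  show "fiber G U X \<rho> \<rho>' p y \<in> hats"
    unfolding fiber_def stabilizer_isotropy
  proof (rule hat_setsI[OF V D(1-3) is_act_restrict[OF act V]])
    show "finite (orbs ?V ?F (\<lambda>g. restrict (\<rho> g) ?F))" unfolding orbs_restrict by (rule fin)
    show "\<exists>B. finite B \<and> B \<subseteq> S \<and> isotropy (stab D) (\<lambda>g. restrict (\<rho> g) ?F) x = stab B" if "x \<in> ?F" for x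
      unfolding isotropy_restrict[OF that] using tame_point[OF tF that] by metis
  qed simp
qed

lemma hat_rels_cases:
  fixes r :: "('w, 'x) gset int_mpoly"
  assumes "r \<in> Theta_group_rels G S (stabilizer_class G S)"
  obtains
    (iso) P Q :: "('w, 'x) gset" where "r = var P - var Q" "P \<in> hats" "Q \<in> hats" "hat_iso G S P Q"
  | (singleton) P :: "('w, 'x) gset" where "r = var P - 1" "P \<in> hats" "is_singleton (points P)"
  | (coproduct) R P Q :: "('w, 'x) gset" where "r = var R - (var P + var Q)" "R \<in> hats" "P \<in> hats" "Q \<in> hats"
      "hat_coproduct G S R P Q"
  | (conj) g and P :: "('w, 'x) gset" where "r = var (hat_conj G g P) - var P" "g \<in> carrier G" "P \<in> hats"
  | (fiber) U :: "('w \<Rightarrow> 'w) set" and X Y :: "'x set" and \<rho> \<rho>' p y where "r = var (U, X, \<rho>) - var (fiber G U X \<rho> \<rho>' p y) * var (U, Y, \<rho>')"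
      "transitive_E_smooth_uset G S (stabilizer_class G S) (U, X, \<rho>)"
      "transitive_E_smooth_uset G S (stabilizer_class G S) (U, Y, \<rho>')"
      "p \<in> X \<rightarrow> Y" "\<forall>g\<in>U. \<forall>x\<in>X. p (\<rho> g x) = \<rho>' g (p x)" "y \<in> Y"
  using assms unfolding Theta_group_rels_def
  by (elim UnE CollectE exE conjE) metis+

lemma hat_rels_closed: "Theta_group_rels G S (stabilizer_class G S) \<subseteq> carrier (free_comm_ring hats)"
proof
  fix r :: "('w, 'x) gset int_mpoly"
  assume "r \<in> Theta_group_rels G S (stabilizer_class G S)"
  then show "r \<in> carrier (free_comm_ring hats)"
  proof (cases rule: hat_rels_cases)
    case (conj g P)
    obtain U X \<rho> where "P = (U, X, \<rho>)" by (metis surj_pair)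
    then show ?thesis using conj hat_conj_closed(1)[of g U X \<rho>] by (auto intro!: free_closed)
  next
    case (fiber U X Y \<rho> \<rho>' p y)
    show ?thesis unfolding fiber(1)
      using fiber_closed(1)[OF fiber(2-6)] transitive_E_smoothD(1)[OF fiber(2)]
        transitive_E_smoothD(1)[OF fiber(3)]
      by (intro free_closed)
  qed (auto intro!: free_closed)
qed

text \<open>
  \<open>g x \<mapsto> g y\<close> is well defined when the stabilizer of \<open>x\<close> fixes \<open>y\<close>.
\<close>

lemma orbit_map:
  assumes U: "subgroup U G" and actX: "is_act U X \<rho>" and actY: "is_act U Y \<rho>'"
    and x: "x \<in> X" and y: "y \<in> Y" and sub: "isotropy U \<rho> x \<subseteq> isotropy U \<rho>' y"
  shows "\<exists>p. p x = y \<and> (\<forall>g\<in>U. p (\<rho> g x) = \<rho>' g y)"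
proof -
  define p where "p z = \<rho>' (SOME g. g \<in> U \<and> \<rho> g x = z) y" for z
  have *: "p (\<rho> g x) = \<rho>' g y" if g: "g \<in> U" for g
  proof -
    define h where "h = (SOME h. h \<in> U \<and> \<rho> h x = \<rho> g x)"
    have h: "h \<in> U" "\<rho> h x = \<rho> g x"
      using someI[of "\<lambda>h. h \<in> U \<and> \<rho> h x = \<rho> g x" g] g unfolding h_def by auto
    have ig: "inv g \<in> U" by (rule subgroup.m_inv_closed[OF U g])
    have "\<rho> (inv g \<otimes> h) x = x"
      using is_act_mult[OF actX ig h(1) x] h(2) is_act_inv(1)[OF actX U g x] by simp
    then have "inv g \<otimes> h \<in> isotropy U \<rho> x"
      using subgroup.m_closed[OF U ig h(1)] by (simp add: isotropy_def)
    then have "\<rho>' (inv g \<otimes> h) y = y" using sub by (auto simp: isotropy_def)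
    then have "\<rho>' (inv g) (\<rho>' h y) = y" using is_act_mult[OF actY ig h(1) y] by simp
    then have "\<rho>' h y = \<rho>' g y"
      using is_act_inv(2)[OF actY U g is_act_closed[OF actY h(1) y]] by simp
    then show ?thesis by (simp add: p_def h_def)
  qed
  have "p x = y"
    using *[OF subgroup.one_closed[OF U]] is_act_one[OF actX x] is_act_one[OF actY y] by simp
  then show ?thesis using * by blast
qed

lemma hat_iso_orbits:
  assumes V: "open_subgroup G S V" "V \<subseteq> U" "V \<subseteq> U'" and actX: "is_act V X \<rho>" and actY: "is_act V Y \<rho>'"
    and x: "x \<in> X" "X = orb V \<rho> x" and y: "y \<in> Y" "Y = orb V \<rho>' y"
    and eq: "isotropy V \<rho> x = isotropy V \<rho>' y"
  shows "hat_iso G S (U, X, \<rho>) (U', Y, \<rho>')"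
proof -
  have sV: "subgroup V G" using V(1) by (simp add: open_subgroup_def)
  obtain p where p: "p x = y" "\<And>g. g \<in> V \<Longrightarrow> p (\<rho> g x) = \<rho>' g y"
    using orbit_map[OF sV actX actY x(1) y(1)] eq by blast
  obtain q where q: "q y = x" "\<And>g. g \<in> V \<Longrightarrow> q (\<rho>' g y) = \<rho> g x"
    using orbit_map[OF sV actY actX y(1) x(1)] eq by blast
  have X: "\<exists>g\<in>V. z = \<rho> g x" if "z \<in> X" for z using that x(2) by (auto simp: orb_def)
  have Y: "\<exists>g\<in>V. z = \<rho>' g y" if "z \<in> Y" for z using that y(2) by (auto simp: orb_def)
  have pY: "p \<in> X \<rightarrow> Y" using X p(2) is_act_closed[OF actY _ y(1)] by fastforce
  have qX: "q \<in> Y \<rightarrow> X" using Y q(2) is_act_closed[OF actX _ x(1)] by fastforce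
  have "bij_betw p X Y"
  proof (rule bij_betwI[OF pY qX])
    show "q (p z) = z" if "z \<in> X" for z using X[OF that] p(2) q(2) by auto
    show "p (q z) = z" if "z \<in> Y" for z using Y[OF that] p(2) q(2) by auto
  qed
  moreover have "p (\<rho> g z) = \<rho>' g (p z)" if "g \<in> V" "z \<in> X" for g z
  proof -
    from X[OF that(2)] obtain h where h: "h \<in> V" "z = \<rho> h x" by blast
    then show ?thesis
      using p(2)[OF h(1)] p(2)[OF subgroup.m_closed[OF sV that(1) h(1)]]
        is_act_mult[OF actX that(1) h(1) x(1)] is_act_mult[OF actY that(1) h(1) y(1)] by simp
  qed
  ultimately show ?thesis
    using pY V unfolding hat_iso_def hat_map.simps by (intro exI[of _ p]) auto
qed

abbreviation eqg :: "('w, 'x) gset int_mpoly \<Rightarrow> ('w, 'x) gset int_mpoly \<Rightarrow> bool" (infix "\<cong>\<^sub>g" 50)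
  where "eqg \<equiv> pres_eq hats (Theta_group_rels G S (stabilizer_class G S))"

lemma eqg_congruence: "ring_congruence eqg"
  by (rule pres_eq_congruence[OF hat_rels_closed])

lemma eqg_iso:
  assumes "P \<in> hats" "Q \<in> hats" "hat_iso G S P Q"
  shows "var P \<cong>\<^sub>g var Q"
proof (rule pres_eqI[OF _ hat_rels_closed free_var free_var])
  show "var P - var Q \<in> Theta_group_rels G S (stabilizer_class G S)"
    unfolding Theta_group_rels_def
    by (rule UnI1, rule UnI1, rule UnI1, rule UnI1, rule CollectI, intro exI conjI) (rule refl assms)+
qed (rule assms)+

lemma eqg_singleton:
  assumes "P \<in> hats" "is_singleton (points P)"
  shows "var P \<cong>\<^sub>g 1"
proof (rule pres_eqI[OF _ hat_rels_closed free_var free_one])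
  show "var P - 1 \<in> Theta_group_rels G S (stabilizer_class G S)"
    unfolding Theta_group_rels_def
    by (rule UnI1, rule UnI1, rule UnI1, rule UnI2, rule CollectI, intro exI conjI) (rule refl assms)+
qed (rule assms)+

lemma eqg_coproduct:
  assumes "R \<in> hats" "P \<in> hats" "Q \<in> hats" "hat_coproduct G S R P Q"
  shows "var R \<cong>\<^sub>g var P + var Q"
proof (rule pres_eqI[OF _ hat_rels_closed free_var free_add[OF free_var free_var]])
  show "var R - (var P + var Q) \<in> Theta_group_rels G S (stabilizer_class G S)"
    unfolding Theta_group_rels_def
    by (rule UnI1, rule UnI1, rule UnI2, rule CollectI, intro exI conjI) (rule refl assms)+
qed (rule assms)+

lemma eqg_conj:
  assumes "g \<in> carrier G" "(U, X, \<rho>) \<in> hats"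
  shows "var (hat_conj G g (U, X, \<rho>)) \<cong>\<^sub>g var (U, X, \<rho>)"
proof (rule pres_eqI[OF _ hat_rels_closed free_var free_var])
  show "var (hat_conj G g (U, X, \<rho>)) - var (U, X, \<rho>) \<in> Theta_group_rels G S (stabilizer_class G S)"
    unfolding Theta_group_rels_def
    by (rule UnI1, rule UnI2, rule CollectI, intro exI conjI) (rule refl assms)+
qed (rule assms hat_conj_closed(1)[OF assms])+

lemma eqg_fiber:
  fixes X Y :: "'x set"
  assumes "transitive_E_smooth_uset G S (stabilizer_class G S) (U, X, \<rho>)"
    and "transitive_E_smooth_uset G S (stabilizer_class G S) (U, Y, \<rho>')"
    and "p \<in> X \<rightarrow> Y" "\<forall>g\<in>U. \<forall>x\<in>X. p (\<rho> g x) = \<rho>' g (p x)" "y \<in> Y"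
  shows "var (U, X, \<rho>) \<cong>\<^sub>g var (fiber G U X \<rho> \<rho>' p y) * var (U, Y, \<rho>')"
proof (rule pres_eqI[OF _ hat_rels_closed])
  show "var (U, X, \<rho>) - var (fiber G U X \<rho> \<rho>' p y) * var (U, Y, \<rho>')
    \<in> Theta_group_rels G S (stabilizer_class G S)"
    unfolding Theta_group_rels_def using assms by (intro UnI2 CollectI exI conjI) (rule refl | assumption)+
qed (use fiber_closed(1)[OF assms] transitive_E_smoothD(1)[OF assms(1)] transitive_E_smoothD(1)[OF assms(2)]
    in \<open>auto intro!: free_closed\<close>)

text \<open>
  An invariant subset of a tame set, as a generator of the ring; the restriction makes the action
  extensional.
\<close>

definition piece :: "'w set \<Rightarrow> 'x set \<Rightarrow> (('w \<Rightarrow> 'w) \<Rightarrow> 'x \<Rightarrow> 'x) \<Rightarrow> ('w, 'x) gset" where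
  "piece A Y \<rho> = (stab A, Y, \<lambda>g. restrict (\<rho> g) Y)"

lemma piece_hats:
  assumes "tame A Y \<rho>"
  shows "piece A Y \<rho> \<in> hats"
  unfolding piece_def
proof (rule hat_setsI[OF tame_stab[OF assms] _ _ order_refl is_act_restrict[OF tame_act[OF assms] tame_stab[OF assms]]])
  show "finite (orbs (stab A) Y (\<lambda>g. restrict (\<rho> g) Y))"
    unfolding orbs_restrict using assms by (simp add: tame_def)
  show "\<exists>B. finite B \<and> B \<subseteq> S \<and> isotropy (stab A) (\<lambda>g. restrict (\<rho> g) Y) x = stab B" if "x \<in> Y" for x
    unfolding isotropy_restrict[OF that] using tame_point[OF assms that] by metis
qed (use assms in \<open>auto simp: tame_def\<close>)

lemma tame_restrict:
  assumes "tame A Y \<rho>"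
  shows "tame A Y (\<lambda>g. restrict (\<rho> g) Y)"
  using assms is_act_restrict[OF tame_act[OF assms] tame_stab[OF assms]]
  unfolding tame_def orbs_restrict by (simp add: isotropy_restrict)

text \<open>
  Finite additivity.  The empty set has class zero, being the disjoint union of two copies of itself.
\<close>

lemma eqg_pieces:
  fixes Y :: "'t \<Rightarrow> 'x set"
  assumes t: "tame A X \<rho>" and T: "finite T" and X: "\<And>t. t \<in> T \<Longrightarrow> Y t \<subseteq> X"
    and disj: "\<And>s t. s \<in> T \<Longrightarrow> t \<in> T \<Longrightarrow> s \<noteq> t \<Longrightarrow> Y s \<inter> Y t = {}"
    and inv: "\<And>t g y. t \<in> T \<Longrightarrow> g \<in> stab A \<Longrightarrow> y \<in> Y t \<Longrightarrow> \<rho> g y \<in> Y t"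
  shows "var (piece A (\<Union>t\<in>T. Y t) \<rho>) \<cong>\<^sub>g (\<Sum>t\<in>T. var (piece A (Y t) \<rho>))"
  using T X disj inv
proof (induction T)
  interpret E: ring_congruence eqg by (rule eqg_congruence)
  have oA: "open_subgroup G S (stab A)" using t open_stab by (auto simp: tame_def)
  case empty
  have e: "tame A {} \<rho>" by (rule tame_subset[OF t]) auto
  let ?E = "var (piece A {} \<rho>)"
  have "hat_map G S (piece A {} \<rho>) (piece A {} \<rho>) id"
    using oA unfolding piece_def hat_map.simps by blast
  then have "hat_coproduct G S (piece A {} \<rho>) (piece A {} \<rho>) (piece A {} \<rho>)"
    unfolding hat_coproduct_def by (intro exI[of _ id]) (simp add: piece_def)
  then have "?E \<cong>\<^sub>g ?E + ?E" using piece_hats[OF e] by (intro eqg_coproduct)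
  then have "?E - ?E \<cong>\<^sub>g ?E + ?E - ?E" by (rule E.eqv_diff) (rule E.eqv_reflI(1)[OF \<open>?E \<cong>\<^sub>g ?E + ?E\<close>])
  then show ?case using E.eqv_sym by simp
next
  interpret E: ring_congruence eqg by (rule eqg_congruence)
  have oA: "open_subgroup G S (stab A)" using t open_stab by (auto simp: tame_def)
  case (insert s T)
  let ?Z = "\<Union>t\<in>T. Y t"
  have dj: "Y s \<inter> ?Z = {}" using insert.prems(2) insert.hyps(2) by blast
  have invs: "\<rho> g y \<in> Y s" if "g \<in> stab A" "y \<in> Y s" for g y by (rule insert.prems(3)[OF _ that]) simp
  have invZ: "\<rho> g y \<in> ?Z" if "g \<in> stab A" "y \<in> ?Z" for g y
    using that(2) insert.prems(3)[OF _ that(1)] by auto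
  have sub: "Y s \<subseteq> X" "?Z \<subseteq> X" using insert.prems(1) by auto
  have tZ: "tame A ?Z \<rho>" by (rule tame_subset[OF t sub(2) invZ])
  have ts: "tame A (Y s) \<rho>" by (rule tame_subset[OF t sub(1) invs])
  have tU: "tame A (Y s \<union> ?Z) \<rho>"
    by (rule tame_subset[OF t]) (use sub invs invZ in \<open>blast, metis Un_iff\<close>)
  have m1: "hat_map G S (piece A (Y s) \<rho>) (piece A (Y s \<union> ?Z) \<rho>) id"
    unfolding piece_def hat_map.simps using oA by (auto intro!: exI[of _ "stab A"])
  have m2: "hat_map G S (piece A ?Z \<rho>) (piece A (Y s \<union> ?Z) \<rho>) id"
    unfolding piece_def hat_map.simps using oA by (auto intro!: exI[of _ "stab A"])
  have "hat_coproduct G S (piece A (Y s \<union> ?Z) \<rho>) (piece A (Y s) \<rho>) (piece A ?Z \<rho>)"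
    unfolding hat_coproduct_def using m1 m2 dj by (intro exI[of _ id]) (simp add: piece_def)
  then have "var (piece A (Y s \<union> ?Z) \<rho>) \<cong>\<^sub>g var (piece A (Y s) \<rho>) + var (piece A ?Z \<rho>)"
    by (intro eqg_coproduct piece_hats tU ts tZ)
  moreover have "var (piece A (Y s) \<rho>) + var (piece A ?Z \<rho>) \<cong>\<^sub>g
      var (piece A (Y s) \<rho>) + (\<Sum>t\<in>T. var (piece A (Y t) \<rho>))"
  proof (rule E.eqv_add)
    show "var (piece A (Y s) \<rho>) \<cong>\<^sub>g var (piece A (Y s) \<rho>)"
      by (rule pres_eq_refl[OF hat_rels_closed free_var[OF piece_hats[OF ts]]])
    show "var (piece A ?Z \<rho>) \<cong>\<^sub>g (\<Sum>t\<in>T. var (piece A (Y t) \<rho>))"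
      by (rule insert.IH) (use insert.prems in auto)
  qed
  ultimately show ?case using insert.hyps E.eqv_trans by simp
qed

end

text \<open>
  The set \<open>G(A)/G(B)\<close> is realised as the orbit of an enumeration of \<open>B\<close>.  The injection \<open>code\<close> moves these
  tuples into the type that the points of the generators are taken from.
\<close>

locale coded_oligo_group = oligo_group G S
  for G :: "('w \<Rightarrow> 'w) monoid" (structure) and S :: "'w set" +
  fixes code :: "'w list \<Rightarrow> 'x"
  assumes inj_code: "inj code"
begin

text \<open>
  An enumeration of \<open>B\<close>, not necessarily compatible with translations: equivariance always comes from
  comparing stabilizers.
\<close>

definition lst :: "'w set \<Rightarrow> 'w list" where "lst B = (SOME bs. set bs = B)"

definition cact :: "('w \<Rightarrow> 'w) \<Rightarrow> 'x \<Rightarrow> 'x" where "cact g x = code (map g (inv_into UNIV code x))"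

definition tup :: "'w set \<Rightarrow> 'w set \<Rightarrow> 'x set" where
  "tup A B = orb (stab A) cact (code (lst B))"

definition nu :: "'w set \<Rightarrow> 'w set \<Rightarrow> ('w, 'x) gset int_mpoly" where
  "nu A B = var (piece A (tup A B) cact)"

lemma set_lst: "finite B \<Longrightarrow> set (lst B) = B"
  unfolding lst_def by (rule someI_ex) (rule finite_list)

lemma cact_code: "cact g (code xs) = code (map g xs)"
  by (simp add: cact_def inj_code)

lemma cact_act: "U \<subseteq> carrier G \<Longrightarrow> is_act U (code ` lists S) cact"
  unfolding is_act_def
  using G_closed mult_apply one_apply
  by (auto simp: cact_code map_idI in_lists_conv_set subset_iff intro!: arg_cong[of _ _ code])

lemma code_lst: "finite B \<Longrightarrow> B \<subseteq> S \<Longrightarrow> code (lst B) \<in> code ` lists S"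
  by (intro imageI) (simp add: set_lst lists_eq_set)

lemma isotropy_code: "U \<subseteq> carrier G \<Longrightarrow> finite B \<Longrightarrow> isotropy U cact (code (lst B)) = U \<inter> stab B"
  using map_eq_conv[of _ "lst B" id]
  by (auto simp: isotropy_def cact_code inj_eq[OF inj_code] stab_iff set_lst)

lemma tup_subset:
  assumes "A \<subseteq> S" "finite B" "B \<subseteq> S"
  shows "tup A B \<subseteq> code ` lists S" "code (lst B) \<in> tup A B" "is_act (stab A) (tup A B) cact"
proof -
  have act: "is_act (stab A) (code ` lists S) cact" by (rule cact_act) (auto simp: stab_iff)
  show sub: "tup A B \<subseteq> code ` lists S" unfolding tup_def by (rule orb_subset[OF act code_lst[OF assms(2,3)]])
  show "code (lst B) \<in> tup A B"
    unfolding tup_def by (rule orb_self[OF act stab_subgroup[OF assms(1)] code_lst[OF assms(2,3)]])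
  show "is_act (stab A) (tup A B) cact"
    by (rule is_act_subset[OF act sub])
      (auto simp: tup_def intro: orb_invariant[OF act stab_subgroup[OF assms(1)] code_lst[OF assms(2,3)]])
qed

lemma tup_base:
  assumes "A \<subseteq> B" "finite B" "B \<subseteq> S"
  shows "base A cact (code (lst B)) B" "tame A (tup A B) cact"
proof -
  have A: "finite A" "A \<subseteq> S" "stab B \<subseteq> stab A"
    using assms finite_subset stab_antimono[OF assms(1)] by auto
  note tup = tup_subset[OF A(2) assms(2,3)] and sA = stab_subgroup[OF A(2)]
  have "isotropy (stab A) cact (code (lst B)) = stab B"
    using isotropy_code[OF subgroup.subset[OF sA] assms(2)] A(3) by blast
  then show b: "base A cact (code (lst B)) B" using assms by (simp add: base_def)
  have "\<exists>C. finite C \<and> A \<subseteq> C \<and> C \<subseteq> S \<and> isotropy (stab A) cact x = stab C" if x: "x \<in> tup A B" for x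
  proof -
    obtain g where g: "g \<in> stab A" "x = cact g (code (lst B))" using x by (auto simp: tup_def orb_def)
    have gG: "g \<in> carrier G" using g(1) by (rule stab_carrier)
    have "isotropy (stab A) cact x = stab (g ` B)"
      unfolding g(2) isotropy_translate[OF tup(3) sA tup(2) g(1)]
      using b stab_image[OF gG assms(3)] by (simp add: base_def)
    moreover have "A \<subseteq> g ` B" using stab_image_self[OF g(1)] assms(1) by blast
    ultimately show ?thesis using G_closed[OF gG] assms by (intro exI[of _ "g ` B"]) auto
  qed
  moreover have "orbs (stab A) (tup A B) cact = {tup A B}"
    using orb_eq[OF tup(3) sA tup(2)] tup(2) unfolding orbs_def tup_def by blast
  ultimately show "tame A (tup A B) cact" using A tup(3) by (simp add: tame_def)
qed

text \<open>
  A transitive set is determined by one stabilizer.  The isomorphism is needed in both directions since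
  the points of the two sets have different types.
\<close>

lemma piece_iso_tup:
  fixes X :: "'y set"
  assumes U: "open_subgroup G S (stab A)" "stab A \<subseteq> U" and act: "is_act (stab A) X \<rho>"
    and x: "x \<in> X" "X = orb (stab A) \<rho> x" and B: "base A \<rho> x B"
  shows "hat_iso G S (U, X, \<rho>) (piece A (tup A B) cact)"
    and "hat_iso G S (piece A (tup A B) cact) (U, X, \<rho>)"
proof -
  have Bf: "A \<subseteq> B" "finite B" "B \<subseteq> S" using B by (auto simp: base_def)
  have A: "A \<subseteq> S" using Bf by blast
  note tup = tup_subset[OF A Bf(2,3)] tup_base[OF Bf] and sA = stab_subgroup[OF A]
  have orb: "tup A B = orb (stab A) (\<lambda>g. restrict (cact g) (tup A B)) (code (lst B))"
    using tup(2) by (simp add: orb_def) (simp add: tup_def orb_def)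
  have iso: "isotropy (stab A) \<rho> x = isotropy (stab A) (\<lambda>g. restrict (cact g) (tup A B)) (code (lst B))"
    unfolding isotropy_restrict[OF tup(2)] using B tup(4) by (simp add: base_def)
  note act' = is_act_restrict[OF tup(3) sA]
  show "hat_iso G S (U, X, \<rho>) (piece A (tup A B) cact)"
    unfolding piece_def by (rule hat_iso_orbits[OF U order_refl act act' x tup(2) orb iso])
  show "hat_iso G S (piece A (tup A B) cact) (U, X, \<rho>)"
    unfolding piece_def by (rule hat_iso_orbits[OF U(1) order_refl U(2) act' act tup(2) orb x iso[symmetric]])
qed

lemma nu_refl:
  assumes "A \<subseteq> B" "finite B" "B \<subseteq> S"
  shows "nu A B \<cong>\<^sub>g nu A B"
  unfolding nu_def by (rule pres_eq_refl[OF hat_rels_closed free_var[OF piece_hats[OF tup_base(2)[OF assms]]]])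

text \<open>
  The class of a tame set is the sum of the classes of its orbits, the orbits being given by a system of
  representatives \<open>x t\<close> whose stabilizers are known.
\<close>

lemma eqg_sum_nu:
  assumes P: "(U, X, \<rho>) \<in> hats" and AU: "stab A \<subseteq> U" and t: "tame A X \<rho>" and T: "finite T"
    and x: "\<And>t. t \<in> T \<Longrightarrow> x t \<in> X \<and> base A \<rho> (x t) (B t)"
    and ex: "\<And>z. z \<in> X \<Longrightarrow> \<exists>!t. t \<in> T \<and> z \<in> orb (stab A) \<rho> (x t)"
  shows "var (U, X, \<rho>) \<cong>\<^sub>g (\<Sum>t\<in>T. nu A (B t))"
proof -
  interpret E: ring_congruence eqg by (rule eqg_congruence)
  note act = tame_act[OF t] and sA = tame_stab[OF t]
  have oA: "open_subgroup G S (stab A)" using t open_stab by (auto simp: tame_def)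
  let ?Y = "\<lambda>t. orb (stab A) \<rho> (x t)"
  have Y: "?Y t \<subseteq> X" if "t \<in> T" for t using orb_subset[OF act, of "x t"] x[OF that] by simp
  have X: "X = (\<Union>t\<in>T. ?Y t)"
  proof
    show "X \<subseteq> (\<Union>t\<in>T. ?Y t)"
    proof
      fix z assume "z \<in> X"
      from ex1_implies_ex[OF ex[OF this]] show "z \<in> (\<Union>t\<in>T. ?Y t)" by auto
    qed
  qed (use Y in auto)
  have disj: "?Y s \<inter> ?Y t = {}" if "s \<in> T" "t \<in> T" "s \<noteq> t" for s t
  proof (rule equals0I)
    fix z assume "z \<in> ?Y s \<inter> ?Y t"
    then have "z \<in> ?Y s" "z \<in> ?Y t" by auto
    then show False using ex[of z] Y[OF that(1)] that by (metis subsetD)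
  qed
  have inv: "\<rho> g y \<in> ?Y t" if "t \<in> T" "g \<in> stab A" "y \<in> ?Y t" for t g y
    using orb_invariant[OF act sA _ that(3,2)] x[OF that(1)] by blast
  have "hat_iso G S (U, X, \<rho>) (piece A X \<rho>)"
    unfolding hat_iso_def piece_def hat_map.simps using oA AU
    by (auto intro!: exI[of _ "\<lambda>x. x"] exI[of _ "stab A"] simp: bij_betw_def)
  then have "var (U, X, \<rho>) \<cong>\<^sub>g var (piece A X \<rho>)" by (intro eqg_iso P piece_hats t)
  also have "var (piece A X \<rho>) \<cong>\<^sub>g (\<Sum>t\<in>T. var (piece A (?Y t) \<rho>))"
    using eqg_pieces[of A X \<rho> T ?Y, OF t T Y disj inv] by (simp flip: X)
  also have "(\<Sum>t\<in>T. var (piece A (?Y t) \<rho>)) \<cong>\<^sub>g (\<Sum>t\<in>T. nu A (B t))"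
  proof (rule E.eqv_sum)
    fix t assume tT: "t \<in> T"
    have b: "base A \<rho> (x t) (B t)" and xX: "x t \<in> X" using x[OF tT] by auto
    have tY: "tame A (?Y t) \<rho>" by (rule tame_subset[OF t Y[OF tT]]) (rule inv[OF tT])
    have xY: "x t \<in> ?Y t" by (rule orb_self[OF act sA xX])
    have "hat_iso G S (piece A (?Y t) \<rho>) (piece A (tup A (B t)) cact)"
      unfolding piece_def[of A "?Y t"]
    proof (rule piece_iso_tup(1)[OF oA order_refl is_act_restrict[OF tame_act[OF tY] sA] xY])
      show "?Y t = orb (stab A) (\<lambda>g. restrict (\<rho> g) (?Y t)) (x t)" using xY by (simp add: orb_def)
      show "base A (\<lambda>g. restrict (\<rho> g) (?Y t)) (x t) (B t)"
        using b unfolding base_def isotropy_restrict[OF xY] .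
    qed
    then show "var (piece A (?Y t) \<rho>) \<cong>\<^sub>g nu A (B t)"
      unfolding nu_def using b by (intro eqg_iso piece_hats tY tup_base) (auto simp: base_def)
  qed
  finally show ?thesis .
qed

lemma piece_transitive:
  assumes "A \<subseteq> B" "finite B" "B \<subseteq> S"
  shows "transitive_E_smooth_uset G S (stabilizer_class G S) (piece A (tup A B) cact)"
  unfolding piece_def
proof (rule transitive_E_smoothI)
  have A: "finite A" "A \<subseteq> S" using assms finite_subset by auto
  note tup = tup_subset[OF A(2) assms(2,3)] tup_base[OF assms] and sA = stab_subgroup[OF A(2)]
  show "open_subgroup G S (stab A)" by (rule open_stab[OF A])
  show "is_act (stab A) (tup A B) (\<lambda>g. restrict (cact g) (tup A B))" by (rule is_act_restrict[OF tup(3) sA])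
  show "code (lst B) \<in> tup A B" by (rule tup)
  then show "tup A B = orb (stab A) (\<lambda>g. restrict (cact g) (tup A B)) (code (lst B))"
    by (simp add: orb_def) (simp add: tup_def orb_def)
  show "\<exists>C. finite C \<and> C \<subseteq> S \<and> isotropy (stab A) (\<lambda>g. restrict (cact g) (tup A B)) z = stab A \<inter> stab C"
    if z: "z \<in> tup A B" for z
  proof -
    obtain C where C: "finite C" "A \<subseteq> C" "C \<subseteq> S" "isotropy (stab A) cact z = stab C"
      using tame_point[OF tup(5) z] by metis
    then have "stab C = stab A \<inter> stab C" using stab_antimono by blast
    then show ?thesis using C unfolding isotropy_restrict[OF z] by metis
  qed
qed simp

text \<open>
  The restriction of tuples gives a map \<open>G(A)/G(C) \<rightarrow> G(A)/G(B)\<close> whose fiber over the base point is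
  \<open>G(B)/G(C)\<close>.
\<close>

lemma nu_trans:
  assumes C: "finite C" "C \<subseteq> S" and AB: "A \<subseteq> B" and BC: "B \<subseteq> C"
  shows "nu A C \<cong>\<^sub>g nu A B * nu B C"
proof -
  interpret E: ring_congruence eqg by (rule eqg_congruence)
  have f: "finite B" "B \<subseteq> S" "A \<subseteq> C" "A \<subseteq> S" using assms finite_subset[OF BC] by auto
  have fA: "finite A" by (rule finite_subset[OF f(3) C(1)])
  note tC = tup_subset[OF f(4) C] and tB = tup_subset[OF f(4,1,2)] and tBC = tup_subset[OF f(2) C]
  note bC = tup_base[OF f(3) C] and bB = tup_base[OF AB f(1,2)] and bBC = tup_base[OF BC C]
  note sA = stab_subgroup[OF f(4)] and sB = stab_subgroup[OF f(2)]
  have BA: "stab B \<subseteq> stab A" by (rule stab_antimono[OF AB])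
  let ?x = "code (lst C)" and ?y = "code (lst B)"
  let ?X = "tup A C" and ?Y = "tup A B"
  let ?r = "\<lambda>X g. restrict (cact g) X"
  have "isotropy (stab A) cact ?x \<subseteq> isotropy (stab A) cact ?y"
    using bC(1) bB(1) stab_antimono[OF BC] by (simp add: base_def)
  from orbit_map[OF sA tC(3) tB(3) tC(2) tB(2) this]
  obtain p where p: "p ?x = ?y" "\<And>g. g \<in> stab A \<Longrightarrow> p (cact g ?x) = cact g ?y" by blast
  have X: "\<exists>h\<in>stab A. z = cact h ?x" if "z \<in> ?X" for z using that by (auto simp: tup_def orb_def)
  have pY: "p \<in> ?X \<rightarrow> ?Y"
  proof
    fix z assume "z \<in> ?X"
    then obtain h where "h \<in> stab A" "z = cact h ?x" using X by blast
    then show "p z \<in> ?Y" using p(2) is_act_closed[OF tB(3) _ tB(2)] by simp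
  qed
  have equiv: "p (cact g z) = cact g (p z)" if "g \<in> stab A" "z \<in> ?X" for g z
  proof -
    from X[OF that(2)] obtain h where h: "h \<in> stab A" "z = cact h ?x" by blast
    then show ?thesis
      using p(2)[OF h(1)] p(2)[OF subgroup.m_closed[OF sA that(1) h(1)]]
        is_act_mult[OF tC(3) that(1) h(1) tC(2)] is_act_mult[OF tB(3) that(1) h(1) tB(2)] by simp
  qed
  have equiv': "\<forall>g\<in>stab A. \<forall>x\<in>?X. p (?r ?X g x) = ?r ?Y g (p x)"
    using equiv pY by auto
  let ?F = "fiber G (stab A) ?X (?r ?X) (?r ?Y) p ?y"
  note tr = piece_transitive[OF f(3) C, unfolded piece_def] piece_transitive[OF AB f(1,2), unfolded piece_def]
  note fib = eqg_fiber[OF tr pY equiv' tB(2)] and fibc = fiber_closed(1)[OF tr pY equiv' tB(2)]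
  have iso: "isotropy (stab A) cact ?y = stab B" using bB(1) by (simp add: base_def)
  have Fset: "{z \<in> ?X. p z = ?y} = orb (stab B) cact ?x"
  proof -
    have "p (cact h ?x) = ?y \<longleftrightarrow> h \<in> stab B" if "h \<in> stab A" for h
      using p(2)[OF that] iso[symmetric] that by (simp add: isotropy_def)
    then have "{z \<in> orb (stab A) cact ?x. p z = ?y} = orb (stab B) cact ?x"
      using BA unfolding orb_def by blast
    then show ?thesis by (simp add: tup_def)
  qed
  have xF: "?x \<in> {z \<in> ?X. p z = ?y}" using p(1) tC(2) by simp
  have F: "?F = (stab B, {z \<in> ?X. p z = ?y}, \<lambda>g. restrict (?r ?X g) {z \<in> ?X. p z = ?y})"
    unfolding fiber_def stabilizer_isotropy isotropy_restrict[OF tB(2)] iso by simp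
  have "hat_iso G S ?F (piece B (tup B C) cact)"
    unfolding F
  proof (rule piece_iso_tup(1)[OF open_stab[OF f(1,2)] order_refl _ xF])
    have restr: "restrict (?r ?X g) {z \<in> ?X. p z = ?y} = restrict (cact g) {z \<in> ?X. p z = ?y}" for g
      by auto
    have "is_act (stab B) {z \<in> ?X. p z = ?y} cact"
      using tBC(3) unfolding Fset by (simp add: tup_def)
    then show "is_act (stab B) {z \<in> ?X. p z = ?y} (\<lambda>g. restrict (?r ?X g) {z \<in> ?X. p z = ?y})"
      unfolding restr by (rule is_act_restrict[OF _ sB])
    show "{z \<in> ?X. p z = ?y} = orb (stab B) (\<lambda>g. restrict (?r ?X g) {z \<in> ?X. p z = ?y}) ?x"
      using xF unfolding restr by (simp add: orb_def) (simp add: Fset orb_def)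
    show "base B (\<lambda>g. restrict (?r ?X g) {z \<in> ?X. p z = ?y}) ?x C"
      using bBC(1) unfolding restr base_def isotropy_restrict[OF xF] .
  qed
  then have "var ?F \<cong>\<^sub>g nu B C" unfolding nu_def by (intro eqg_iso fibc piece_hats bBC(2))
  from E.eqv_mult[OF this nu_refl[OF AB f(1,2)]]
  have "var ?F * nu A B \<cong>\<^sub>g nu A B * nu B C" by (simp add: mult.commute)
  moreover have "nu A C \<cong>\<^sub>g var ?F * nu A B" using fib unfolding nu_def piece_def .
  ultimately show ?thesis using E.eqv_trans by blast
qed

text \<open>
  The conjugate of \<open>G(A)/G(B)\<close> by \<open>g\<close> is a transitive set of \<open>G(gA)\<close> in which the old base point has stabilizer
  \<open>G(gB)\<close>.
\<close>

lemma nu_conj: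
  assumes g: "g \<in> carrier G" and B: "finite B" "B \<subseteq> S" and AB: "A \<subseteq> B"
  shows "nu (g ` A) (g ` B) \<cong>\<^sub>g nu A B"
proof -
  interpret E: ring_congruence eqg by (rule eqg_congruence)
  have A: "finite A" "A \<subseteq> S" using B AB finite_subset by auto
  have gB: "g ` A \<subseteq> g ` B" "finite (g ` B)" "g ` B \<subseteq> S" "finite (g ` A)" "g ` A \<subseteq> S"
    using A B AB G_closed[OF g] by auto
  note tup = tup_subset[OF A(2) B] tup_base[OF AB B] and sA = stab_subgroup[OF A(2)]
  let ?X = "tup A B" and ?x = "code (lst B)"
  let ?r = "\<lambda>h. restrict (cact h) ?X"
  have P: "(stab A, ?X, ?r) \<in> hats" using piece_hats[OF tup(5)] by (simp add: piece_def)
  have tr: "tame A ?X ?r"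
    by (rule tame_restrict[OF tup(5)])
  have "hat_conj G g (stab A, ?X, ?r) \<in> hats" by (rule hat_conj_closed(1)[OF g P])
  moreover have "hat_iso G S (hat_conj G g (stab A, ?X, ?r)) (piece (g ` A) (tup (g ` A) (g ` B)) cact)"
    unfolding hat_conj.simps stab_image[OF g A(2), symmetric]
  proof (rule piece_iso_tup(1)[OF open_stab[OF gB(4,5)] order_refl])
    let ?\<rho> = "\<lambda>h. ?r (inv g \<otimes> h \<otimes> g)"
    show "is_act (stab (g ` A)) ?X ?\<rho>" by (rule tame_act[OF hat_conj_closed(2)[OF g P tr]])
    show "?x \<in> ?X" by (rule tup)
    have \<rho>: "?\<rho> (g \<otimes> u \<otimes> inv g) = ?r u" if "u \<in> stab A" for u
      using conj_conj[OF g stab_carrier[OF that]] by simp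
    have "orb (stab (g ` A)) ?\<rho> ?x = orb (stab A) ?r ?x"
      unfolding orb_def stab_image[OF g A(2)] image_image using \<rho> by simp
    then show "?X = orb (stab (g ` A)) ?\<rho> ?x" using tup(2) by (simp add: orb_def) (simp add: tup_def orb_def)
    have b: "base A ?r ?x B" using tup(4) unfolding base_def isotropy_restrict[OF tup(2)] .
    show "base (g ` A) ?\<rho> ?x (g ` B)"
      by (rule base_semilinear[of g A ?X "\<lambda>x. x" ?r ?\<rho> ?x B, OF g A(2)])
        (use \<rho> tup(2) b is_act_closed[OF tup(3)] in auto)
  qed
  ultimately have "var (hat_conj G g (stab A, ?X, ?r)) \<cong>\<^sub>g nu (g ` A) (g ` B)"
    unfolding nu_def by (intro eqg_iso piece_hats tup_base gB(1-3))
  moreover have "var (hat_conj G g (stab A, ?X, ?r)) \<cong>\<^sub>g nu A B"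
    using eqg_conj[OF g P] by (simp add: nu_def piece_def)
  ultimately show ?thesis using E.eqv_trans E.eqv_sym by blast
qed

text \<open>
  The translates by \<open>T\<close> of the base point of \<open>G(A)/G(B)\<close> represent the orbits of \<open>G(A')\<close>, and \<open>t\<close> times
  the base point has stabilizer \<open>G(A' \<union> tB)\<close> in \<open>G(A')\<close>.
\<close>

lemma nu_amalg:
  assumes A': "finite A'" "A' \<subseteq> S" and B: "finite B" "B \<subseteq> S" and AA': "A \<subseteq> A'" and AB: "A \<subseteq> B"
    and T: "finite T" "T \<subseteq> stab A"
    and ex: "\<And>g. g \<in> stab A \<Longrightarrow> \<exists>!t. t \<in> T \<and> (\<exists>h\<in>stab A'. \<forall>b\<in>B. h (g b) = t b)"
  shows "nu A B \<cong>\<^sub>g (\<Sum>t\<in>T. nu A' (A' \<union> t ` B))"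
proof -
  have A: "finite A" "A \<subseteq> S" using B AB finite_subset by auto
  note tup = tup_subset[OF A(2) B] tup_base[OF AB B] and sA = stab_subgroup[OF A(2)] and sA' = stab_subgroup[OF A'(2)]
  have A'A: "stab A' \<subseteq> stab A" by (rule stab_antimono[OF AA'])
  let ?X = "tup A B" and ?x = "code (lst B)"
  let ?r = "\<lambda>h. restrict (cact h) ?X"
  have P: "(stab A, ?X, ?r) \<in> hats" using piece_hats[OF tup(5)] by (simp add: piece_def)
  have tr: "tame A ?X ?r"
    by (rule tame_restrict[OF tup(5)])
  have b: "base A ?r ?x B" using tup(4) unfolding base_def isotropy_restrict[OF tup(2)] .
  have tr': "tame A' ?X ?r" by (rule tame_mono[OF tr AA' A'])
  have "var (stab A, ?X, ?r) \<cong>\<^sub>g (\<Sum>t\<in>T. nu A' (A' \<union> t ` B))"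
  proof (rule eqg_sum_nu[OF P A'A tr' T(1), where x = "\<lambda>t. ?r t ?x"])
    fix t assume "t \<in> T"
    then have t: "t \<in> stab A" using T by blast
    have tx: "?r t ?x \<in> ?X" by (rule is_act_closed[OF tame_act[OF tr] t tup(2)])
    moreover have "base A' ?r (?r t ?x) (A' \<union> t ` B)"
      by (rule base_refine[OF tr tx base_translate[OF tr tup(2) b t] A' AA'])
    ultimately show "?r t ?x \<in> ?X \<and> base A' ?r (?r t ?x) (A' \<union> t ` B)" by blast
  next
    fix z assume "z \<in> ?X"
    then obtain g where g: "g \<in> stab A" "z = ?r g ?x" using tup(2) by (auto simp: tup_def orb_def)
    have "z \<in> orb (stab A') ?r (?r t ?x) \<longleftrightarrow> (\<exists>h\<in>stab A'. \<forall>b\<in>B. h (g b) = t b)" if "t \<in> T" for t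
    proof -
      have t: "t \<in> stab A" using T that by blast
      have tx: "?r t ?x \<in> ?X" by (rule is_act_closed[OF tame_act[OF tr] t tup(2)])
      have zX: "z \<in> ?X" by fact
      have "z \<in> orb (stab A') ?r (?r t ?x) \<longleftrightarrow> ?r t ?x \<in> orb (stab A') ?r z"
        using orb_eq[OF tame_act[OF tr'] sA' tx, of z] orb_eq[OF tame_act[OF tr'] sA' zX, of "?r t ?x"]
          orb_self[OF tame_act[OF tr'] sA' tx] orb_self[OF tame_act[OF tr'] sA' zX] by blast
      also have "\<dots> \<longleftrightarrow> (\<exists>h\<in>stab A'. ?r (h \<otimes> g) ?x = ?r t ?x)"
        unfolding g(2) orb_def image_iff
      proof (rule bex_cong[OF refl])
        fix h assume "h \<in> stab A'"
        then have "h \<in> stab A" using A'A by blast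
        from is_act_mult[OF tame_act[OF tr] this g(1) tup(2)]
        show "(?r t ?x = ?r h (?r g ?x)) = (?r (h \<otimes> g) ?x = ?r t ?x)" by auto
      qed
      also have "\<dots> \<longleftrightarrow> (\<exists>h\<in>stab A'. \<forall>b\<in>B. h (g b) = t b)"
      proof (rule bex_cong[OF refl])
        fix h assume "h \<in> stab A'"
        then have h: "h \<in> stab A" using A'A by blast
        have "(\<forall>b\<in>B. (h \<otimes> g) b = t b) = (\<forall>b\<in>B. h (g b) = t b)"
          using B(2) mult_apply[OF stab_carrier[OF h] stab_carrier[OF g(1)]] by (intro ball_cong) auto
        then show "(?r (h \<otimes> g) ?x = ?r t ?x) = (\<forall>b\<in>B. h (g b) = t b)"
          using base_eq_iff[OF tr tup(2) b subgroup.m_closed[OF sA h g(1)] t] by simp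
      qed
      finally show ?thesis .
    qed
    then have "(\<lambda>t. t \<in> T \<and> z \<in> orb (stab A') ?r (?r t ?x)) =
        (\<lambda>t. t \<in> T \<and> (\<exists>h\<in>stab A'. \<forall>b\<in>B. h (g b) = t b))" by (intro ext conj_cong refl)
    with ex[OF g(1)] show "\<exists>!t. t \<in> T \<and> z \<in> orb (stab A') ?r (?r t ?x)" by (simp only:)
  qed
  then show ?thesis by (simp add: nu_def piece_def)
qed

lemma nu_self:
  assumes "finite A" "A \<subseteq> S"
  shows "nu A A \<cong>\<^sub>g 1"
  unfolding nu_def
proof (rule eqg_singleton[OF piece_hats[OF tup_base(2)[OF order_refl assms]]])
  have "tup A A \<subseteq> {code (lst A)}"
    using tup_base(1)[OF order_refl assms]
    by (auto simp: tup_def orb_def base_def isotropy_def)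
  then show "is_singleton (points (piece A (tup A A) cact))"
    using tup_subset(2)[OF assms(2,1,2)] unfolding piece_def is_singleton_def by auto
qed

sublocale nu: measure G S eqg nu
  by (intro measure.intro measure_axioms.intro oligo_group_axioms eqg_congruence
      nu_self nu_trans nu_conj nu_amalg)

text \<open>
  Measuring smooth sets with \<open>nu\<close> returns their class, so \<open>nu\<close> is the universal measure.
\<close>

lemma psi_set_nu:
  assumes P: "(U, X, \<rho>) \<in> hats"
  shows "nu.psi_set X \<rho> \<cong>\<^sub>g var (U, X, \<rho>)"
proof -
  obtain A where A: "stab A \<subseteq> U" "tame A X \<rho>" using hat_sets_tame[OF P] by metis
  note act = tame_act[OF A(2)] and sA = tame_stab[OF A(2)]
  define x where "x Q = (SOME x. x \<in> Q \<and> base A \<rho> x (Bsel A \<rho> Q))" for Q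
  have x: "x Q \<in> Q \<and> base A \<rho> (x Q) (Bsel A \<rho> Q)" if Q: "Q \<in> orbs (stab A) X \<rho>" for Q
  proof -
    have "\<exists>x. x \<in> Q \<and> base A \<rho> x (Bsel A \<rho> Q)" using Bsel_base[OF A(2) Q] by blast
    then show ?thesis unfolding x_def by (rule someI_ex)
  qed
  have Q: "x Q \<in> X \<and> orb (stab A) \<rho> (x Q) = Q" if "Q \<in> orbs (stab A) X \<rho>" for Q
    using orbs_memD[OF act sA that] x[OF that] by metis
  have "var (U, X, \<rho>) \<cong>\<^sub>g nu.psi A X \<rho>"
    unfolding nu.psi_def
  proof (rule eqg_sum_nu[OF P A, where x = x])
    show "finite (orbs (stab A) X \<rho>)" using A(2) by (simp add: tame_def)
    show "x Q \<in> X \<and> base A \<rho> (x Q) (Bsel A \<rho> Q)" if "Q \<in> orbs (stab A) X \<rho>" for Q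
      using x[OF that] Q[OF that] by blast
    show "\<exists>!Q. Q \<in> orbs (stab A) X \<rho> \<and> z \<in> orb (stab A) \<rho> (x Q)" if z: "z \<in> X" for z
    proof (rule ex1I[of _ "orb (stab A) \<rho> z"])
      have o: "orb (stab A) \<rho> z \<in> orbs (stab A) X \<rho>" using z by (simp add: orbs_def)
      show "orb (stab A) \<rho> z \<in> orbs (stab A) X \<rho> \<and> z \<in> orb (stab A) \<rho> (x (orb (stab A) \<rho> z))"
        using o Q[OF o] orb_self[OF act sA z] by simp
      fix Q' assume Q': "Q' \<in> orbs (stab A) X \<rho> \<and> z \<in> orb (stab A) \<rho> (x Q')"
      then show "Q' = orb (stab A) \<rho> z" using Q orbs_memD[OF act sA] by metis
    qed
  qed
  then show ?thesis using nu.psi_set_eq[OF A(2)] nu.eqv_trans nu.eqv_sym by metis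
qed

end
context oligo_group
begin

text \<open>
  The size of smooth sets, for any measure, defines a homomorphism out of the ring of the group.
\<close>

lemma psi_set_hat_rels:
  fixes eqv :: "'h int_mpoly \<Rightarrow> 'h int_mpoly \<Rightarrow> bool" and r :: "('w, 'x) gset int_mpoly"
  assumes "measure G S eqv mu" and r: "r \<in> Theta_group_rels G S (stabilizer_class G S)"
  shows "eqv (subst_poly (\<lambda>(U, X, \<rho>). measure.psi_set G S mu X \<rho>) r) 0"
proof -
  interpret M: measure G S eqv mu by fact
  let ?s = "subst_poly (\<lambda>(U, X, \<rho>). M.psi_set X \<rho>)"
  have zero: "eqv (a - b) 0" if "eqv a b" for a b
    using M.eqv_diff[OF that M.eqv_reflI(2)[OF that]] by simp
  from r show ?thesis
  proof (cases rule: hat_rels_cases)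
    case (iso P Q)
    obtain U X \<rho> U' Y \<rho>' where P: "P = (U, X, \<rho>)" and Q: "Q = (U', Y, \<rho>')" by (metis surj_pair)
    obtain A where A: "tame A X \<rho>" using hat_sets_tame iso(2) P by metis
    obtain B where B: "tame B Y \<rho>'" using hat_sets_tame iso(3) Q by metis
    from iso(4) obtain f W where W: "open_subgroup G S W" "bij_betw f X Y"
        "\<And>h x. h \<in> W \<Longrightarrow> x \<in> X \<Longrightarrow> f (\<rho> h x) = \<rho>' h (f x)"
      unfolding P Q hat_iso_def hat_map.simps by auto
    have "eqv (M.psi_set X \<rho>) (M.psi_set Y \<rho>')"
      by (rule M.psi_set_iso[of A X \<rho> B Y \<rho>' W f, OF A B W])
    then show ?thesis unfolding iso(1) P Q by (simp add: subst_diff subst_var zero)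
  next
    case (singleton P)
    obtain U X \<rho> where P: "P = (U, X, \<rho>)" by (metis surj_pair)
    obtain x where x: "X = {x}" using singleton(3) P by (auto simp: is_singleton_def)
    obtain A where "tame A {x} \<rho>" using hat_sets_tame singleton(2) P x by metis
    then have "eqv (M.psi_set X \<rho>) 1" unfolding x by (rule M.psi_set_singleton)
    then show ?thesis unfolding singleton(1) P by (simp add: subst_diff subst_var subst_one zero)
  next
    case (coproduct R P Q)
    obtain U X \<rho> U' Y \<rho>' V Z \<tau> where P: "P = (U, X, \<rho>)" and Q: "Q = (U', Y, \<rho>')" and R: "R = (V, Z, \<tau>)"
      by (metis surj_pair)
    obtain A where A: "tame A X \<rho>" using hat_sets_tame coproduct(3) P by metis
    obtain B where B: "tame B Y \<rho>'" using hat_sets_tame coproduct(4) Q by metis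
    obtain C where C: "tame C Z \<tau>" using hat_sets_tame coproduct(2) R by metis
    from coproduct(5) obtain a b where m: "hat_map G S P R a" "hat_map G S Q R b" and
      ab: "inj_on a X" "inj_on b Y" "a ` X \<inter> b ` Y = {}" "a ` X \<union> b ` Y = Z"
      unfolding P Q R hat_coproduct_def by auto
    from m(1) obtain W1 where W1: "open_subgroup G S W1" "\<forall>g\<in>W1. \<forall>x\<in>X. a (\<rho> g x) = \<tau> g (a x)"
      unfolding P R hat_map.simps by (elim conjE exE)
    from m(2) obtain W2 where W2: "open_subgroup G S W2" "\<forall>g\<in>W2. \<forall>x\<in>Y. b (\<rho>' g x) = \<tau> g (b x)"
      unfolding Q R hat_map.simps by (elim conjE exE)
    have "eqv (M.psi_set Z \<tau>) (M.psi_set X \<rho> + M.psi_set Y \<rho>')"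
      by (rule M.psi_set_coproduct[OF C A B open_subgroup_Int[OF W1(1) W2(1)] ab(1,2) _ _ ab(3,4)])
        (use W1(2) W2(2) in auto)
    then show ?thesis unfolding coproduct(1) P Q R by (simp add: subst_diff subst_add subst_var zero)
  next
    case (conj g P)
    obtain U X \<rho> where P: "P = (U, X, \<rho>)" by (metis surj_pair)
    obtain A where A: "tame A X \<rho>" using hat_sets_tame conj(3) P by metis
    let ?\<rho> = "\<lambda>h. \<rho> (inv g \<otimes> h \<otimes> g)"
    have \<rho>: "\<rho> h x = ?\<rho> (g \<otimes> h \<otimes> inv g) x" if "h \<in> stab A" for h x
      using conj_conj[OF conj(2) stab_carrier[OF that]] by simp
    have t: "tame (g ` A) X ?\<rho>"
      by (rule tame_semilinear[of A X \<rho> g "\<lambda>x. x" X ?\<rho>, OF A conj(2)]) (auto simp: bij_betw_def \<rho>)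
    have "eqv (M.psi (g ` A) X ?\<rho>) (M.psi A X \<rho>)"
      by (rule M.psi_semilinear[of A X \<rho> g "\<lambda>x. x" X ?\<rho>, OF A conj(2)]) (auto simp: bij_betw_def \<rho>)
    from M.eqv_trans[OF M.eqv_trans[OF M.psi_set_eq[OF t] this] M.eqv_sym[OF M.psi_set_eq[OF A]]]
    have "eqv (M.psi_set X ?\<rho>) (M.psi_set X \<rho>)" .
    then show ?thesis unfolding conj(1) P by (simp add: subst_diff subst_var zero)
  next
    case (fiber U X Y \<rho> \<rho>' p y)
    note X = transitive_E_smoothD[OF fiber(2)] and Y = transitive_E_smoothD[OF fiber(3)]
    obtain D where D: "stab D \<subseteq> U" "tame D X \<rho>" "tame D Y \<rho>'" and F: "tame D {x \<in> X. p x = y} \<rho>"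
      using fiber_closed(2)[OF fiber(2-6)] by blast
    let ?F = "{x \<in> X. p x = y}"
    have "eqv (M.psi_set X \<rho>) (M.psi_set ?F \<rho> * M.psi_set Y \<rho>')"
      by (rule M.psi_set_fiber[of U D X \<rho> Y \<rho>' D p y, OF X(2) D(1) X(3) Y(3) D(2,3) F _ _ fiber(6) Y(4)[OF fiber(6)]])
        (use fiber(4,5) in auto)
    moreover have "eqv (M.psi_set ?F \<rho>) (M.psi_set ?F (\<lambda>g. restrict (\<rho> g) ?F))"
      by (rule M.psi_set_iso[of D ?F \<rho> D ?F _ "stab D" "\<lambda>x. x", OF F tame_restrict[OF F]])
        (use F in \<open>auto simp: tame_def bij_betw_def intro: open_stab\<close>)
    moreover have "eqv (M.psi_set Y \<rho>') (M.psi_set Y \<rho>')"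
      by (rule M.eqv_reflI(1)[OF M.psi_set_eq[OF D(3)]])
    ultimately have "eqv (M.psi_set X \<rho>) (M.psi_set ?F (\<lambda>g. restrict (\<rho> g) ?F) * M.psi_set Y \<rho>')"
      using M.eqv_trans M.eqv_mult by blast
    then show ?thesis unfolding fiber(1) fiber_def by (simp add: subst_diff subst_mult subst_var zero)
  qed
qed

end


section \<open>Relational structures and their copies\<close>

text \<open>
  An embedding without the extensionality requirement.  This form composes with plain function composition
  and does not depend on the chosen extension outside the domain.
\<close>

definition strong_map :: "'i signature \<Rightarrow> ('i, 'a) struc \<Rightarrow> ('i, 'b) struc \<Rightarrow> ('a \<Rightarrow> 'b) \<Rightarrow> bool" where
  "strong_map \<sigma> X Y f \<longleftrightarrow> inj_on f (dom X) \<and> f ` dom X \<subseteq> dom Y \<and>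
     (\<forall>r \<in> syms \<sigma>. \<forall>xs \<in> lists (dom X). length xs = arity \<sigma> r \<longrightarrow>
        (xs \<in> rel X r \<longleftrightarrow> map f xs \<in> rel Y r))"

lemma strong_mapD:
  assumes "strong_map \<sigma> X Y f"
  shows "inj_on f (dom X)" "f ` dom X \<subseteq> dom Y" "x \<in> dom X \<Longrightarrow> f x \<in> dom Y"
    "r \<in> syms \<sigma> \<Longrightarrow> xs \<in> lists (dom X) \<Longrightarrow> length xs = arity \<sigma> r \<Longrightarrow>
       xs \<in> rel X r \<longleftrightarrow> map f xs \<in> rel Y r"
  using assms by (auto simp: strong_map_def)

lemma struct_iso_iff:
  "struct_iso \<sigma> X Y f \<longleftrightarrow> f \<in> extensional (dom X) \<and> strong_map \<sigma> X Y f \<and> f ` dom X = dom Y"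
  by (auto simp: struct_iso_def strong_map_def bij_betw_def)

lemma embedding_iff:
  "embedding \<sigma> X Y f \<longleftrightarrow> f \<in> extensional (dom X) \<and> strong_map \<sigma> X Y f"
proof -
  have "map f xs \<in> lists (f ` dom X)" if "xs \<in> lists (dom X)" for xs
    using that by (auto simp: in_lists_conv_set)
  then show ?thesis
    by (auto simp: embedding_def struct_iso_def strong_map_def induced_def PiE_def bij_betw_def)
qed

lemma strong_map_cong:
  assumes "\<And>x. x \<in> dom X \<Longrightarrow> f x = g x"
  shows "strong_map \<sigma> X Y f \<longleftrightarrow> strong_map \<sigma> X Y g"
proof -
  have "map f xs = map g xs" if "xs \<in> lists (dom X)" for xs
    using that assms by (simp add: in_lists_conv_set)
  then have "(xs \<in> rel X r \<longleftrightarrow> map f xs \<in> rel Y r) \<longleftrightarrow> (xs \<in> rel X r \<longleftrightarrow> map g xs \<in> rel Y r)"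
    if "xs \<in> lists (dom X)" for xs r
    using that by (simp only:)
  moreover have "inj_on f (dom X) \<longleftrightarrow> inj_on g (dom X)" by (rule inj_on_cong[OF assms])
  moreover have "f ` dom X = g ` dom X" by (rule image_cong[OF refl assms])
  ultimately show ?thesis by (simp add: strong_map_def)
qed

lemma strong_map_restrict: "strong_map \<sigma> X Y (restrict f (dom X)) \<longleftrightarrow> strong_map \<sigma> X Y f"
  by (rule strong_map_cong) simp

lemma strong_map_comp:
  assumes f: "strong_map \<sigma> X Y f" and g: "strong_map \<sigma> Y Z g"
  shows "strong_map \<sigma> X Z (\<lambda>x. g (f x))"
proof -
  have l: "map f xs \<in> lists (dom Y)" if "xs \<in> lists (dom X)" for xs
    using that strong_mapD(3)[OF f] by (auto simp: in_lists_conv_set)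
  have "inj_on (g \<circ> f) (dom X)"
    using strong_mapD(1,2)[OF f] inj_on_subset[OF strong_mapD(1)[OF g]] by (intro comp_inj_on) auto
  moreover have "xs \<in> rel X r \<longleftrightarrow> map (\<lambda>x. g (f x)) xs \<in> rel Z r"
    if "r \<in> syms \<sigma>" "xs \<in> lists (dom X)" "length xs = arity \<sigma> r" for r xs
    using strong_mapD(4)[OF f that] strong_mapD(4)[OF g that(1) l[OF that(2)]] that(3)
    by (simp add: comp_def)
  ultimately show ?thesis
    unfolding strong_map_def using strong_mapD(3)[OF f] strong_mapD(3)[OF g] by (auto simp: comp_def)
qed

text \<open>
  A map whose composite with an embedding is an embedding is itself one, since relations are both preserved
  and reflected.
\<close>

lemma strong_map_factor:
  assumes h: "strong_map \<sigma> X Z h" and g: "strong_map \<sigma> Y Z g"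
    and f: "\<And>x. x \<in> dom X \<Longrightarrow> f x \<in> dom Y \<and> g (f x) = h x"
  shows "strong_map \<sigma> X Y f"
proof -
  have "inj_on f (dom X)"
    by (rule inj_onI) (metis f inj_onD[OF strong_mapD(1)[OF h]])
  moreover have "xs \<in> rel X r \<longleftrightarrow> map f xs \<in> rel Y r"
    if "r \<in> syms \<sigma>" "xs \<in> lists (dom X)" "length xs = arity \<sigma> r" for r xs
  proof -
    have "map f xs \<in> lists (dom Y)" "map g (map f xs) = map h xs"
      using that(2) f by (auto simp: in_lists_conv_set)
    then show ?thesis
      using strong_mapD(4)[OF h that] strong_mapD(4)[OF g that(1), of "map f xs"] that(3)
      by (simp only: length_map)
  qed
  ultimately show ?thesis unfolding strong_map_def using f by auto
qed

text \<open>
  The map \<open>X \<rightarrow> Y\<close> over the common target of \<open>h\<close> and \<open>g\<close>, defined when the image of \<open>g\<close> contains that of \<open>h\<close>.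
\<close>

definition lift_map :: "('i, 'a) struc \<Rightarrow> ('i, 'c) struc \<Rightarrow> ('c \<Rightarrow> 'w) \<Rightarrow> ('a \<Rightarrow> 'w) \<Rightarrow> 'a \<Rightarrow> 'c" where
  "lift_map X Y g h = (\<lambda>x\<in>dom X. inv_into (dom Y) g (h x))"

lemma lift_map:
  assumes h: "strong_map \<sigma> X Z h" and g: "strong_map \<sigma> Y Z g" and sub: "h ` dom X \<subseteq> g ` dom Y"
  shows "embedding \<sigma> X Y (lift_map X Y g h)"
    and "x \<in> dom X \<Longrightarrow> lift_map X Y g h x \<in> dom Y \<and> g (lift_map X Y g h x) = h x"
    and "h ` dom X = g ` dom Y \<Longrightarrow> struct_iso \<sigma> X Y (lift_map X Y g h)"
proof -
  have *: "lift_map X Y g h x \<in> dom Y \<and> g (lift_map X Y g h x) = h x" if "x \<in> dom X" for x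
  proof -
    have "h x \<in> g ` dom Y" using that sub by blast
    then show ?thesis using that by (simp add: lift_map_def inv_into_into f_inv_into_f)
  qed
  then show "x \<in> dom X \<Longrightarrow> lift_map X Y g h x \<in> dom Y \<and> g (lift_map X Y g h x) = h x" .
  show emb: "embedding \<sigma> X Y (lift_map X Y g h)"
    unfolding embedding_iff using strong_map_factor[OF h g *] by (simp only: lift_map_def restrict_extensional simp_thms)
  assume eq: "h ` dom X = g ` dom Y"
  have "lift_map X Y g h ` dom X = dom Y"
  proof
    show "lift_map X Y g h ` dom X \<subseteq> dom Y" using * by blast
    show "dom Y \<subseteq> lift_map X Y g h ` dom X"
    proof
      fix y assume y: "y \<in> dom Y"
      then obtain x where x: "x \<in> dom X" "g y = h x" using eq by blast
      then have "lift_map X Y g h x = y"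
        using *[OF x(1)] y inj_onD[OF strong_mapD(1)[OF g]] by metis
      then show "y \<in> lift_map X Y g h ` dom X" using x(1) by blast
    qed
  qed
  then show "struct_iso \<sigma> X Y (lift_map X Y g h)"
    using emb by (simp add: struct_iso_iff embedding_iff)
qed

text \<open>
  The function \<open>cp\<close> chooses, for each finite subset of \<open>\<Omega>\<close>, where its copy among the members of the age
  lives.
\<close>

locale homogeneous_structure =
  fixes \<sigma> :: "'i signature" and \<Omega> :: "('i, 'w) struc" and cp :: "'w set \<Rightarrow> 'w \<Rightarrow> 'b"
  assumes struct: "is_structure \<sigma> \<Omega>" and homog: "homogeneous \<sigma> \<Omega>"
    and inj_cp: "finite A \<Longrightarrow> inj_on (cp A) A"
    and finite_age: "finite ({X \<in> (age \<sigma> \<Omega> :: ('i, 'b) struc set). card (dom X) = n} // iso_rel \<sigma>)"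
begin

abbreviation "G \<equiv> Aut \<sigma> \<Omega>"
abbreviation "S \<equiv> dom \<Omega>"
abbreviation "\<AA> \<equiv> age \<sigma> \<Omega> :: ('i, 'b) struc set"

lemma carrier_Aut: "g \<in> carrier G \<longleftrightarrow> struct_iso \<sigma> \<Omega> \<Omega> g"
  by (simp add: Aut_def)

lemma subgroup_Aut: "subgroup (carrier G) (BijGroup S)"
proof -
  interpret B: group "BijGroup S" by (rule group_BijGroup)
  have Bij: "g \<in> Bij S" if "g \<in> carrier G" for g
    using that by (simp add: carrier_Aut struct_iso_def Bij_def)
  show ?thesis
  proof (rule B.subgroupI)
    show "carrier G \<subseteq> carrier (BijGroup S)" using Bij by (auto simp: BijGroup_def)
    have "struct_iso \<sigma> \<Omega> \<Omega> (\<lambda>x\<in>S. x)"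
      unfolding struct_iso_iff strong_map_restrict by (auto simp: strong_map_def)
    then show "carrier G \<noteq> {}" using carrier_Aut by blast
  next
    fix g assume g: "g \<in> carrier G"
    then have s: "strong_map \<sigma> \<Omega> \<Omega> g" "g ` S = S" by (auto simp: carrier_Aut struct_iso_iff)
    have i: "inv_into S g x \<in> S \<and> g (inv_into S g x) = x" if "x \<in> S" for x
      using that s(2) by (metis f_inv_into_f inv_into_into)
    have "strong_map \<sigma> \<Omega> \<Omega> (inv_into S g)"
      by (rule strong_map_factor[of _ _ _ "\<lambda>x. x", OF _ s(1) i]) (auto simp: strong_map_def)
    moreover have "inv_into S g ` S = S"
      using strong_mapD(1)[OF s(1)] s(2) by (metis bij_betw_def bij_betw_inv_into)
    ultimately have "struct_iso \<sigma> \<Omega> \<Omega> (\<lambda>x\<in>S. inv_into S g x)"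
      unfolding struct_iso_iff strong_map_restrict by simp
    then show "inv\<^bsub>BijGroup S\<^esub> g \<in> carrier G"
      by (simp add: inv_BijGroup[OF Bij[OF g]] carrier_Aut)
  next
    fix g h assume g: "g \<in> carrier G" and h: "h \<in> carrier G"
    then have s: "strong_map \<sigma> \<Omega> \<Omega> g" "g ` S = S" "strong_map \<sigma> \<Omega> \<Omega> h" "h ` S = S"
      by (auto simp: carrier_Aut struct_iso_iff)
    have "struct_iso \<sigma> \<Omega> \<Omega> (compose S g h)"
      unfolding struct_iso_iff compose_def strong_map_restrict
      using strong_map_comp[OF s(3,1)] s(2,4) by (simp add: image_image[symmetric])
    then show "g \<otimes>\<^bsub>BijGroup S\<^esub> h \<in> carrier G"
      using Bij[OF g] Bij[OF h] by (simp add: BijGroup_def carrier_Aut)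
  qed
qed

sublocale perm_group G S
  by (intro perm_group.intro subgroup_Aut) (simp add: Aut_def)

text \<open>
  The form in which homogeneity is used everywhere: two embeddings of a finite structure into \<open>\<Omega>\<close> differ by
  an automorphism.
\<close>

lemma extend_to_automorphism:
  assumes fin: "finite (dom X)" and f: "strong_map \<sigma> X \<Omega> f" and f': "strong_map \<sigma> X \<Omega> f'"
  shows "\<exists>g\<in>carrier G. \<forall>x\<in>dom X. g (f x) = f' x"
proof -
  let ?A = "f ` dom X" and ?B = "f' ` dom X"
  have st: "strong_map \<sigma> (induced \<Omega> C) \<Omega> (\<lambda>x. x)" if "C \<subseteq> S" for C
    using that by (auto simp: strong_map_def induced_def in_lists_conv_set)
  have A: "?A \<subseteq> S" "?B \<subseteq> S" using strong_mapD(2)[OF f] strong_mapD(2)[OF f'] by auto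
  let ?i = "inv_into (dom X) f"
  have i: "?i a \<in> dom X \<and> f (?i a) = a" if "a \<in> ?A" for a
    using that by (metis f_inv_into_f inv_into_into)
  have 1: "strong_map \<sigma> (induced \<Omega> ?A) X ?i"
    by (rule strong_map_factor[OF st[OF A(1)] f]) (use i in \<open>auto simp: induced_def\<close>)
  have "strong_map \<sigma> (induced \<Omega> ?A) (induced \<Omega> ?B) (\<lambda>a. f' (?i a))"
    by (rule strong_map_factor[OF strong_map_comp[OF 1 f'] st[OF A(2)]]) (use i in \<open>auto simp: induced_def\<close>)
  moreover have "(\<lambda>a. f' (?i a)) ` ?A = ?B"
    using strong_mapD(1)[OF f] by (simp add: image_image)
  moreover have dom: "dom (induced \<Omega> C) = C" for C by (simp add: induced_def)
  ultimately have "struct_iso \<sigma> (induced \<Omega> ?A) (induced \<Omega> ?B) (\<lambda>a\<in>dom (induced \<Omega> ?A). f' (?i a))"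
    unfolding struct_iso_iff strong_map_restrict by (simp add: dom)
  then have "struct_iso \<sigma> (induced \<Omega> ?A) (induced \<Omega> ?B) (\<lambda>a\<in>?A. f' (?i a))"
    by (simp only: dom)
  then obtain g where "g \<in> carrier G" "\<forall>a\<in>?A. g a = (\<lambda>a\<in>?A. f' (?i a)) a"
    using homog fin A unfolding homogeneous_def by (metis finite_imageI)
  then show ?thesis using strong_mapD(1)[OF f] by (intro bexI[of _ g]) auto
qed

lemma strong_map_automorphism:
  "strong_map \<sigma> X \<Omega> f \<Longrightarrow> g \<in> carrier G \<Longrightarrow> strong_map \<sigma> X \<Omega> (\<lambda>x. g (f x))"
  using strong_map_comp[of \<sigma> X \<Omega> f \<Omega> g] by (simp add: carrier_Aut struct_iso_iff)

text \<open>
  The copy of the finite substructure on \<open>A\<close> in the type of the age, and below its embedding into \<open>\<Omega>\<close>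
  with image \<open>A\<close>.
\<close>

definition K :: "'w set \<Rightarrow> ('i, 'b) struc" where
  "K A = \<lparr>dom = cp A ` A, rel = (\<lambda>r. map (cp A) ` (rel \<Omega> r \<inter> lists A))\<rparr>"

definition eK :: "'w set \<Rightarrow> 'b \<Rightarrow> 'w" where "eK A = inv_into A (cp A)"

lemma K:
  assumes A: "finite A" "A \<subseteq> S"
  shows "strong_map \<sigma> (K A) \<Omega> (eK A)" "eK A ` dom (K A) = A" "K A \<in> \<AA>"
proof -
  note inj = inj_cp[OF A(1)]
  have e: "eK A (cp A a) = a" if "a \<in> A" for a using inj that by (simp add: eK_def)
  have im: "eK A ` cp A ` A = A" using e by (force simp: image_image)
  then show "eK A ` dom (K A) = A" by (simp add: K_def)
  have me: "map (eK A) (map (cp A) xs) = xs" if "xs \<in> lists A" for xs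
    using that e by (auto simp: in_lists_conv_set intro!: map_idI)
  have "xs \<in> map (cp A) ` (rel \<Omega> r \<inter> lists A) \<longleftrightarrow> map (eK A) xs \<in> rel \<Omega> r"
    if xs: "xs \<in> lists (cp A ` A)" for xs r
  proof -
    obtain ys where ys: "ys \<in> lists A" "xs = map (cp A) ys"
      using xs unfolding lists_image by blast
    have "map (cp A) ys = map (cp A) zs \<Longrightarrow> zs \<in> lists A \<Longrightarrow> ys = zs" for zs
      using me ys(1) by metis
    then show ?thesis using ys me[OF ys(1)] by auto
  qed
  moreover have "inj_on (eK A) (cp A ` A)" using e by (intro inj_onI) auto
  ultimately show strong: "strong_map \<sigma> (K A) \<Omega> (eK A)"
    using im A(2) by (auto simp: strong_map_def K_def)
  have "is_structure \<sigma> (K A)"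
  proof -
    have "length xs = arity \<sigma> r" if "r \<in> syms \<sigma>" "xs \<in> rel \<Omega> r" for r xs
      using struct that unfolding is_structure_def by blast
    then show ?thesis
      using struct unfolding is_structure_def K_def by (auto simp: in_lists_conv_set)
  qed
  moreover have "embedding \<sigma> (K A) \<Omega> (restrict (eK A) (dom (K A)))"
    using strong by (simp add: embedding_iff strong_map_restrict)
  ultimately show "K A \<in> \<AA>" using A(1) by (auto simp: age_def K_def)
qed

lemma ageD:
  assumes "X \<in> \<AA>"
  shows "finite (dom X)" "\<exists>f. strong_map \<sigma> X \<Omega> f"
  using assms by (auto simp: age_def embedding_iff)

text \<open>
  A tuple \<open>xs\<close> spans a substructure with at most \<open>n\<close> points, which is isomorphic to one of finitely many
  fixed structures.  The isomorphism type together with the tuple \<open>ys\<close> that corresponds to \<open>xs\<close> in the fixed structure leaves finitely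
  many possibilities, and by homogeneity it determines the orbit of \<open>xs\<close>.
\<close>

lemma finite_tuple_orbits_Aut: "finite (orbits G {xs \<in> lists S. length xs = n} (\<lambda>g. map g))"
proof -
  let ?U = "{xs \<in> lists S. length xs = n}"
  define R where "R C = (SOME X. X \<in> C)" for C :: "('i, 'b) struc set"
  define cl where "cl xs = iso_rel \<sigma> `` {K (set xs)}" for xs :: "'w list"
  let ?P = "\<lambda>xs ys. \<exists>F. strong_map \<sigma> (R (cl xs)) \<Omega> F \<and> ys \<in> lists (dom (R (cl xs))) \<and> map F ys = xs"
  define ys where "ys xs = (SOME ys. ?P xs ys)" for xs
  define Cs where "Cs = (\<Union>m\<le>n. {X \<in> \<AA>. card (dom X) = m} // iso_rel \<sigma>)"
  have finCs: "finite Cs" unfolding Cs_def using finite_age by blast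
  have main: "cl xs \<in> Cs \<and> finite (dom (R (cl xs))) \<and> ?P xs (ys xs)" if xs: "xs \<in> ?U" for xs
  proof -
    let ?A = "set xs"
    have A: "finite ?A" "?A \<subseteq> S" "card ?A \<le> n" using xs card_length[of xs] by auto
    note KA = K[OF A(1,2)]
    have card: "card (dom (K ?A)) \<le> n"
      using A(1,3) card_image_le[of ?A "cp ?A"] by (simp add: K_def)
    have C: "cl xs \<in> Cs"
      unfolding Cs_def cl_def using KA(3) card by (auto intro!: quotientI)
    have "struct_iso \<sigma> (K ?A) (K ?A) (\<lambda>x\<in>dom (K ?A). x)"
      unfolding struct_iso_iff strong_map_restrict by (auto simp: strong_map_def)
    then have "K ?A \<in> cl xs" by (auto simp: cl_def iso_rel_def)
    then have "R (cl xs) \<in> cl xs" unfolding R_def by (rule someI)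
    then obtain k where k: "struct_iso \<sigma> (K ?A) (R (cl xs)) k" by (auto simp: cl_def iso_rel_def)
    let ?X = "R (cl xs)"
    have ks: "strong_map \<sigma> (K ?A) ?X k" "k ` dom (K ?A) = dom ?X" using k by (auto simp: struct_iso_iff)
    let ?i = "inv_into (dom (K ?A)) k"
    have i: "?i x \<in> dom (K ?A) \<and> k (?i x) = x" if "x \<in> dom ?X" for x
      using that ks(2) by (metis f_inv_into_f inv_into_into)
    have "strong_map \<sigma> ?X (K ?A) ?i"
      by (rule strong_map_factor[of _ _ _ "\<lambda>x. x", OF _ ks(1) i]) (auto simp: strong_map_def)
    then have F: "strong_map \<sigma> ?X \<Omega> (\<lambda>x. eK ?A (?i x))" by (rule strong_map_comp[OF _ KA(1)])
    have "(\<lambda>x. eK ?A (?i x)) ` dom ?X = ?A"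
      using KA(2) strong_mapD(1)[OF ks(1)] unfolding ks(2)[symmetric] by (simp add: image_image)
    then have "xs \<in> lists ((\<lambda>x. eK ?A (?i x)) ` dom ?X)" by (auto simp: in_lists_conv_set)
    then obtain zs where zs: "zs \<in> lists (dom ?X)" "xs = map (\<lambda>x. eK ?A (?i x)) zs"
      unfolding lists_image by blast
    have "?P xs zs" using F zs(1) zs(2)[symmetric] by blast
    then have "?P xs (ys xs)" unfolding ys_def by (rule someI)
    moreover have "finite (dom ?X)" unfolding ks(2)[symmetric] using A by (simp add: K_def)
    ultimately show ?thesis using C by blast
  qed
  let ?h = "\<lambda>xs. (cl xs, ys xs)"
  have "?h ` ?U \<subseteq> (\<Union>C\<in>{C \<in> Cs. finite (dom (R C))}. {C} \<times> {zs. set zs \<subseteq> dom (R C) \<and> length zs = n})"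
  proof
    fix p assume "p \<in> ?h ` ?U"
    then obtain xs where xs: "xs \<in> ?U" "p = (cl xs, ys xs)" by blast
    obtain F where F: "ys xs \<in> lists (dom (R (cl xs)))" "map F (ys xs) = xs"
      using main[OF xs(1)] by blast
    have "length (ys xs) = n" "set (ys xs) \<subseteq> dom (R (cl xs))"
      using arg_cong[OF F(2), of length] F(1) xs(1) by (auto simp: in_lists_conv_set)
    then show "p \<in> (\<Union>C\<in>{C \<in> Cs. finite (dom (R C))}. {C} \<times> {zs. set zs \<subseteq> dom (R C) \<and> length zs = n})"
      using main[OF xs(1)] xs(2) by auto
  qed
  moreover have "finite (\<Union>C\<in>{C \<in> Cs. finite (dom (R C))}. {C} \<times> {zs. set zs \<subseteq> dom (R C) \<and> length zs = n})"
    using finCs by (intro finite_UN_I) (auto intro!: finite_lists_length_eq)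
  ultimately have fin: "finite (?h ` ?U)" by (rule finite_subset)
  have "finite ((\<lambda>xs. orbit G (\<lambda>g. map g) xs) ` ?U)"
  proof (rule finite_image_factor[OF fin])
    have *: "orbit G (\<lambda>g. map g) xs' \<subseteq> orbit G (\<lambda>g. map g) xs"
      if xs: "xs \<in> ?U" and xs': "xs' \<in> ?U" and eq: "?h xs = ?h xs'" for xs xs'
    proof -
      obtain F where F: "strong_map \<sigma> (R (cl xs)) \<Omega> F" "ys xs \<in> lists (dom (R (cl xs)))" "map F (ys xs) = xs"
        using main[OF xs] by blast
      obtain F' where F': "strong_map \<sigma> (R (cl xs)) \<Omega> F'" "map F' (ys xs) = xs'"
        using main[OF xs'] eq by auto
      obtain g where g: "g \<in> carrier G" "\<forall>x\<in>dom (R (cl xs)). g (F x) = F' x"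
        using extend_to_automorphism[OF _ F(1) F'(1)] main[OF xs] by blast
      have "map g (map F (ys xs)) = map F' (ys xs)" using g(2) F(2) by (auto simp: in_lists_conv_set)
      then have gx: "map g xs = xs'" using F(3) F'(2) by simp
      have "map h xs' = map (h \<otimes>\<^bsub>G\<^esub> g) xs" if "h \<in> carrier G" for h
        using xs that g(1) unfolding gx[symmetric] by (auto simp: mult_apply)
      then show ?thesis using g(1) unfolding orbit_def by blast
    qed
    show "orbit G (\<lambda>g. map g) xs = orbit G (\<lambda>g. map g) xs'"
      if "xs \<in> ?U" "xs' \<in> ?U" "?h xs = ?h xs'" for xs xs'
      using *[OF that] *[OF that(2,1) that(3)[symmetric]] by blast
  qed
  moreover have "orbits G ?U (\<lambda>g. map g) = (\<lambda>xs. orbit G (\<lambda>g. map g) xs) ` ?U"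
    by (auto simp: orbits_def)
  ultimately show ?thesis by simp
qed

sublocale oligo_group G S
  by unfold_locales (rule finite_tuple_orbits_Aut)

lemma oligomorphic_Aut: "oligomorphic G S (\<lambda>g. g)"
proof -
  have "group_hom G (BijGroup S) (\<lambda>g. g)"
    using subgroup.subset[OF subgroup_Aut]
    by (intro group_hom.intro group_hom_axioms.intro group_axioms group_BijGroup homI)
      (auto simp: Aut_def)
  then have "faithful_action G S (\<lambda>g. g)"
    by (intro faithful_action.intro group_action.intro faithful_action_axioms.intro) auto
  then show ?thesis by (simp add: oligomorphic_def finite_tuple_orbits_Aut)
qed

subsection \<open>Amalgamations inside the structure\<close>

text \<open>
  The amalgamation is realised inside \<open>\<Omega>\<close> by \<open>F\<close>, with \<open>Y'\<close> in the fixed position \<open>e'\<close> and \<open>X\<close> in the translate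
  by \<open>g\<close> of its fixed position \<open>f\<close>.
\<close>

definition placed where
  "placed Y' X f e' = (\<lambda>(X', i', j') F g. strong_map \<sigma> X' \<Omega> F \<and>
     (\<forall>y\<in>dom Y'. F (i' y) = e' y) \<and> (\<forall>x\<in>dom X. F (j' x) = g (f x)))"

context
  fixes Y X Y' :: "('i, 'b) struc" and i j :: "'b \<Rightarrow> 'b" and e' f :: "'b \<Rightarrow> 'w"
  assumes i: "(Y, X, i) \<in> embeddings \<sigma> \<AA>" and j: "(Y, Y', j) \<in> embeddings \<sigma> \<AA>"
    and f: "strong_map \<sigma> X \<Omega> f" and e': "strong_map \<sigma> Y' \<Omega> e'"
    and agree: "\<And>y. y \<in> dom Y \<Longrightarrow> f (i y) = e' (j y)"
begin

lemma emb_facts: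
  "Y \<in> \<AA>" "X \<in> \<AA>" "Y' \<in> \<AA>" "embedding \<sigma> Y X i" "embedding \<sigma> Y Y' j"
  "y \<in> dom Y \<Longrightarrow> i y \<in> dom X" "y \<in> dom Y \<Longrightarrow> j y \<in> dom Y'"
  using i j by (auto simp: embeddings_def embedding_iff dest: strong_mapD(3))

text \<open>
  Every amalgamation of \<open>i\<close> and \<open>j\<close> can be moved so that \<open>Y'\<close> comes to lie in the position \<open>e'\<close>.  The positions
  of \<open>X\<close> then differ from \<open>f\<close> by an automorphism, which fixes the image of \<open>Y\<close>.
\<close>

lemma placed_exists:
  assumes a: "a \<in> amalgamations \<sigma> \<AA> (Y, X, i) (Y, Y', j)"
  shows "\<exists>F g. g \<in> stab (e' ` j ` dom Y) \<and> placed Y' X f e' a F g"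
proof -
  obtain X' i' j' where a': "a = (X', i', j')" by (metis surj_pair)
  have X': "X' \<in> \<AA>" "strong_map \<sigma> Y' X' i'" "strong_map \<sigma> X X' j'"
    "compose (dom Y) i' j = compose (dom Y) j' i"
    using a unfolding a' amalgamations_def by (auto simp: embedding_iff)
  have com: "i' (j y) = j' (i y)" if "y \<in> dom Y" for y
    using fun_cong[OF X'(4), of y] that by (simp add: compose_def)
  obtain F0 where F0: "strong_map \<sigma> X' \<Omega> F0" using ageD(2)[OF X'(1)] by blast
  obtain k where k: "k \<in> carrier G" "\<forall>y\<in>dom Y'. k (F0 (i' y)) = e' y"
    using extend_to_automorphism[OF ageD(1)[OF emb_facts(3)] strong_map_comp[OF X'(2) F0] e'] by blast
  define F where "F x = k (F0 x)" for x
  have F: "strong_map \<sigma> X' \<Omega> F" unfolding F_def by (rule strong_map_automorphism[OF F0 k(1)])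
  obtain g where g: "g \<in> carrier G" "\<forall>x\<in>dom X. g (f x) = F (j' x)"
    using extend_to_automorphism[OF ageD(1)[OF emb_facts(2)] f strong_map_comp[OF X'(3) F]] by blast
  have "g (e' (j y)) = e' (j y)" if "y \<in> dom Y" for y
  proof -
    have "g (e' (j y)) = g (f (i y))" by (simp add: agree[OF that])
    also have "\<dots> = k (F0 (j' (i y)))" using g(2) emb_facts(6)[OF that] by (simp add: F_def)
    also have "\<dots> = k (F0 (i' (j y)))" by (simp add: com[OF that])
    also have "\<dots> = e' (j y)" using k(2) emb_facts(7)[OF that] by simp
    finally show ?thesis .
  qed
  then have "g \<in> stab (e' ` j ` dom Y)" using g(1) by (auto simp: stab_iff)
  moreover have "placed Y' X f e' a F g" using F g(2) k(2) by (simp add: placed_def a' F_def)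
  ultimately show ?thesis by blast
qed

lemma placed_image:
  assumes a: "a \<in> amalgamations \<sigma> \<AA> (Y, X, i) (Y, Y', j)" and p: "placed Y' X f e' a F g"
  shows "F ` dom (fst a) = e' ` dom Y' \<union> g ` f ` dom X"
proof -
  obtain X' i' j' where a': "a = (X', i', j')" by (metis surj_pair)
  have d: "dom X' = i' ` dom Y' \<union> j' ` dom X" using a unfolding a' amalgamations_def by auto
  have "F ` i' ` dom Y' = e' ` dom Y'" "F ` j' ` dom X = g ` f ` dom X"
    unfolding image_image by (rule image_cong[OF refl]; use p in \<open>simp add: placed_def a'\<close>)+
  then show ?thesis by (simp add: a' d image_Un)
qed

text \<open>
  The dictionary between amalgamations and orbits: an isomorphism of amalgamations is an automorphism that
  fixes the image of \<open>Y'\<close> and carries one translate of the image of \<open>X\<close> to the other.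
\<close>

lemma placed_iso_iff:
  assumes a: "a \<in> amalgamations \<sigma> \<AA> (Y, X, i) (Y, Y', j)" and b: "b \<in> amalgamations \<sigma> \<AA> (Y, X, i) (Y, Y', j)"
    and pa: "placed Y' X f e' a F1 g1" and pb: "placed Y' X f e' b F2 g2"
  shows "amalg_iso \<sigma> (Y, X, i) (Y, Y', j) a b \<longleftrightarrow> (\<exists>h\<in>stab (e' ` dom Y'). \<forall>c\<in>f ` dom X. h (g1 c) = g2 c)"
proof -
  obtain X1 i1 j1 X2 i2 j2 where a': "a = (X1, i1, j1)" and b': "b = (X2, i2, j2)" by (metis surj_pair)
  have A1: "X1 \<in> \<AA>" "strong_map \<sigma> Y' X1 i1" "strong_map \<sigma> X X1 j1" "i1 \<in> extensional (dom Y')" "j1 \<in> extensional (dom X)"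
    using a unfolding a' amalgamations_def by (auto simp: embedding_iff)
  have A2: "X2 \<in> \<AA>" "strong_map \<sigma> Y' X2 i2" "strong_map \<sigma> X X2 j2" "i2 \<in> extensional (dom Y')" "j2 \<in> extensional (dom X)"
    using b unfolding b' amalgamations_def by (auto simp: embedding_iff)
  have F1: "strong_map \<sigma> X1 \<Omega> F1" "\<And>y. y \<in> dom Y' \<Longrightarrow> F1 (i1 y) = e' y" "\<And>x. x \<in> dom X \<Longrightarrow> F1 (j1 x) = g1 (f x)"
    using pa by (auto simp: placed_def a')
  have F2: "strong_map \<sigma> X2 \<Omega> F2" "\<And>y. y \<in> dom Y' \<Longrightarrow> F2 (i2 y) = e' y" "\<And>x. x \<in> dom X \<Longrightarrow> F2 (j2 x) = g2 (f x)"
    using pb by (auto simp: placed_def b')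
  note d1 = strong_mapD(3)[OF A1(2)] strong_mapD(3)[OF A1(3)] and d2 = strong_mapD(3)[OF A2(2)] strong_mapD(3)[OF A2(3)]
  show ?thesis
  proof
    assume "amalg_iso \<sigma> (Y, X, i) (Y, Y', j) a b"
    then obtain k where k: "struct_iso \<sigma> X1 X2 k" "compose (dom Y') k i1 = i2" "compose (dom X) k j1 = j2"
      by (auto simp: amalg_iso_def a' b')
    have ki: "k (i1 y) = i2 y" if "y \<in> dom Y'" for y using fun_cong[OF k(2), of y] that by (simp add: compose_def)
    have kj: "k (j1 x) = j2 x" if "x \<in> dom X" for x using fun_cong[OF k(3), of x] that by (simp add: compose_def)
    have ks: "strong_map \<sigma> X1 X2 k" using k(1) by (simp add: struct_iso_iff)
    obtain h where h: "h \<in> carrier G" "\<forall>x\<in>dom X1. h (F1 x) = F2 (k x)"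
      using extend_to_automorphism[OF ageD(1)[OF A1(1)] F1(1) strong_map_comp[OF ks F2(1)]] by blast
    have "h (e' y) = e' y" if "y \<in> dom Y'" for y
      using h(2) d1(1)[OF that] F1(2)[OF that] F2(2)[OF that] ki[OF that] by fastforce
    moreover have "h (g1 (f x)) = g2 (f x)" if "x \<in> dom X" for x
      using h(2) d1(2)[OF that] F1(3)[OF that] F2(3)[OF that] kj[OF that] by fastforce
    ultimately show "\<exists>h\<in>stab (e' ` dom Y'). \<forall>c\<in>f ` dom X. h (g1 c) = g2 c"
      using h(1) by (intro bexI[of _ h]) (auto simp: stab_iff)
  next
    assume "\<exists>h\<in>stab (e' ` dom Y'). \<forall>c\<in>f ` dom X. h (g1 c) = g2 c"
    then obtain h where h: "h \<in> stab (e' ` dom Y')" "\<And>x. x \<in> dom X \<Longrightarrow> h (g1 (f x)) = g2 (f x)" by blast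
    have hF: "strong_map \<sigma> X1 \<Omega> (\<lambda>x. h (F1 x))" by (rule strong_map_automorphism[OF F1(1) stab_carrier[OF h(1)]])
    have "h ` g1 ` f ` dom X = g2 ` f ` dom X" unfolding image_image using h(2) by simp
    then have "(\<lambda>x. h (F1 x)) ` dom X1 = F2 ` dom X2"
      using placed_image[OF a pa] placed_image[OF b pb] stab_image_self[OF h(1)]
      by (simp add: a' b' image_image[symmetric] image_Un)
    note l = lift_map[OF hF F2(1)] and eq = this
    let ?k = "lift_map X1 X2 F2 (\<lambda>x. h (F1 x))"
    have k: "struct_iso \<sigma> X1 X2 ?k" by (rule l(3)) (simp_all add: eq)
    have kF: "?k x \<in> dom X2 \<and> F2 (?k x) = h (F1 x)" if "x \<in> dom X1" for x
      by (rule l(2)) (simp_all add: eq that)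
    note injF2 = inj_onD[OF strong_mapD(1)[OF F2(1)]]
    have "compose (dom Y') ?k i1 = i2"
    proof (rule extensionalityI[of _ "dom Y'"])
      fix y assume y: "y \<in> dom Y'"
      have "F2 (?k (i1 y)) = F2 (i2 y)"
        using kF[OF d1(1)[OF y]] F1(2)[OF y] F2(2)[OF y] h(1) y by (auto simp: stab_iff)
      then have "?k (i1 y) = i2 y" using injF2 kF[OF d1(1)[OF y]] d2(1)[OF y] by blast
      then show "compose (dom Y') ?k i1 y = i2 y" using y by (simp add: compose_def)
    qed (use A2 in auto)
    moreover have "compose (dom X) ?k j1 = j2"
    proof (rule extensionalityI[of _ "dom X"])
      fix x assume x: "x \<in> dom X"
      have "F2 (?k (j1 x)) = F2 (j2 x)"
        using kF[OF d1(2)[OF x]] F1(3)[OF x] F2(3)[OF x] h(2)[OF x] by simp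
      then have "?k (j1 x) = j2 x" using injF2 kF[OF d1(2)[OF x]] d2(2)[OF x] by blast
      then show "compose (dom X) ?k j1 x = j2 x" using x by (simp add: compose_def)
    qed (use A2 in auto)
    ultimately show "amalg_iso \<sigma> (Y, X, i) (Y, Y', j) a b" using k by (auto simp: amalg_iso_def a' b')
  qed
qed

text \<open>
  Conversely, every \<open>g\<close> that fixes the image of \<open>Y\<close> gives an amalgamation, the substructure of \<open>\<Omega>\<close> on
  \<open>e'(Y') \<union> g f(X)\<close>.
\<close>

lemma std_amalg:
  assumes g: "g \<in> stab (e' ` j ` dom Y)"
  defines "C \<equiv> e' ` dom Y' \<union> g ` f ` dom X"
  defines "a \<equiv> (K C, lift_map Y' (K C) (eK C) e', lift_map X (K C) (eK C) (\<lambda>x. g (f x)))"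
  shows "a \<in> amalgamations \<sigma> \<AA> (Y, X, i) (Y, Y', j)" "placed Y' X f e' a (eK C) g"
    "finite C" "C \<subseteq> S"
proof -
  have gf: "strong_map \<sigma> X \<Omega> (\<lambda>x. g (f x))" by (rule strong_map_automorphism[OF f stab_carrier[OF g]])
  show C: "finite C" "C \<subseteq> S"
    using ageD(1)[OF emb_facts(2)] ageD(1)[OF emb_facts(3)] strong_mapD(2)[OF e'] strong_mapD(2)[OF gf]
    by (auto simp: C_def)
  note KC = K[OF C]
  let ?i = "lift_map Y' (K C) (eK C) e'" and ?j = "lift_map X (K C) (eK C) (\<lambda>x. g (f x))"
  note li = lift_map[OF e' KC(1), unfolded KC(2)] and lj = lift_map[OF gf KC(1), unfolded KC(2)]
  have subs: "e' ` dom Y' \<subseteq> C" "(\<lambda>x. g (f x)) ` dom X \<subseteq> C" by (auto simp: C_def)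
  note li = li(1,2)[OF subs(1)] and lj = lj(1,2)[OF subs(2)]
  note inj = inj_onD[OF strong_mapD(1)[OF KC(1)]]
  have com: "?i (j y) = ?j (i y)" if y: "y \<in> dom Y" for y
  proof -
    have "g (f (i y)) = e' (j y)" using g y agree[OF y] by (auto simp: stab_iff)
    then show ?thesis
      using li(2)[OF emb_facts(7)[OF y]] lj(2)[OF emb_facts(6)[OF y]] inj by metis
  qed
  have "dom (K C) = ?i ` dom Y' \<union> ?j ` dom X"
  proof
    show "?i ` dom Y' \<union> ?j ` dom X \<subseteq> dom (K C)" using li(2) lj(2) by blast
    show "dom (K C) \<subseteq> ?i ` dom Y' \<union> ?j ` dom X"
    proof
      fix z assume z: "z \<in> dom (K C)"
      then have "eK C z \<in> C" using KC(2) by blast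
      then consider y where "y \<in> dom Y'" "eK C z = e' y" | x where "x \<in> dom X" "eK C z = g (f x)"
        by (auto simp: C_def)
      then show "z \<in> ?i ` dom Y' \<union> ?j ` dom X"
      proof cases
        case 1
        then have "z = ?i y" using li(2)[OF 1(1)] z inj by metis
        then show ?thesis using 1 by blast
      next
        case 2
        then have "z = ?j x" using lj(2)[OF 2(1)] z inj by metis
        then show ?thesis using 2 by blast
      qed
    qed
  qed
  moreover have "compose (dom Y) ?i j = compose (dom Y) ?j i" unfolding compose_def using com by auto
  ultimately show "a \<in> amalgamations \<sigma> \<AA> (Y, X, i) (Y, Y', j)"
    using li(1) lj(1) KC(3) by (simp add: a_def amalgamations_def)
  show "placed Y' X f e' a (eK C) g" using KC(1) li(2) lj(2) by (simp add: placed_def a_def)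
qed

end
end


section \<open>The ring of the age carries the universal measure\<close>

context homogeneous_structure
begin

abbreviation "embs \<equiv> embeddings \<sigma> \<AA>"
abbreviation "eqs \<equiv> pres_eq embs (Theta_struct_rels \<sigma> \<AA>)"

lemma embs_iff: "(Y, X, i) \<in> embs \<longleftrightarrow> Y \<in> \<AA> \<and> X \<in> \<AA> \<and> i \<in> extensional (dom Y) \<and> strong_map \<sigma> Y X i"
  by (auto simp: embeddings_def embedding_iff)

lemma embs_compose:
  assumes "(Y, X, i) \<in> embs" "(Z, Y, j) \<in> embs"
  shows "(Z, X, compose (dom Z) i j) \<in> embs"
  using assms strong_map_comp[of \<sigma> Z Y j X i]
  unfolding embs_iff compose_def strong_map_restrict by simp

lemma amalg_embs:
  assumes "(X', i', j') \<in> amalgamations \<sigma> \<AA> (Y, X, i) (Y, Y', j)" "(Y, Y', j) \<in> embs"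
  shows "(Y', X', i') \<in> embs"
  using assms by (auto simp: amalgamations_def embeddings_def)

lemma struct_rels_cases:
  fixes r :: "('i, 'b) emb int_mpoly"
  assumes "r \<in> Theta_struct_rels \<sigma> \<AA>"
  obtains
    (iso) Y X :: "('i, 'b) struc" and i where "r = var (Y, X, i) - 1" "(Y, X, i) \<in> embs" "struct_iso \<sigma> Y X i"
  | (comp) X Y Z :: "('i, 'b) struc" and i j where
      "r = var (Z, X, compose (dom Z) i j) - var (Y, X, i) * var (Z, Y, j)" "(Y, X, i) \<in> embs" "(Z, Y, j) \<in> embs"
  | (amalg) X Y Y' :: "('i, 'b) struc" and i j T where
      "r = var (Y, X, i) - (\<Sum>(X', i', j')\<in>T. var (Y', X', i'))" "(Y, X, i) \<in> embs" "(Y, Y', j) \<in> embs"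
      "amalg_representatives \<sigma> \<AA> (Y, X, i) (Y, Y', j) T"
  using assms unfolding Theta_struct_rels_def
  by (elim UnE CollectE exE conjE) metis+

lemma amalg_sum_closed:
  assumes "(Y, Y', j) \<in> embs" "amalg_representatives \<sigma> \<AA> (Y, X, i) (Y, Y', j) T"
  shows "(\<Sum>(X', i', j')\<in>T. var (Y', X', i')) \<in> carrier (free_comm_ring embs)"
proof (rule free_sum)
  fix t assume t: "t \<in> T"
  obtain X' i' j' where t': "t = (X', i', j')" by (metis surj_pair)
  then have "(Y', X', i') \<in> embs"
    using assms t amalg_embs unfolding amalg_representatives_def by blast
  then show "(case t of (X', i', j') \<Rightarrow> var (Y', X', i')) \<in> carrier (free_comm_ring embs)"
    unfolding t' by (simp add: free_var)
qed

lemma struct_rels_closed: "Theta_struct_rels \<sigma> \<AA> \<subseteq> carrier (free_comm_ring embs)"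
proof
  fix r :: "('i, 'b) emb int_mpoly" assume "r \<in> Theta_struct_rels \<sigma> \<AA>"
  then show "r \<in> carrier (free_comm_ring embs)"
  proof (cases rule: struct_rels_cases)
    case (comp X Y Z i j)
    then show ?thesis using embs_compose by (auto intro!: free_closed)
  next
    case (amalg X Y Y' i j T)
    then show ?thesis using amalg_sum_closed by (auto intro!: free_closed)
  qed (auto intro!: free_closed)
qed

lemma eqs_congruence: "ring_congruence eqs"
  by (rule pres_eq_congruence[OF struct_rels_closed])

lemma eqs_refl: "(Y, X, i) \<in> embs \<Longrightarrow> eqs (var (Y, X, i)) (var (Y, X, i))"
  by (rule pres_eq_refl[OF struct_rels_closed free_var])

lemma eqs_iso:
  assumes "(Y, X, i) \<in> embs" "struct_iso \<sigma> Y X i"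
  shows "eqs (var (Y, X, i)) 1"
proof (rule pres_eqI[OF _ struct_rels_closed free_var free_one])
  show "var (Y, X, i) - 1 \<in> Theta_struct_rels \<sigma> \<AA>"
    unfolding Theta_struct_rels_def
    by (rule UnI1, rule UnI1, rule CollectI, intro exI conjI) (rule refl assms)+
qed (rule assms)

lemma eqs_comp:
  assumes "(Y, X, i) \<in> embs" "(Z, Y, j) \<in> embs"
  shows "eqs (var (Z, X, compose (dom Z) i j)) (var (Y, X, i) * var (Z, Y, j))"
proof (rule pres_eqI[OF _ struct_rels_closed free_var free_mult[OF free_var free_var]])
  show "var (Z, X, compose (dom Z) i j) - var (Y, X, i) * var (Z, Y, j) \<in> Theta_struct_rels \<sigma> \<AA>"
    unfolding Theta_struct_rels_def
    by (rule UnI1, rule UnI2, rule CollectI, intro exI conjI) (rule refl assms)+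
qed (rule assms embs_compose[OF assms])+

lemma eqs_amalg:
  assumes "(Y, X, i) \<in> embs" "(Y, Y', j) \<in> embs" "amalg_representatives \<sigma> \<AA> (Y, X, i) (Y, Y', j) T"
  shows "eqs (var (Y, X, i)) (\<Sum>(X', i', j')\<in>T. var (Y', X', i'))"
proof (rule pres_eqI[OF _ struct_rels_closed free_var amalg_sum_closed[OF assms(2,3)]])
  show "var (Y, X, i) - (\<Sum>(X', i', j')\<in>T. var (Y', X', i')) \<in> Theta_struct_rels \<sigma> \<AA>"
    unfolding Theta_struct_rels_def
    by (rule UnI2, rule CollectI, intro exI conjI) (rule refl assms)+
qed (rule assms)

definition incl :: "'w set \<Rightarrow> 'w set \<Rightarrow> 'b \<Rightarrow> 'b" where
  "incl A B = lift_map (K A) (K B) (eK B) (eK A)"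

definition mu :: "'w set \<Rightarrow> 'w set \<Rightarrow> ('i, 'b) emb int_mpoly" where
  "mu A B = var (K A, K B, incl A B)"

lemma incl:
  assumes "A \<subseteq> B" "finite B" "B \<subseteq> S"
  shows "(K A, K B, incl A B) \<in> embs"
    and "x \<in> dom (K A) \<Longrightarrow> incl A B x \<in> dom (K B) \<and> eK B (incl A B x) = eK A x"
    and "A = B \<Longrightarrow> struct_iso \<sigma> (K A) (K B) (incl A B)"
proof -
  have A: "finite A" "A \<subseteq> S" using assms finite_subset by auto
  note KA = K[OF A] and KB = K[OF assms(2,3)]
  note l = lift_map[OF KA(1) KB(1), unfolded KA(2) KB(2), folded incl_def]
  show "(K A, K B, incl A B) \<in> embs" using l(1)[OF assms(1)] KA(3) KB(3) by (simp add: embeddings_def)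
  show "x \<in> dom (K A) \<Longrightarrow> incl A B x \<in> dom (K B) \<and> eK B (incl A B x) = eK A x"
    by (rule l(2)[OF assms(1)])
  show "struct_iso \<sigma> (K A) (K B) (incl A B)" if "A = B" by (rule l(3)) (use that in auto)
qed

text \<open>
  Every generator equals the class of an inclusion: the square with sides \<open>i\<close>, the inclusion of the images in \<open>\<Omega>\<close> and two
  isomorphisms commutes, and isomorphisms have class \<open>1\<close>.
\<close>

lemma eqs_position:
  assumes Y: "(Y, X, i) \<in> embs" and f: "strong_map \<sigma> X \<Omega> f"
  shows "eqs (var (Y, X, i)) (mu (f ` i ` dom Y) (f ` dom X))"
proof -
  interpret E: ring_congruence eqs by (rule eqs_congruence)
  let ?A = "f ` i ` dom Y" and ?B = "f ` dom X"
  have i: "strong_map \<sigma> Y X i" "X \<in> \<AA>" "Y \<in> \<AA>" using Y by (auto simp: embs_iff)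
  have fi: "strong_map \<sigma> Y \<Omega> (\<lambda>y. f (i y))" by (rule strong_map_comp[OF i(1) f])
  have B: "?A \<subseteq> ?B" "finite ?B" "?B \<subseteq> S"
    using ageD(1)[OF i(2)] strong_mapD(2)[OF f] strong_mapD(2)[OF i(1)] by auto
  have A: "finite ?A" "?A \<subseteq> S" using B finite_subset by auto
  note KA = K[OF A] and KB = K[OF B(2,3)]
  let ?a = "lift_map Y (K ?A) (eK ?A) (\<lambda>y. f (i y))" and ?b = "lift_map X (K ?B) (eK ?B) f"
  have eqA: "(\<lambda>y. f (i y)) ` dom Y = eK ?A ` dom (K ?A)" unfolding KA(2) by (simp add: image_image)
  have eqB: "f ` dom X = eK ?B ` dom (K ?B)" unfolding KB(2) ..
  note a = lift_map[OF fi KA(1) equalityD1[OF eqA]] and b = lift_map[OF f KB(1) equalityD1[OF eqB]]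
  have aE: "(Y, K ?A, ?a) \<in> embs" using a(1) i KA by (simp add: embeddings_def)
  have bE: "(X, K ?B, ?b) \<in> embs" using b(1) i KB by (simp add: embeddings_def)
  note inc = incl[OF B]
  have "compose (dom Y) ?b i = compose (dom Y) (incl ?A ?B) ?a"
  proof (rule extensionalityI[of _ "dom Y"])
    fix y assume y: "y \<in> dom Y"
    have iy: "i y \<in> dom X" by (rule strong_mapD(3)[OF i(1) y])
    have "eK ?B (?b (i y)) = eK ?B (incl ?A ?B (?a y))"
      using b(2)[OF iy] a(2)[OF y] inc(2)[of "?a y"] by simp
    then have "?b (i y) = incl ?A ?B (?a y)"
      using inj_onD[OF strong_mapD(1)[OF KB(1)]] b(2)[OF iy] a(2)[OF y] inc(2)[of "?a y"] by blast
    then show "compose (dom Y) ?b i y = compose (dom Y) (incl ?A ?B) ?a y" using y by (simp add: compose_def)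
  qed auto
  from E.eqv_trans[OF E.eqv_sym[OF eqs_comp[OF bE Y]], unfolded this, OF eqs_comp[OF inc(1) aE]]
  have "eqs (var (X, K ?B, ?b) * var (Y, X, i)) (mu ?A ?B * var (Y, K ?A, ?a))"
    unfolding mu_def .
  moreover have "eqs (var (X, K ?B, ?b) * var (Y, X, i)) (1 * var (Y, X, i))"
    by (rule E.eqv_mult[OF eqs_iso[OF bE b(3)[OF eqB]] eqs_refl[OF Y]])
  moreover have "eqs (mu ?A ?B * var (Y, K ?A, ?a)) (mu ?A ?B * 1)"
    by (rule E.eqv_mult[OF _ eqs_iso[OF aE a(3)[OF eqA]]]) (unfold mu_def, rule eqs_refl[OF inc(1)])
  ultimately have "eqs (1 * var (Y, X, i)) (mu ?A ?B * 1)" using E.eqv_sym E.eqv_trans by blast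
  then show ?thesis by simp
qed

lemma mu_self: "finite A \<Longrightarrow> A \<subseteq> S \<Longrightarrow> eqs (mu A A) 1"
  unfolding mu_def by (rule eqs_iso) (auto intro: incl)

lemma mu_trans:
  assumes C: "finite C" "C \<subseteq> S" and AB: "A \<subseteq> B" and BC: "B \<subseteq> C"
  shows "eqs (mu A C) (mu A B * mu B C)"
proof -
  have f: "finite B" "B \<subseteq> S" "A \<subseteq> C" using assms finite_subset[OF BC] by auto
  note iAB = incl[OF AB f(1,2)] and iBC = incl[OF BC C] and iAC = incl[OF f(3) C]
  have "compose (dom (K A)) (incl B C) (incl A B) = incl A C"
  proof (rule extensionalityI[of _ "dom (K A)"])
    fix x assume x: "x \<in> dom (K A)"
    have "incl B C (incl A B x) = incl A C x"
      by (rule inj_onD[OF strong_mapD(1)[OF K(1)[OF C]]])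
        (use iAB(2)[OF x] iAC(2)[OF x] iBC(2)[of "incl A B x"] in auto)
    then show "compose (dom (K A)) (incl B C) (incl A B) x = incl A C x" using x by (simp add: compose_def)
  qed (auto simp: incl_def lift_map_def)
  then show ?thesis
    using eqs_comp[OF iBC(1) iAB(1)] unfolding mu_def by (simp add: mult.commute)
qed

lemma mu_conj:
  assumes g: "g \<in> carrier G" and B: "finite B" "B \<subseteq> S" and AB: "A \<subseteq> B"
  shows "eqs (mu (g ` A) (g ` B)) (mu A B)"
proof -
  interpret E: ring_congruence eqs by (rule eqs_congruence)
  have A: "finite A" "A \<subseteq> S" using assms finite_subset[OF AB] by auto
  note inc = incl[OF AB B]
  have "(\<lambda>x. g (eK B x)) ` incl A B ` dom (K A) = g ` A"
  proof -
    have "(\<lambda>x. g (eK B x)) ` incl A B ` dom (K A) = (\<lambda>x. g (eK A x)) ` dom (K A)"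
      unfolding image_image using inc(2) by (intro image_cong) simp_all
    also have "\<dots> = g ` eK A ` dom (K A)" by (simp only: image_image)
    finally show ?thesis by (simp only: K(2)[OF A])
  qed
  moreover have "(\<lambda>x. g (eK B x)) ` dom (K B) = g ` B"
  proof -
    have "(\<lambda>x. g (eK B x)) ` dom (K B) = g ` eK B ` dom (K B)" by (simp only: image_image)
    then show ?thesis by (simp only: K(2)[OF B])
  qed
  ultimately have "eqs (mu A B) (mu (g ` A) (g ` B))"
    using eqs_position[OF inc(1) strong_map_automorphism[OF K(1)[OF B] g]] by (simp add: mu_def)
  then show ?thesis by (rule E.eqv_sym)
qed

text \<open>
  The standard amalgamations for \<open>t \<in> T\<close> are representatives of all amalgamations of the copies of \<open>A \<subseteq> B\<close>
  and \<open>A \<subseteq> A'\<close>, so the sum formula is an instance of the amalgamation relation.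
\<close>

lemma mu_amalg:
  assumes A': "finite A'" "A' \<subseteq> S" and B: "finite B" "B \<subseteq> S" and AA': "A \<subseteq> A'" and AB: "A \<subseteq> B"
    and T: "finite T" "T \<subseteq> stab A"
    and ex: "\<And>g. g \<in> stab A \<Longrightarrow> \<exists>!t. t \<in> T \<and> (\<exists>h\<in>stab A'. \<forall>b\<in>B. h (g b) = t b)"
  shows "eqs (mu A B) (\<Sum>t\<in>T. mu A' (A' \<union> t ` B))"
proof -
  have A: "finite A" "A \<subseteq> S" using B finite_subset[OF AB] AB by auto
  note iB = incl[OF AB B] and iA' = incl[OF AA' A']
  note KA = K[OF A] and KB = K[OF B] and KA' = K[OF A']
  have agree: "eK B (incl A B y) = eK A' (incl A A' y)" if "y \<in> dom (K A)" for y
    using iB(2)[OF that] iA'(2)[OF that] by simp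
  have im: "eK A' ` incl A A' ` dom (K A) = A"
    using iA'(2) KA(2) by (force simp: image_image)
  let ?i = "(K A, K B, incl A B)" and ?j = "(K A, K A', incl A A')"
  let ?am = "amalgamations \<sigma> \<AA> ?i ?j"
  define C where "C t = A' \<union> t ` B" for t
  define std where "std t = (K (C t), lift_map (K A') (K (C t)) (eK (C t)) (eK A'),
    lift_map (K B) (K (C t)) (eK (C t)) (\<lambda>x. t (eK B x)))" for t
  note ctx = iB(1) iA'(1) KB(1) KA'(1) agree
  have imB: "t ` eK B ` dom (K B) = t ` B" for t by (simp add: KB(2))
  have std: "std t \<in> ?am" "placed (K A') (K B) (eK B) (eK A') (std t) (eK (C t)) t"
    if "t \<in> stab A" for t
    using std_amalg[OF ctx, of t, unfolded im KA'(2) imB] that unfolding std_def C_def by auto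
  have iso: "amalg_iso \<sigma> ?i ?j a (std t) \<longleftrightarrow> (\<exists>h\<in>stab A'. \<forall>b\<in>B. h (g b) = t b)"
    if a: "a \<in> ?am" and F: "placed (K A') (K B) (eK B) (eK A') a F g" and t: "t \<in> stab A" for a F g t
    using placed_iso_iff[OF ctx a std(1)[OF t] F std(2)[OF t]] unfolding KA'(2) KB(2) .
  have "amalg_representatives \<sigma> \<AA> ?i ?j (std ` T)"
    unfolding amalg_representatives_def
  proof (intro conjI ballI)
    show "finite (std ` T)" using T by simp
    show "std ` T \<subseteq> ?am" using std(1) T(2) by blast
    fix a assume a: "a \<in> ?am"
    obtain F g where g: "g \<in> stab A" and F: "placed (K A') (K B) (eK B) (eK A') a F g"
      using placed_exists[OF ctx a] unfolding im by blast
    obtain t where t: "t \<in> T" "\<exists>h\<in>stab A'. \<forall>b\<in>B. h (g b) = t b"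
      and uniq: "\<And>s. s \<in> T \<Longrightarrow> \<exists>h\<in>stab A'. \<forall>b\<in>B. h (g b) = s b \<Longrightarrow> s = t"
      using ex[OF g] by blast
    show "\<exists>!u. u \<in> std ` T \<and> amalg_iso \<sigma> ?i ?j a u"
    proof (rule ex1I[of _ "std t"])
      show "std t \<in> std ` T \<and> amalg_iso \<sigma> ?i ?j a (std t)"
        using t iso[OF a F] T(2) by blast
      fix u assume u: "u \<in> std ` T \<and> amalg_iso \<sigma> ?i ?j a u"
      then obtain s where s: "s \<in> T" "u = std s" by blast
      then have "\<exists>h\<in>stab A'. \<forall>b\<in>B. h (g b) = s b" using u iso[OF a F] T(2) by blast
      then show "u = std t" using uniq[OF s(1)] s(2) by simp
    qed
  qed
  from eqs_amalg[OF iB(1) iA'(1) this]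
  have "eqs (mu A B) (\<Sum>(X', i', j')\<in>std ` T. var (K A', X', i'))" unfolding mu_def .
  moreover have inj: "inj_on std T"
  proof (rule inj_onI)
    fix s t assume s: "s \<in> T" and t: "t \<in> T" and eq: "std s = std t"
    have sA: "s \<in> stab A" and tA: "t \<in> stab A" using s t T by auto
    have one: "\<exists>h\<in>stab A'. \<forall>b\<in>B. h (s b) = s b"
      using one_apply G_closed[OF stab_carrier[OF sA]] A'(2) B(2)
      by (intro bexI[of _ "\<one>\<^bsub>G\<^esub>"]) (auto simp: stab_iff subset_iff)
    then have "amalg_iso \<sigma> ?i ?j (std s) (std t)" using iso[OF std(1,2)[OF sA] sA] eq by simp
    then have "\<exists>h\<in>stab A'. \<forall>b\<in>B. h (s b) = t b" using iso[OF std(1,2)[OF sA] tA] by simp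
    then show "s = t" using ex[OF sA] one s t by blast
  qed
  have "(\<Sum>(X', i', j')\<in>std ` T. var (K A', X', i')) = (\<Sum>t\<in>T. mu A' (A' \<union> t ` B))"
    by (subst sum.reindex[OF inj]) (simp add: std_def C_def mu_def incl_def)
  ultimately show ?thesis by simp
qed

sublocale mu: measure G S eqs mu
  by (intro measure.intro measure_axioms.intro oligo_group_axioms eqs_congruence
      mu_self mu_trans mu_conj mu_amalg)

subsection \<open>Every measure factors through the ring of the age\<close>

text \<open>
  The value of a measure \<open>M\<close> on an embedding, read off after embedding \<open>X\<close> into \<open>\<Omega>\<close>; any
  embedding of \<open>X\<close> gives the same value (\<open>phi_eq\<close>).
\<close>

definition phi :: "('w set \<Rightarrow> 'w set \<Rightarrow> 'r) \<Rightarrow> ('i, 'b) emb \<Rightarrow> 'r" where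
  "phi M = (\<lambda>(Y, X, i). let f = (SOME f. strong_map \<sigma> X \<Omega> f) in M (f ` i ` dom Y) (f ` dom X))"

lemma phi_position:
  assumes "(Y, X, i) \<in> embs"
  obtains f where "strong_map \<sigma> X \<Omega> f" "phi M (Y, X, i) = M (f ` i ` dom Y) (f ` dom X)"
    "f ` i ` dom Y \<subseteq> f ` dom X" "finite (f ` dom X)" "f ` dom X \<subseteq> S"
proof -
  have X: "X \<in> \<AA>" "strong_map \<sigma> Y X i" using assms by (auto simp: embs_iff)
  have f: "strong_map \<sigma> X \<Omega> (SOME f. strong_map \<sigma> X \<Omega> f)" using ageD(2)[OF X(1)] by (rule someI_ex)
  show thesis
  proof (rule that[OF f])
    show "(SOME f. strong_map \<sigma> X \<Omega> f) ` i ` dom Y \<subseteq> (SOME f. strong_map \<sigma> X \<Omega> f) ` dom X"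
      by (rule image_mono[OF strong_mapD(2)[OF X(2)]])
  qed (use strong_mapD(2)[OF f] ageD(1)[OF X(1)] in \<open>simp_all add: phi_def Let_def\<close>)
qed

lemma phi_eq:
  assumes M: "measure G S eqv M" and Y: "(Y, X, i) \<in> embs" and f: "strong_map \<sigma> X \<Omega> f"
  shows "eqv (phi M (Y, X, i)) (M (f ` i ` dom Y) (f ` dom X))"
proof -
  interpret M: measure G S eqv M by (rule M)
  obtain f0 where f0: "strong_map \<sigma> X \<Omega> f0" "phi M (Y, X, i) = M (f0 ` i ` dom Y) (f0 ` dom X)"
    "f0 ` i ` dom Y \<subseteq> f0 ` dom X" "finite (f0 ` dom X)" "f0 ` dom X \<subseteq> S"
    using phi_position[OF Y, of M] by metis
  have X: "X \<in> \<AA>" "strong_map \<sigma> Y X i" using Y by (auto simp: embs_iff)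
  obtain g where g: "g \<in> carrier G" "\<forall>x\<in>dom X. g (f0 x) = f x"
    using extend_to_automorphism[OF ageD(1)[OF X(1)] f0(1) f] by blast
  have "g ` f0 ` dom X = f ` dom X" "g ` f0 ` i ` dom Y = f ` i ` dom Y"
    unfolding image_image using g(2) strong_mapD(3)[OF X(2)] by auto
  then show ?thesis
    using M.mu_conj[OF g(1) f0(4,5,3)] M.eqv_sym f0(2) by metis
qed

text \<open>
  The positions \<open>g t\<close> of a system \<open>T\<close> of representatives of the amalgamations represent the orbits of
  \<open>G(A')\<close> on \<open>G(A)/G(B)\<close>, where \<open>A\<close>, \<open>A'\<close> and \<open>B\<close> are the images of \<open>Y\<close>, \<open>Y'\<close> and \<open>X\<close> in compatible positions.
\<close>

lemma phi_amalg:
  assumes M: "measure G S eqv M" and i: "(Y, X, i) \<in> embs" and j: "(Y, Y', j) \<in> embs"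
    and T: "amalg_representatives \<sigma> \<AA> (Y, X, i) (Y, Y', j) T"
  shows "eqv (phi M (Y, X, i)) (\<Sum>(X', i', j')\<in>T. phi M (Y', X', i'))"
proof -
  interpret M: measure G S eqv M by (rule M)
  let ?am = "amalgamations \<sigma> \<AA> (Y, X, i) (Y, Y', j)"
  let ?iso = "amalg_iso \<sigma> (Y, X, i) (Y, Y', j)"
  have Tfin: "finite T" and Tam: "T \<subseteq> ?am" and Tex: "\<And>a. a \<in> ?am \<Longrightarrow> \<exists>!t. t \<in> T \<and> ?iso a t"
    using T by (auto simp: amalg_representatives_def)
  have Y: "Y \<in> \<AA>" "X \<in> \<AA>" "Y' \<in> \<AA>" "strong_map \<sigma> Y X i" "strong_map \<sigma> Y Y' j"
    using i j by (auto simp: embs_iff)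
  obtain e' where e': "strong_map \<sigma> Y' \<Omega> e'" using ageD(2)[OF Y(3)] by blast
  obtain f0 where f0: "strong_map \<sigma> X \<Omega> f0" using ageD(2)[OF Y(2)] by blast
  obtain k where k: "k \<in> carrier G" "\<forall>y\<in>dom Y. k (f0 (i y)) = e' (j y)"
    using extend_to_automorphism[OF ageD(1)[OF Y(1)] strong_map_comp[OF Y(4) f0] strong_map_comp[OF Y(5) e']]
    by blast
  define f where "f x = k (f0 x)" for x
  have f: "strong_map \<sigma> X \<Omega> f" unfolding f_def by (rule strong_map_automorphism[OF f0 k(1)])
  have agree: "f (i y) = e' (j y)" if "y \<in> dom Y" for y using k(2) that by (simp add: f_def)
  note ctx = i j f e' agree
  let ?A = "e' ` j ` dom Y" and ?A' = "e' ` dom Y'" and ?B = "f ` dom X"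
  have Aeq: "f ` i ` dom Y = ?A" unfolding image_image using agree by auto
  have fin: "finite ?A'" "?A' \<subseteq> S" "finite ?B" "?B \<subseteq> S" "?A \<subseteq> ?A'" "?A \<subseteq> ?B"
    using ageD(1)[OF Y(3)] ageD(1)[OF Y(2)] strong_mapD(2)[OF e'] strong_mapD(2)[OF f]
      image_mono[OF strong_mapD(2)[OF Y(5)], of e'] image_mono[OF strong_mapD(2)[OF Y(4)], of f]
    unfolding Aeq by simp_all
  have "\<forall>t\<in>T. \<exists>Fg. snd Fg \<in> stab ?A \<and> placed Y' X f e' t (fst Fg) (snd Fg)"
  proof
    fix t assume "t \<in> T"
    then have "t \<in> ?am" using Tam by blast
    from placed_exists[OF ctx this]
    obtain F g where "g \<in> stab ?A" "placed Y' X f e' t F g" by blast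
    then show "\<exists>Fg. snd Fg \<in> stab ?A \<and> placed Y' X f e' t (fst Fg) (snd Fg)"
      by (intro exI[of _ "(F, g)"]) simp
  qed
  then obtain Fg where Fg: "\<forall>t\<in>T. snd (Fg t) \<in> stab ?A \<and> placed Y' X f e' t (fst (Fg t)) (snd (Fg t))"
    by (rule bchoice[THEN exE])
  define F g where "F t = fst (Fg t)" and "g t = snd (Fg t)" for t
  have g: "g t \<in> stab ?A" and pl: "placed Y' X f e' t (F t) (g t)" if "t \<in> T" for t
    using Fg that by (auto simp: F_def g_def)
  have isoT: "?iso a t \<longleftrightarrow> (\<exists>h\<in>stab ?A'. \<forall>b\<in>?B. h (g' b) = g t b)"
    if "a \<in> ?am" "placed Y' X f e' a F' g'" "t \<in> T" for a F' g' t
    using placed_iso_iff[OF ctx that(1) _ that(2) pl[OF that(3)]] Tam that(3) by blast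
  have refl: "?iso t t" if "t \<in> T" for t
  proof -
    have "\<exists>h\<in>stab ?A'. \<forall>b\<in>?B. h (g t b) = g t b"
      using one_apply G_closed[OF stab_carrier[OF g[OF that]]] fin(2,4)
      by (intro bexI[of _ "\<one>\<^bsub>G\<^esub>"]) (auto simp: stab_iff subset_iff)
    then show ?thesis using isoT[OF _ pl[OF that] that] Tam that by blast
  qed
  \<comment> \<open>Equal positions give isomorphic amalgamations, so the sum over \<open>T\<close> is a sum over positions.\<close>
  have inj: "inj_on g T"
  proof (rule inj_onI)
    fix s t assume s: "s \<in> T" and t: "t \<in> T" and eq: "g s = g t"
    have "?iso s t" using isoT[OF _ pl[OF s] t] isoT[OF _ pl[OF s] s] refl[OF s] Tam s eq by auto
    then show "s = t" using Tex[of s] refl[OF s] s t Tam by blast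
  qed
  have "eqv (M ?A ?B) (\<Sum>u\<in>g ` T. M ?A' (?A' \<union> u ` ?B))"
  proof (rule M.mu_amalg[OF fin])
    show "finite (g ` T)" using Tfin by simp
    show "g ` T \<subseteq> stab ?A" using g by blast
    fix k assume k: "k \<in> stab ?A"
    define a where "a = (K (?A' \<union> k ` ?B), lift_map Y' (K (?A' \<union> k ` ?B)) (eK (?A' \<union> k ` ?B)) e',
      lift_map X (K (?A' \<union> k ` ?B)) (eK (?A' \<union> k ` ?B)) (\<lambda>x. k (f x)))"
    have a: "a \<in> ?am" "placed Y' X f e' a (eK (?A' \<union> k ` ?B)) k"
      using std_amalg(1,2)[OF ctx k] by (simp_all only: a_def)
    obtain t where t: "t \<in> T" "?iso a t" and uniq: "\<And>s. s \<in> T \<Longrightarrow> ?iso a s \<Longrightarrow> s = t"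
      using Tex[OF a(1)] by blast
    show "\<exists>!u. u \<in> g ` T \<and> (\<exists>h\<in>stab ?A'. \<forall>b\<in>?B. h (k b) = u b)"
    proof (rule ex1I[of _ "g t"])
      show "g t \<in> g ` T \<and> (\<exists>h\<in>stab ?A'. \<forall>b\<in>?B. h (k b) = g t b)"
        using t isoT[OF a t(1)] by blast
      fix u assume u: "u \<in> g ` T \<and> (\<exists>h\<in>stab ?A'. \<forall>b\<in>?B. h (k b) = u b)"
      then obtain s where s: "s \<in> T" "u = g s" by blast
      then have "?iso a s" using u isoT[OF a s(1)] by blast
      then show "u = g t" using uniq[OF s(1)] s(2) by simp
    qed
  qed
  also have "(\<Sum>u\<in>g ` T. M ?A' (?A' \<union> u ` ?B)) = (\<Sum>t\<in>T. M ?A' (?A' \<union> g t ` ?B))"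
    by (simp add: sum.reindex[OF inj])
  also have "eqv \<dots> (\<Sum>(X', i', j')\<in>T. phi M (Y', X', i'))"
  proof (rule M.eqv_sum)
    fix t assume t: "t \<in> T"
    obtain X' i' j' where t': "t = (X', i', j')" by (metis surj_pair)
    have tam: "t \<in> ?am" using t Tam by blast
    have E: "(Y', X', i') \<in> embs" using amalg_embs[OF tam[unfolded t'] j] .
    have F: "strong_map \<sigma> X' \<Omega> (F t)" "\<And>y. y \<in> dom Y' \<Longrightarrow> F t (i' y) = e' y"
      using pl[OF t] by (auto simp: placed_def t')
    have "F t ` i' ` dom Y' = ?A'" unfolding image_image using F(2) by simp
    moreover have "F t ` dom X' = ?A' \<union> g t ` ?B"
      using placed_image[OF ctx tam pl[OF t]] by (simp add: t')
    ultimately have "eqv (phi M (Y', X', i')) (M ?A' (?A' \<union> g t ` ?B))"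
      using phi_eq[OF M E F(1)] by simp
    then show "eqv (M ?A' (?A' \<union> g t ` ?B)) (case t of (X', i', j') \<Rightarrow> phi M (Y', X', i'))"
      unfolding t' by (simp add: M.eqv_sym)
  qed
  finally have "eqv (M ?A ?B) (\<Sum>(X', i', j')\<in>T. phi M (Y', X', i'))" .
  with phi_eq[OF M i f] show ?thesis unfolding Aeq by (rule M.eqv_trans)
qed

text \<open>
  Any measure defines a homomorphism out of the ring of the age.
\<close>

lemma phi_struct_rels:
  fixes eqv :: "'h int_mpoly \<Rightarrow> 'h int_mpoly \<Rightarrow> bool"
  assumes M: "measure G S eqv M" and r: "r \<in> Theta_struct_rels \<sigma> \<AA>"
  shows "eqv (subst_poly (phi M) r) 0"
proof -
  interpret M: measure G S eqv M by (rule M)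
  have zero: "eqv (a - b) 0" if "eqv a b" for a b
    using M.eqv_diff[OF that M.eqv_reflI(2)[OF that]] by simp
  from r show ?thesis
  proof (cases rule: struct_rels_cases)
    case (iso Y X i)
    obtain f where f: "strong_map \<sigma> X \<Omega> f" "phi M (Y, X, i) = M (f ` i ` dom Y) (f ` dom X)"
      "f ` i ` dom Y \<subseteq> f ` dom X" "finite (f ` dom X)" "f ` dom X \<subseteq> S"
      using phi_position[OF iso(2), of M] by metis
    have "i ` dom Y = dom X" using iso(3) by (simp add: struct_iso_iff)
    then have "eqv (phi M (Y, X, i)) 1" using M.mu_self[OF f(4,5)] f(2) by simp
    then show ?thesis unfolding iso(1) by (simp add: subst_diff subst_var subst_one zero)
  next
    case (comp X Y Z i j)
    have E: "strong_map \<sigma> Y X i" "strong_map \<sigma> Z Y j" "X \<in> \<AA>" using comp by (auto simp: embs_iff)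
    obtain f where f: "strong_map \<sigma> X \<Omega> f" using ageD(2)[OF E(3)] by blast
    have fi: "strong_map \<sigma> Y \<Omega> (\<lambda>y. f (i y))" by (rule strong_map_comp[OF E(1) f])
    let ?A = "f ` i ` j ` dom Z" and ?B = "f ` i ` dom Y" and ?C = "f ` dom X"
    have sub: "finite ?C" "?C \<subseteq> S" "?A \<subseteq> ?B" "?B \<subseteq> ?C"
      using ageD(1)[OF E(3)] strong_mapD(2)[OF f] strong_mapD(2)[OF E(1)] strong_mapD(2)[OF E(2)] by auto
    have "f ` compose (dom Z) i j ` dom Z = ?A" by (auto simp: compose_def image_iff)
    then have 1: "eqv (phi M (Z, X, compose (dom Z) i j)) (M ?A ?C)"
      using phi_eq[OF M embs_compose[OF comp(2,3)] f] by simp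
    have 2: "eqv (phi M (Y, X, i)) (M ?B ?C)" by (rule phi_eq[OF M comp(2) f])
    have 3: "eqv (phi M (Z, Y, j)) (M ?A ?B)"
      using phi_eq[OF M comp(3) fi] by (simp add: image_image)
    have "eqv (phi M (Z, X, compose (dom Z) i j)) (M ?A ?B * M ?B ?C)"
      by (rule M.eqv_trans[OF 1 M.mu_trans[OF sub]])
    moreover have "eqv (M ?A ?B * M ?B ?C) (phi M (Z, Y, j) * phi M (Y, X, i))"
      by (rule M.eqv_mult[OF M.eqv_sym[OF 3] M.eqv_sym[OF 2]])
    ultimately have "eqv (phi M (Z, X, compose (dom Z) i j)) (phi M (Y, X, i) * phi M (Z, Y, j))"
      unfolding mult.commute[of "phi M (Y, X, i)"] by (rule M.eqv_trans)
    then show ?thesis unfolding comp(1) by (simp add: subst_diff subst_mult subst_var zero)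
  next
    case (amalg X Y Y' i j T)
    have "subst_poly (phi M) (\<Sum>(X', i', j')\<in>T. var (Y', X', i')) = (\<Sum>(X', i', j')\<in>T. phi M (Y', X', i'))"
      unfolding subst_sum by (rule sum.cong) (auto simp: subst_var)
    then show ?thesis unfolding amalg(1) subst_diff subst_var
      using zero[OF phi_amalg[OF M amalg(2-4)]] by simp
  qed
qed

lemma extend_embedding:
  assumes Y: "(Y, X, i) \<in> embs" and e: "strong_map \<sigma> Y \<Omega> e"
  obtains f where "strong_map \<sigma> X \<Omega> f" "\<And>y. y \<in> dom Y \<Longrightarrow> f (i y) = e y"
proof -
  have X: "Y \<in> \<AA>" "X \<in> \<AA>" "strong_map \<sigma> Y X i" using Y by (auto simp: embs_iff)
  obtain f0 where f0: "strong_map \<sigma> X \<Omega> f0" using ageD(2)[OF X(2)] by blast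
  obtain k where k: "k \<in> carrier G" "\<forall>y\<in>dom Y. k (f0 (i y)) = e y"
    using extend_to_automorphism[OF ageD(1)[OF X(1)] strong_map_comp[OF X(3) f0] e] by blast
  show thesis by (rule that[OF strong_map_automorphism[OF f0 k(1)]]) (use k(2) in simp)
qed

end

section \<open>The comparison isomorphism\<close>

locale coded_homogeneous_structure = homogeneous_structure \<sigma> \<Omega> cp
  for \<sigma> :: "'i signature" and \<Omega> :: "('i, 'w) struc" and cp :: "'w set \<Rightarrow> 'w \<Rightarrow> 'b" +
  fixes code :: "'w list \<Rightarrow> 'x"
  assumes inj_code': "inj code"
begin

sublocale coded_oligo_group G S code
  by unfold_locales (rule inj_code')

lemma phi_nu:
  assumes "(Y, X, i) \<in> embs"
  obtains A B where "A \<subseteq> B" "finite B" "B \<subseteq> S" "phi nu (Y, X, i) = nu A B" "eqs (mu A B) (var (Y, X, i))"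
  by (metis phi_position[OF assms, of nu] eqs_position[OF assms] mu.eqv_sym)

lemma psi_set_tup:
  assumes "A \<subseteq> B" "finite B" "B \<subseteq> S"
  shows "eqs (mu.psi_set (tup A B) (\<lambda>g. restrict (cact g) (tup A B))) (mu A B)"
proof -
  have A: "A \<subseteq> S" using assms by blast
  note tup = tup_subset[OF A assms(2,3)] tup_base[OF assms]
  show ?thesis
  proof (rule mu.psi_set_orbit[OF tame_restrict[OF tup(5)] _ tup(2)])
    show "base A (\<lambda>g. restrict (cact g) (tup A B)) (code (lst B)) B"
      using tup(4) unfolding base_def isotropy_restrict[OF tup(2)] .
    show "tup A B = orb (stab A) (\<lambda>g. restrict (cact g) (tup A B)) (code (lst B))"
      using tup(2) by (simp add: orb_def) (simp add: tup_def orb_def)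
  qed
qed

lemma subst_psi_phi:
  assumes Y: "(Y, X, i) \<in> embs"
  shows "eqs (subst_poly (\<lambda>(U, X, \<rho>). mu.psi_set X \<rho>) (phi nu (Y, X, i))) (var (Y, X, i))"
proof -
  obtain A B where A: "A \<subseteq> B" "finite B" "B \<subseteq> S" "phi nu (Y, X, i) = nu A B" "eqs (mu A B) (var (Y, X, i))"
    using phi_nu[OF Y] by metis
  show ?thesis
    using mu.eqv_trans[OF psi_set_tup[OF A(1-3)] A(5)]
    unfolding A(4) nu_def subst_var piece_def by simp
qed

text \<open>
  Applying \<open>phi nu\<close> to the size of \<open>X\<close> for \<open>mu\<close> turns every \<open>mu A B\<close> into \<open>nu A B\<close>, so the result is the size of \<open>X\<close> for \<open>nu\<close>.
\<close>

lemma subst_phi_psi: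
  assumes P: "(U, X, \<rho>) \<in> hats"
  shows "eqg (subst_poly (phi nu) (mu.psi_set X \<rho>)) (var (U, X, \<rho>))"
proof -
  define A where "A = (SOME A. tame A X \<rho>)"
  have t: "tame A X \<rho>" unfolding A_def using hat_sets_tame[OF P] by (metis someI_ex)
  have "eqg (subst_poly (phi nu) (mu.psi_set X \<rho>)) (nu.psi_set X \<rho>)"
    unfolding mu.psi_set_def nu.psi_set_def A_def[symmetric] mu.psi_def nu.psi_def subst_sum
  proof (rule nu.eqv_sum)
    fix Q assume "Q \<in> orbs (stab A) X \<rho>"
    then obtain x where "base A \<rho> x (Bsel A \<rho> Q)" using Bsel_base[OF t] by metis
    then have B: "A \<subseteq> Bsel A \<rho> Q" "finite (Bsel A \<rho> Q)" "Bsel A \<rho> Q \<subseteq> S" by (auto simp: base_def)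
    then have A: "finite A" "A \<subseteq> S" using finite_subset by auto
    let ?B = "Bsel A \<rho> Q"
    have "eK ?B ` incl A ?B ` dom (K A) = A"
    proof -
      have "eK ?B ` incl A ?B ` dom (K A) = eK A ` dom (K A)"
        unfolding image_image using incl(2)[OF B] by (intro image_cong) simp_all
      then show ?thesis using K(2)[OF A] by simp
    qed
    then show "eqg (subst_poly (phi nu) (mu A ?B)) (nu A ?B)"
      using phi_eq[OF nu.measure_axioms incl(1)[OF B] K(1)[OF B(2,3)]] K(2)[OF B(2,3)]
      by (simp add: mu_def subst_var)
  qed
  then show ?thesis using nu.eqv_trans psi_set_nu[OF P] by blast
qed

text \<open>
  By homogeneity the pointwise stabilizer of \<open>e(Y)\<close> is transitive on the extensions of \<open>e\<close>, and the stabilizer of the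
  extension \<open>f\<close> is the pointwise stabilizer of \<open>f(X)\<close>.
\<close>

lemma extension_set_iso:
  assumes Y: "(Y, X, i) \<in> embs" and e: "embedding \<sigma> Y \<Omega> e"
    and f: "strong_map \<sigma> X \<Omega> f" and fi: "\<And>y. y \<in> dom Y \<Longrightarrow> f (i y) = e y"
  shows "hat_iso G S (piece (e ` dom Y) (tup (e ` dom Y) (f ` dom X)) cact) (extension_set \<sigma> \<Omega> (Y, X, i) e)"
proof -
  let ?A = "e ` dom Y" and ?B = "f ` dom X"
  have X: "Y \<in> \<AA>" "X \<in> \<AA>" "strong_map \<sigma> Y X i" using Y by (auto simp: embs_iff)
  have es: "strong_map \<sigma> Y \<Omega> e" "e \<in> extensional (dom Y)" using e by (auto simp: embedding_iff)
  have i: "i y \<in> dom X" if "y \<in> dom Y" for y by (rule strong_mapD(3)[OF X(3) that])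
  have A: "finite ?A" "?A \<subseteq> S" using ageD(1)[OF X(1)] strong_mapD(2)[OF es(1)] by auto
  have B: "finite ?B" "?B \<subseteq> S" using ageD(1)[OF X(2)] strong_mapD(2)[OF f] by auto
  have AB: "?A \<subseteq> ?B" using fi i by (metis image_eqI image_subsetI)
  define F where "F = {f. embedding \<sigma> X \<Omega> f \<and> compose (dom Y) f i = e}"
  define \<rho> where "\<rho> g = (\<lambda>f\<in>F. compose (dom X) g f)" for g :: "'w \<Rightarrow> 'w"
  have Fiff: "h \<in> F \<longleftrightarrow> h \<in> extensional (dom X) \<and> strong_map \<sigma> X \<Omega> h \<and> (\<forall>y\<in>dom Y. h (i y) = e y)" for h
    unfolding F_def mem_Collect_eq embedding_iff
    using es(2) by (auto simp: compose_def fun_eq_iff extensional_def)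
  have ext: "extension_set \<sigma> \<Omega> (Y, X, i) e = (stab ?A, F, \<rho>)"
  proof -
    have "\<rho> = (\<lambda>g. \<lambda>f\<in>F. compose (dom X) g f)" unfolding \<rho>_def ..
    then show ?thesis by (simp only: extension_set.simps Let_def F_def)
  qed
  define f' where "f' = restrict f (dom X)"
  have f'F: "f' \<in> F" unfolding Fiff f'_def strong_map_restrict using f fi i by simp
  have S: "h x \<in> S" if "h \<in> F" "x \<in> dom X" for h x
    using that by (auto simp: Fiff dest: strong_mapD(3))
  have closed: "compose (dom X) g h \<in> F" if "g \<in> stab ?A" "h \<in> F" for g h
    using that strong_map_automorphism[of X h g] i
    unfolding Fiff compose_def strong_map_restrict by (auto simp: stab_iff)
  have act: "is_act (stab ?A) F \<rho>"
    unfolding is_act_def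
  proof (intro conjI ballI)
    show "\<rho> g h \<in> F" if "g \<in> stab ?A" "h \<in> F" for g h using closed[OF that] that by (simp add: \<rho>_def)
    show "\<rho> (g \<otimes>\<^bsub>G\<^esub> k) h = \<rho> g (\<rho> k h)" if "g \<in> stab ?A" "k \<in> stab ?A" "h \<in> F" for g k h
    proof -
      have "compose (dom X) (g \<otimes>\<^bsub>G\<^esub> k) h = compose (dom X) g (compose (dom X) k h)"
        unfolding compose_def using S[OF that(3)] that(1,2)
        by (intro restrict_ext) (simp add: mult_apply stab_carrier)
      then show ?thesis using that closed[OF that(2,3)] by (simp add: \<rho>_def)
    qed
    show "\<rho> \<one>\<^bsub>G\<^esub> h = h" if "h \<in> F" for h
    proof -
      have "compose (dom X) \<one>\<^bsub>G\<^esub> h = h"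
        by (rule extensionalityI[of _ "dom X"]) (use that S[OF that] in \<open>auto simp: compose_def one_apply Fiff\<close>)
      then show ?thesis using that by (simp add: \<rho>_def)
    qed
  qed
  have orb: "F = orb (stab ?A) \<rho> f'"
  proof
    show "orb (stab ?A) \<rho> f' \<subseteq> F" by (rule orb_subset[OF act f'F])
    show "F \<subseteq> orb (stab ?A) \<rho> f'"
    proof
      fix h assume h: "h \<in> F"
      then have hs: "strong_map \<sigma> X \<Omega> h" "h \<in> extensional (dom X)" "\<And>y. y \<in> dom Y \<Longrightarrow> h (i y) = e y"
        by (auto simp: Fiff)
      obtain k where k: "k \<in> carrier G" "\<forall>x\<in>dom X. k (f x) = h x"
        using extend_to_automorphism[OF ageD(1)[OF X(2)] f hs(1)] by blast
      have "k (e y) = e y" if "y \<in> dom Y" for y using k(2) i[OF that] fi[OF that] hs(3)[OF that] by fastforce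
      then have kA: "k \<in> stab ?A" using k(1) by (auto simp: stab_iff)
      have "\<rho> k f' = h" unfolding \<rho>_def using f'F
        by (auto simp: f'_def compose_def k(2) intro!: extensionalityI[OF _ hs(2)])
      then show "h \<in> orb (stab ?A) \<rho> f'" using kA by (auto simp: orb_def)
    qed
  qed
  have "isotropy (stab ?A) \<rho> f' = stab ?B"
  proof (intro equalityI subsetI)
    fix g assume "g \<in> isotropy (stab ?A) \<rho> f'"
    then have g: "g \<in> carrier G" "compose (dom X) g f' = f'"
      using f'F by (auto simp: isotropy_def \<rho>_def stab_iff)
    have "g (f x) = f x" if "x \<in> dom X" for x
      using fun_cong[OF g(2), of x] that by (simp add: compose_def f'_def)
    then show "g \<in> stab ?B" using g(1) by (auto simp: stab_iff)
  next
    fix g assume g: "g \<in> stab ?B"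
    then have "g \<in> stab ?A" using stab_antimono[OF AB] by blast
    moreover have "compose (dom X) g f' = f'"
      unfolding compose_def f'_def using g by (intro restrict_ext) (simp add: stab_iff)
    ultimately show "g \<in> isotropy (stab ?A) \<rho> f'" using f'F by (simp add: isotropy_def \<rho>_def)
  qed
  then have base: "base ?A \<rho> f' ?B" using B AB by (simp add: base_def)
  show ?thesis unfolding ext
    by (rule piece_iso_tup(2)[OF open_stab[OF A] order_refl act f'F orb base])
qed

theorem comparison_iso:
  "\<exists>\<Phi> \<in> ring_iso (Theta_struct \<sigma> \<AA>) (Theta_group G S (stabilizer_class G S) :: ('w, 'x) gset int_mpoly set ring).
     \<forall>(Y, X, i) \<in> embs. \<forall>e. embedding \<sigma> Y \<Omega> e \<longrightarrow>
       (\<exists>P \<in> hats. hat_iso G S P (extension_set \<sigma> \<Omega> (Y, X, i) e) \<and>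
          \<Phi> (emb_class \<sigma> \<AA> (Y, X, i)) = set_class G S (stabilizer_class G S) P)"
proof -
  let ?psi = "\<lambda>(U, X, \<rho>). mu.psi_set X \<rho>"
  have phi: "phi nu y \<in> carrier (free_comm_ring hats)" if "y \<in> embs" for y
  proof -
    obtain Y X i where y: "y = (Y, X, i)" by (metis surj_pair)
    obtain A B where "A \<subseteq> B" "finite B" "B \<subseteq> S" "phi nu y = nu A B"
      using phi_nu \<open>y \<in> embs\<close> unfolding y by metis
    then show ?thesis using nu_refl[of A B] by (simp add: pres_eq_def)
  qed
  have psi: "?psi P \<in> carrier (free_comm_ring embs)" if "P \<in> hats" for P :: "('w, 'x) gset"
  proof -
    obtain U X \<rho> where P: "P = (U, X, \<rho>)" by (metis surj_pair)
    obtain A where "tame A X \<rho>" using hat_sets_tame \<open>P \<in> hats\<close> unfolding P by metis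
    from mu.psi_set_eq[OF this] show ?thesis by (simp add: P pres_eq_def)
  qed
  obtain \<Phi> where iso: "\<Phi> \<in> ring_iso (presented_ring embs (Theta_struct_rels \<sigma> \<AA>))
      (presented_ring hats (Theta_group_rels G S (stabilizer_class G S)))"
    and \<Phi>: "\<And>y. y \<in> embs \<Longrightarrow> \<Phi> (gen_class embs (Theta_struct_rels \<sigma> \<AA>) y) =
      (Idl\<^bsub>free_comm_ring hats\<^esub> (Theta_group_rels G S (stabilizer_class G S))) +>\<^bsub>free_comm_ring hats\<^esub> phi nu y"
  proof (rule presented_ring_iso[OF struct_rels_closed hat_rels_closed, of "phi nu" ?psi])
    show "eqg (subst_poly (phi nu) r) 0" if "r \<in> Theta_struct_rels \<sigma> \<AA>" for r
      by (rule phi_struct_rels[OF nu.measure_axioms that])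
    show "eqs (subst_poly ?psi r) 0" if "r \<in> Theta_group_rels G S (stabilizer_class G S)" for r
      by (rule psi_set_hat_rels[OF mu.measure_axioms that])
    show "eqs (subst_poly ?psi (phi nu y)) (var y)" if "y \<in> embs" for y
      using subst_psi_phi that by (cases y) auto
    show "eqg (subst_poly (phi nu) (?psi P)) (var P)" if "P \<in> hats" for P :: "('w, 'x) gset"
      using subst_phi_psi that by (cases P) auto
  qed (use phi psi in auto)
  show ?thesis
  proof (intro bexI[of _ \<Phi>] ballI, clarify)
    fix Y X i e assume Y: "(Y, X, i) \<in> embs" and e: "embedding \<sigma> Y \<Omega> e"
    have es: "strong_map \<sigma> Y \<Omega> e" using e by (simp add: embedding_iff)
    obtain f where f: "strong_map \<sigma> X \<Omega> f" "\<And>y. y \<in> dom Y \<Longrightarrow> f (i y) = e y"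
      using extend_embedding[OF Y es] by metis
    let ?A = "e ` dom Y" and ?B = "f ` dom X"
    have X: "X \<in> \<AA>" "strong_map \<sigma> Y X i" using Y by (auto simp: embs_iff)
    have A: "f ` i ` dom Y = ?A" unfolding image_image using f(2) by simp
    have B: "?A \<subseteq> ?B" "finite ?B" "?B \<subseteq> S"
      using ageD(1)[OF X(1)] strong_mapD(2)[OF f(1)] image_mono[OF strong_mapD(2)[OF X(2)], of f]
      unfolding A by auto
    let ?P = "piece ?A (tup ?A ?B) cact"
    have P: "?P \<in> hats" by (rule piece_hats[OF tup_base(2)[OF B]])
    have "eqg (phi nu (Y, X, i)) (nu ?A ?B)"
      using phi_eq[OF nu.measure_axioms Y f(1)] unfolding A .
    then have "\<Phi> (emb_class \<sigma> \<AA> (Y, X, i)) = set_class G S (stabilizer_class G S) ?P"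
      using \<Phi>[OF Y] pres_eq_iff_coset[OF hat_rels_closed phi[OF Y] free_var[OF P]]
      unfolding emb_class_def set_class_def gen_class_def nu_def by simp
    then show "\<exists>P\<in>hats. hat_iso G S P (extension_set \<sigma> \<Omega> (Y, X, i) e) \<and>
        \<Phi> (emb_class \<sigma> \<AA> (Y, X, i)) = set_class G S (stabilizer_class G S) P"
      using P extension_set_iso[OF Y e f] by blast
  next
    show "\<Phi> \<in> ring_iso (Theta_struct \<sigma> \<AA>) (Theta_group G S (stabilizer_class G S))"
      using iso by (simp add: Theta_struct_def Theta_group_def)
  qed
qed

end

theorem theorem6p9:
  fixes \<sigma> :: "'i signature"
    and \<Omega> :: "('i, 'w) struc"
    and \<AA> :: "('i, 'b) struc set"
    and G :: "('w \<Rightarrow> 'w) monoid"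
    and \<E> :: "('w \<Rightarrow> 'w) set set"
  assumes "is_signature \<sigma>"
    and "is_structure \<sigma> \<Omega>"
    and "homogeneous \<sigma> \<Omega>"
    and "\<AA> = age \<sigma> \<Omega>"
    and "\<And>n. finite ({X \<in> \<AA>. card (dom X) = n} // iso_rel \<sigma>)"
    and "G = Aut \<sigma> \<Omega>"
    and "\<E> = stabilizer_class G (dom \<Omega>)"
    and large_b: "infinite (UNIV :: 'b set)"
    and large_x: "\<exists>h :: nat \<times> 'w list \<Rightarrow> 'x. inj h"
  shows "oligomorphic G (dom \<Omega>) (\<lambda>g. g) \<and>
    (\<exists>\<Phi> \<in> ring_iso (Theta_struct \<sigma> \<AA>) (Theta_group G (dom \<Omega>) \<E> :: ('w, 'x) gset int_mpoly set ring).
       \<forall>(Y, X, i) \<in> embeddings \<sigma> \<AA>. \<forall>e. embedding \<sigma> Y \<Omega> e \<longrightarrow>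
         (\<exists>P \<in> hat_sets G (dom \<Omega>) \<E>.
            hat_iso G (dom \<Omega>) P (extension_set \<sigma> \<Omega> (Y, X, i) e) \<and>
            \<Phi> (emb_class \<sigma> \<AA> (Y, X, i)) = set_class G (dom \<Omega>) \<E> P))"
proof -
  have "\<exists>c :: 'w \<Rightarrow> 'b. inj_on c A" if A: "finite A" for A
  proof -
    obtain B :: "'b set" where B: "finite B" "card B = card A"
      using infinite_arbitrarily_large[OF large_b] by blast
    then obtain c where "bij_betw c A B" using finite_same_card_bij[OF A B(1)] by metis
    then show ?thesis by (auto simp: bij_betw_def)
  qed
  then have "\<forall>A. \<exists>c :: 'w \<Rightarrow> 'b. finite A \<longrightarrow> inj_on c A" by blast
  then obtain cp :: "'w set \<Rightarrow> 'w \<Rightarrow> 'b" where cp: "\<forall>A. finite A \<longrightarrow> inj_on (cp A) A"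
    by (rule choice[THEN exE])
  obtain h :: "nat \<times> 'w list \<Rightarrow> 'x" where h: "inj h" using large_x by blast
  then have "inj (\<lambda>xs. h (0, xs))" by (auto simp: inj_def)
  then interpret coded_homogeneous_structure \<sigma> \<Omega> cp "\<lambda>xs. h (0, xs)"
    using assms(2,3,5) cp unfolding assms(4) by unfold_locales auto
  show ?thesis
    using oligomorphic_Aut comparison_iso unfolding assms(4,6,7) by blast
qed

end
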